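(* Let $G=S_n$ and $H=S_b\wr S_a$ (the stabiliser of a partition of $\{1,\dots,n\}$ into $a$ blocks of size $b$), where $n=ab$, $a\geqslant b\geqslant 2$ and $(a,b)\neq(2,2)$. Then $b(G,H)=4$ if $(a,b)=(3,2)$; $b(G,H)=2$ if $b\geqslant 3$ and $a\geqslant \max\{b+3,8\}$; and $b(G,H)=3$ otherwise.
   Context: For a subgroup $H\leqslant G$, $H_G=\bigcap_{g\in G}H^g$ is the core of $H$, and $b(G,H)=\min\{|S| : S\subseteq G,\ \bigcap_{g\in S}H^g=H_G\}$. Equivalently here, $b(G,H)$ is the minimal number of partitions of $\{1,\dots,n\}$ into $a$ parts of size $b$ whose common stabiliser in $S_n$ is trivial. *)

theory Defs
  imports "HOL-Combinatorics.Permutations"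
begin

definition Sym :: "nat \<Rightarrow> (nat \<Rightarrow> nat) set" where
  "Sym n = {\<sigma>. \<sigma> permutes {..<n}}"

definition std_partition :: "nat \<Rightarrow> nat \<Rightarrow> nat set set" where
  "std_partition a b = (\<lambda>i. {i*b..<(i+1)*b}) ` {..<a}"

text \<open>Stabiliser in Sym n of a set system P (for P = std_partition a b this is S_b wr S_a).\<close>
definition stab :: "nat \<Rightarrow> nat set set \<Rightarrow> (nat \<Rightarrow> nat) set" where
  "stab n P = {\<sigma> \<in> Sym n. (\<lambda>B. \<sigma> ` B) ` P = P}"

definition conjugate :: "(nat \<Rightarrow> nat) set \<Rightarrow> (nat \<Rightarrow> nat) \<Rightarrow> (nat \<Rightarrow> nat) set" where
  "conjugate H g = {inv g \<circ> h \<circ> g | h. h \<in> H}"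

definition core :: "(nat \<Rightarrow> nat) set \<Rightarrow> (nat \<Rightarrow> nat) set \<Rightarrow> (nat \<Rightarrow> nat) set" where
  "core G H = (\<Inter>g\<in>G. conjugate H g)"

definition base_size :: "(nat \<Rightarrow> nat) set \<Rightarrow> (nat \<Rightarrow> nat) set \<Rightarrow> nat" where
  "base_size G H = (LEAST k. \<exists>S. S \<subseteq> G \<and> finite S \<and> card S = k \<and>
                      (\<Inter>g\<in>S. conjugate H g) = core G H)"

end

theory Submission
  imports Defs
begin

text \<open>
  A conjugate of the stabiliser of the standard partition is the stabiliser of the kernel of a
  labelling of the \<open>n\<close> points by \<open>a\<close> labels, each used \<open>b\<close> times, so the base size is the least
  number of such labellings that are preserved together only by the identity.

  Two labellings form a \<open>b\<close>-regular bipartite multigraph on \<open>a + a\<close> vertices, the points being its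
  edges. They suffice iff this graph is simple and has no nontrivial automorphism preserving the
  sides; passing to the complement replaces \<open>b\<close> by \<open>a - b\<close>. For degree at most \<open>2\<close>, such an
  automorphism always exists (rotate a cycle by two steps). For degree \<open>3\<close> and \<open>a \<in> {6, 7}\<close> it exists
  by a finite case distinction: a certificate lists how the graph can be explored vertex by vertex
  until an automorphism becomes visible. In all other cases a cyclic band matrix with one switch is
  rigid, since the rows sharing all but one of their columns form a few paths of distinguishable
  shape; only \<open>a = 8\<close> with degree \<open>3\<close> needs a separate graph.

  If two labellings do not suffice, three do: for \<open>b \<ge> 3\<close> take the rows and columns of a band matrix
  and shift one special point from each row to the previous one; for \<open>b = 2\<close> add a set of chords
  to an even cycle. The six points of \<open>(a, b) = (3, 2)\<close> carry only \<open>15\<close> pairings, any three of which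
  commute with a common fourth one.
\<close>

section \<open>Labellings and base size\<close>

text \<open>The thresholds of the theorem are statements about degrees. Two labellings suffice iff a
  rigid graph of degree \<open>b\<close> exists, equivalently one of degree \<open>a - b\<close>.
  Degrees 0, 1 and 2 never allow one, whence \<open>b \<ge> 3\<close> and
  \<open>a \<ge> b + 3\<close>; degree 3 allows one only from \<open>a = 8\<close> on, which further
  excludes just (6,3), (7,3) and (7,4). The obstacle to rigidity is symmetry: a cyclic band has all
  rotations as automorphisms, and a switch of two edges is the smallest change that keeps every
  degree. Of an automorphism only its action on rows is followed, through the number of columns in
  which two rows differ; the columns come last, since distinct columns have distinct sets of rows.
  The core is never computed: one separating family already forces it to be trivial. In the excluded
  case (2,2) it is the Klein four-group.\<close>

definition preserves :: "'a set \<Rightarrow> ('a \<Rightarrow> nat) \<Rightarrow> ('a \<Rightarrow> 'a) \<Rightarrow> bool" where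
  "preserves X f \<sigma> \<longleftrightarrow> (\<forall>x\<in>X. \<forall>y\<in>X. f x = f y \<longleftrightarrow> f (\<sigma> x) = f (\<sigma> y))"

definition balanced :: "'a set \<Rightarrow> nat \<Rightarrow> nat \<Rightarrow> ('a \<Rightarrow> nat) \<Rightarrow> bool" where
  "balanced X a b f \<longleftrightarrow> f ` X \<subseteq> {..<a} \<and> (\<forall>v<a. card {x \<in> X. f x = v} = b)"

definition separating :: "'a set \<Rightarrow> ('a \<Rightarrow> nat) list \<Rightarrow> bool" where
  "separating X fs \<longleftrightarrow> (\<forall>\<sigma>. \<sigma> permutes X \<and> (\<forall>f\<in>set fs. preserves X f \<sigma>) \<longrightarrow> \<sigma> = id)"

lemma preservesD:
  "preserves X f \<sigma> \<Longrightarrow> x \<in> X \<Longrightarrow> y \<in> X \<Longrightarrow> f (\<sigma> x) = f (\<sigma> y) \<longleftrightarrow> f x = f y"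
  unfolding preserves_def by blast

lemma block_eq:
  fixes b i :: nat
  assumes "0 < b"
  shows "{i * b..<(i + 1) * b} = {x. x div b = i}"
proof (intro set_eqI iffI)
  fix x assume "x \<in> {i * b..<(i + 1) * b}"
  then have "x div b = i" by (intro div_nat_eqI) (auto simp: mult.commute)
  then show "x \<in> {x. x div b = i}" by simp
next
  fix x assume "x \<in> {x. x div b = i}"
  then have i: "x div b = i" by simp
  then show "x \<in> {i * b..<(i + 1) * b}"
    using div_mult_mod_eq[of x b] mod_less_divisor[OF assms, of x] unfolding i by simp
qed

text \<open>Blocks are the fibres of \<open>x div b\<close>. A permutation that keeps this kernel
  sends blocks onto blocks; on the finite set of blocks this map is injective, hence onto, which
  gives the equality demanded by \<open>stab\<close>.\<close>

lemma mem_stab_iff: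
  assumes "n = a * b" "0 < b"
  shows "\<sigma> \<in> stab n (std_partition a b) \<longleftrightarrow> \<sigma> permutes {..<n} \<and> preserves {..<n} (\<lambda>x. x div b) \<sigma>"
proof -
  define B where "B i = {x. x div b = i}" for i
  have P: "std_partition a b = B ` {..<a}"
    using block_eq[OF assms(2)] by (simp add: std_partition_def B_def)
  have lt: "x div b < a \<longleftrightarrow> x < n" for x
    using assms by (simp add: div_less_iff_less_mult)
  have ne: "i * b \<in> B i" for i using assms(2) by (simp add: B_def)
  show ?thesis
  proof (cases "\<sigma> permutes {..<n}")
    case True
    have mem: "\<sigma> x < n \<longleftrightarrow> x < n" for x using permutes_in_image[OF True] by simp
    have "(\<lambda>B. \<sigma> ` B) ` std_partition a b = std_partition a b \<longleftrightarrow> preserves {..<n} (\<lambda>x. x div b) \<sigma>"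
    proof
      assume eq: "(\<lambda>B. \<sigma> ` B) ` std_partition a b = std_partition a b"
      show "preserves {..<n} (\<lambda>x. x div b) \<sigma>"
        unfolding preserves_def
      proof (intro ballI iffI)
        fix x y assume xy: "x \<in> {..<n}" "y \<in> {..<n}"
        { assume "x div b = y div b"
          moreover have "\<sigma> ` B (x div b) \<in> std_partition a b"
            using eq P xy lt by (metis imageI lessThan_iff)
          then obtain j where "\<sigma> ` B (x div b) = B j" by (auto simp: P)
          ultimately have "\<sigma> x \<in> B j" "\<sigma> y \<in> B j" by (auto simp: B_def)
          then show "\<sigma> x div b = \<sigma> y div b" by (simp add: B_def) }
        { assume s: "\<sigma> x div b = \<sigma> y div b"
          have "B (\<sigma> x div b) \<in> std_partition a b"
            unfolding P using xy lt[of "\<sigma> x"] mem[of x] by simp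
          then have "B (\<sigma> x div b) \<in> (\<lambda>B. \<sigma> ` B) ` std_partition a b"
            unfolding eq .
          then obtain i where "B (\<sigma> x div b) = \<sigma> ` B i" by (auto simp: P)
          moreover have "\<sigma> x \<in> B (\<sigma> x div b)" "\<sigma> y \<in> B (\<sigma> x div b)" using s by (auto simp: B_def)
          ultimately have "x \<in> B i" "y \<in> B i"
            using permutes_inj[OF True] by (auto simp: inj_image_mem_iff)
          then show "x div b = y div b" by (simp add: B_def) }
      qed
    next
      assume pres: "preserves {..<n} (\<lambda>x. x div b) \<sigma>"
      have "\<sigma> ` B i \<in> B ` {..<a}" if "i < a" for i
      proof -
        have ib: "i * b < n" using that assms by simp
        have "\<sigma> ` B i = B (\<sigma> (i * b) div b)"
        proof (intro set_eqI iffI)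
          fix y assume "y \<in> \<sigma> ` B i"
          then obtain x where x: "x div b = i" "y = \<sigma> x" by (auto simp: B_def)
          then have "x < n" using lt[of x] that by simp
          then show "y \<in> B (\<sigma> (i * b) div b)"
            using preservesD[OF pres, of x "i * b"] ib x assms(2) by (simp add: B_def)
        next
          fix y assume y: "y \<in> B (\<sigma> (i * b) div b)"
          obtain x where x: "y = \<sigma> x" using permutes_surj[OF True] by auto
          have "\<sigma> x div b = \<sigma> (i * b) div b" using y x by (simp add: B_def)
          then have "\<sigma> x < n" using lt[of "\<sigma> x"] lt[of "\<sigma> (i * b)"] ib mem by simp
          then show "y \<in> \<sigma> ` B i"
            using preservesD[OF pres, of x "i * b"] ib mem[of x] x y assms(2) by (simp add: B_def)
        qed
        moreover have "\<sigma> (i * b) div b < a" using mem lt ib by simp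
        ultimately show ?thesis by simp
      qed
      then have "(\<lambda>B. \<sigma> ` B) ` (B ` {..<a}) \<subseteq> B ` {..<a}" by auto
      moreover have "inj_on (\<lambda>B. \<sigma> ` B) (B ` {..<a})"
        using permutes_inj[OF True] by (simp add: inj_on_def inj_image_eq_iff)
      ultimately show "(\<lambda>B. \<sigma> ` B) ` std_partition a b = std_partition a b"
        unfolding P by (intro endo_inj_surj) auto
    qed
    then show ?thesis using True by (simp add: stab_def Sym_def)
  qed (simp add: stab_def Sym_def)
qed

text \<open>Conjugating back, \<open>g \<circ> \<tau> \<circ> inv g\<close> must stabilise the
  standard partition; read through the bijection \<open>g\<close>, the labelling
  \<open>x div b\<close> becomes \<open>g x div b\<close>.\<close>

lemma mem_conjugate_stab_iff:
  assumes "n = a * b" "0 < b" and g: "g \<in> Sym n"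
  shows "\<tau> \<in> conjugate (stab n (std_partition a b)) g \<longleftrightarrow>
           \<tau> permutes {..<n} \<and> preserves {..<n} (\<lambda>x. g x div b) \<tau>"
proof -
  have g: "g permutes {..<n}" using g by (simp add: Sym_def)
  note gi = permutes_inverses[OF g]
  have "\<tau> \<in> conjugate (stab n (std_partition a b)) g \<longleftrightarrow> g \<circ> \<tau> \<circ> inv g \<in> stab n (std_partition a b)"
  proof
    assume "\<tau> \<in> conjugate (stab n (std_partition a b)) g"
    then obtain h where "\<tau> = inv g \<circ> h \<circ> g" "h \<in> stab n (std_partition a b)"
      by (auto simp: conjugate_def)
    moreover from this have "g \<circ> \<tau> \<circ> inv g = h" by (simp add: fun_eq_iff gi)
    ultimately show "g \<circ> \<tau> \<circ> inv g \<in> stab n (std_partition a b)" by simp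
  next
    assume "g \<circ> \<tau> \<circ> inv g \<in> stab n (std_partition a b)"
    moreover have "\<tau> = inv g \<circ> (g \<circ> \<tau> \<circ> inv g) \<circ> g" by (simp add: fun_eq_iff gi)
    ultimately show "\<tau> \<in> conjugate (stab n (std_partition a b)) g"
      unfolding conjugate_def by blast
  qed
  also have "\<dots> \<longleftrightarrow> g \<circ> \<tau> \<circ> inv g permutes {..<n} \<and> preserves {..<n} (\<lambda>x. x div b) (g \<circ> \<tau> \<circ> inv g)"
    by (rule mem_stab_iff[OF assms(1,2)])
  also have "g \<circ> \<tau> \<circ> inv g permutes {..<n} \<longleftrightarrow> \<tau> permutes {..<n}"
  proof
    assume h: "g \<circ> \<tau> \<circ> inv g permutes {..<n}"
    have "inv g \<circ> (g \<circ> \<tau> \<circ> inv g) \<circ> g permutes {..<n}"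
      by (rule permutes_compose[OF g permutes_compose[OF h permutes_inv[OF g]]])
    moreover have "inv g \<circ> (g \<circ> \<tau> \<circ> inv g) \<circ> g = \<tau>" by (simp add: fun_eq_iff gi)
    ultimately show "\<tau> permutes {..<n}" by simp
  qed (intro permutes_compose g permutes_inv)
  also have "preserves {..<n} (\<lambda>x. x div b) (g \<circ> \<tau> \<circ> inv g) \<longleftrightarrow> preserves {..<n} (\<lambda>x. g x div b) \<tau>"
  proof -
    have X: "g ` {..<n} = {..<n}" by (rule permutes_image[OF g])
    have "preserves {..<n} (\<lambda>x. x div b) (g \<circ> \<tau> \<circ> inv g) \<longleftrightarrow>
        preserves (g ` {..<n}) (\<lambda>x. x div b) (g \<circ> \<tau> \<circ> inv g)" unfolding X ..
    also have "\<dots> \<longleftrightarrow> preserves {..<n} (\<lambda>x. g x div b) \<tau>"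
      unfolding preserves_def ball_simps by (simp add: gi)
    finally show ?thesis .
  qed
  finally show ?thesis .
qed

lemma balanced_of_perm:
  assumes "n = a * b" "0 < b" and g: "g \<in> Sym n"
  shows "balanced {..<n} a b (\<lambda>x. g x div b)"
  unfolding balanced_def
proof (intro conjI allI impI)
  have g: "g permutes {..<n}" using g by (simp add: Sym_def)
  have lt: "x div b < a \<longleftrightarrow> x < n" for x
    using assms by (simp add: div_less_iff_less_mult)
  show "(\<lambda>x. g x div b) ` {..<n} \<subseteq> {..<a}" using lt permutes_in_image[OF g] by auto
  fix v assume v: "v < a"
  have "g ` {x \<in> {..<n}. g x div b = v} = {v * b..<(v + 1) * b}"
    unfolding block_eq[OF assms(2)]
  proof (intro set_eqI iffI)
    fix y assume y: "y \<in> {x. x div b = v}"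
    obtain x where "y = g x" using permutes_surj[OF g] by auto
    moreover have "y < n" using y v lt by auto
    ultimately show "y \<in> g ` {x \<in> {..<n}. g x div b = v}"
      using y permutes_in_image[OF g, of x] by auto
  qed auto
  then have "card {x \<in> {..<n}. g x div b = v} = card {v * b..<(v + 1) * b}"
    using permutes_inj[OF g] by (metis (no_types, lifting) card_image inj_on_subset subset_UNIV)
  then show "card {x \<in> {..<n}. g x div b = v} = b" by simp
qed

text \<open>Converse of \<open>balanced_of_perm\<close>: bijections from the fibres of
  \<open>f\<close> onto the blocks are glued to one permutation. Thus every balanced labelling
  stands for a conjugate of the stabiliser.\<close>

lemma perm_of_balanced:
  assumes "n = a * b" "0 < b" and f: "balanced {..<n} a b f"
  obtains g where "g \<in> Sym n" "\<And>x. x < n \<Longrightarrow> g x div b = f x"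
proof -
  have "\<exists>h. bij_betw h {x \<in> {..<n}. f x = v} {v * b..<(v + 1) * b}" if "v < a" for v
    using f that by (intro finite_same_card_bij) (auto simp: balanced_def)
  then obtain h where h: "\<And>v. v < a \<Longrightarrow> bij_betw (h v) {x \<in> {..<n}. f x = v} {v * b..<(v + 1) * b}"
    by metis
  define g where "g x = (if x < n then h (f x) x else x)" for x
  have fa: "f x < a" if "x < n" for x using f that by (auto simp: balanced_def)
  have gf: "g x div b = f x" if "x < n" for x
  proof -
    have "h (f x) x \<in> {f x * b..<(f x + 1) * b}"
      using bij_betwE[OF h[OF fa[OF that]]] that by auto
    then show ?thesis using that unfolding block_eq[OF assms(2)] by (simp add: g_def)
  qed
  have "inj_on g {..<n}"
  proof (rule inj_onI)
    fix x y assume xy: "x \<in> {..<n}" "y \<in> {..<n}" "g x = g y"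
    then have "f x = f y" using gf by (metis lessThan_iff)
    then show "x = y"
      using xy bij_betw_imp_inj_on[OF h[OF fa[of x]]] by (auto simp: g_def inj_on_def)
  qed
  moreover have "g ` {..<n} \<subseteq> {..<n}"
    using gf fa assms(1,2) by (auto simp flip: div_less_iff_less_mult)
  ultimately have "bij_betw g {..<n} {..<n}" by (simp add: bij_betw_def endo_inj_surj)
  then have "g permutes {..<n}" by (intro bij_imp_permutes) (auto simp: g_def)
  then show thesis using that[of g] gf by (simp add: Sym_def)
qed

lemma preserves_cong:
  "(\<And>x. x \<in> X \<Longrightarrow> f x = g x) \<Longrightarrow> \<sigma> permutes X \<Longrightarrow> preserves X f \<sigma> \<longleftrightarrow> preserves X g \<sigma>"
  unfolding preserves_def by (auto simp: permutes_in_image)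

text \<open>The bridge from groups to labellings. Lists replace sets of group elements, so
  \<open>lower\<close> can speak of length exactly \<open>k\<close>: smaller families are
  padded.\<close>

lemma base_size_eq_Suc:
  assumes n: "n = a * b" "0 < b"
    and fs: "length fs = Suc k" "\<forall>f\<in>set fs. balanced {..<n} a b f" "separating {..<n} fs"
    and lower: "\<And>fs. length fs = k \<Longrightarrow> \<forall>f\<in>set fs. balanced {..<n} a b f \<Longrightarrow> \<not> separating {..<n} fs"
  shows "base_size (Sym n) (stab n (std_partition a b)) = Suc k"
proof -
  define H where "H = stab n (std_partition a b)"
  note conj_iff = mem_conjugate_stab_iff[OF n, folded H_def]
  have "\<forall>f\<in>set fs. \<exists>g. g \<in> Sym n \<and> (\<forall>x<n. g x div b = f x)"
    using perm_of_balanced[OF n] fs(2) by metis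
  then obtain g where g: "\<And>f. f \<in> set fs \<Longrightarrow> g f \<in> Sym n"
      "\<And>f x. f \<in> set fs \<Longrightarrow> x < n \<Longrightarrow> g f x div b = f x"
    by metis
  define S where "S = g ` set fs"
  \<comment> \<open>Only \<open>\<le>\<close> for the cardinality, since \<open>fs\<close> may
    repeat labellings; equality comes from \<open>min\<close> at the end.\<close>
  have S: "S \<subseteq> Sym n" "finite S" "card S \<le> Suc k"
    using g(1) fs(1) by (auto simp: S_def intro: order_trans[OF card_image_le] card_length)
      (metis card_image_le card_length finite_set le_trans)
  have id_conj: "id \<in> conjugate H g" if "g \<in> Sym n" for g
    using conj_iff[OF that] by (simp add: permutes_id preserves_def)
  have S_id: "(\<Inter>g\<in>S. conjugate H g) = {id}"
  proof -
    have "\<sigma> = id" if \<sigma>: "\<sigma> \<in> (\<Inter>g\<in>S. conjugate H g)" for \<sigma>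
    proof -
      have *: "\<sigma> permutes {..<n} \<and> preserves {..<n} f \<sigma>" if f: "f \<in> set fs" for f
      proof -
        have "\<sigma> \<in> conjugate H (g f)" using \<sigma> f by (auto simp: S_def)
        then have "\<sigma> permutes {..<n}" "preserves {..<n} (\<lambda>x. g f x div b) \<sigma>"
          using conj_iff[OF g(1)[OF f]] by auto
        then show ?thesis using preserves_cong[of "{..<n}" f "\<lambda>x. g f x div b" \<sigma>] g(2)[OF f] by simp
      qed
      have "fs \<noteq> []" using fs(1) by auto
      then have "\<sigma> permutes {..<n}" using * by (meson last_in_set)
      then show "\<sigma> = id" using fs(3) * by (auto simp: separating_def)
    qed
    then show ?thesis using id_conj S(1) by blast
  qed
  \<comment> \<open>The core intersects a larger family whose members all contain \<open>id\<close>,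
    so it collapses together with the intersection over \<open>S\<close>.\<close>
  have core: "core (Sym n) H = {id}"
    using S_id S(1) id_conj unfolding core_def by blast
  have min: "Suc k \<le> card R" if R: "R \<subseteq> Sym n" "finite R" "(\<Inter>g\<in>R. conjugate H g) = {id}" for R
  proof (rule ccontr)
    assume "\<not> Suc k \<le> card R"
    obtain gs where gs: "set gs = R" "length gs = card R"
      using finite_distinct_list[OF R(2)] by (metis distinct_card)
    \<comment> \<open>Padding with \<open>id\<close> means repeating the standard labelling. A
      nontrivial permutation preserving the longer list preserves in particular the labellings
      coming from \<open>R\<close>.\<close>
    define gs' where "gs' = gs @ replicate (k - card R) id"
    have len: "length gs' = k" using gs \<open>\<not> Suc k \<le> card R\<close> by (simp add: gs'_def)
    have sub: "set gs' \<subseteq> Sym n" using gs R(1) by (auto simp: gs'_def Sym_def permutes_id)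
    have "\<not> separating {..<n} (map (\<lambda>g x. g x div b) gs')"
      by (rule lower) (use len sub balanced_of_perm[OF n] in auto)
    then obtain \<sigma> where \<sigma>: "\<sigma> permutes {..<n}" "\<sigma> \<noteq> id"
        "\<And>g. g \<in> set gs' \<Longrightarrow> preserves {..<n} (\<lambda>x. g x div b) \<sigma>"
      by (auto simp: separating_def)
    have "\<sigma> \<in> (\<Inter>g\<in>R. conjugate H g)"
    proof
      fix g assume "g \<in> R"
      then show "\<sigma> \<in> conjugate H g"
        using \<sigma> conj_iff[of g] R(1) gs by (auto simp: gs'_def)
    qed
    then show False using R(3) \<sigma>(2) by simp
  qed
  have "card S = Suc k" using min[OF S(1,2) S_id] S(3) by simp
  then show ?thesis
    unfolding base_size_def H_def[symmetric] core
    using S S_id min by (intro Least_equality) blast+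
qed

section \<open>Changing the set of points\<close>

lemma separating_transfer:
  assumes h: "bij_betw h Y X" and sep: "separating X fs"
  shows "separating Y (map (\<lambda>f. f \<circ> h) fs)"
  unfolding separating_def
proof (intro allI impI)
  fix \<sigma> assume "\<sigma> permutes Y \<and> (\<forall>f\<in>set (map (\<lambda>f. f \<circ> h) fs). preserves Y f \<sigma>)"
  then have \<sigma>: "\<sigma> permutes Y" and pres: "\<And>f. f \<in> set fs \<Longrightarrow> preserves Y (f \<circ> h) \<sigma>" by auto
  define \<tau> where "\<tau> = (\<lambda>x. if x \<in> X then h (\<sigma> (inv_into Y h x)) else x)"
  have hY: "h ` Y = X" using h by (simp add: bij_betw_def)
  have th: "\<tau> (h y) = h (\<sigma> y)" if "y \<in> Y" for y
    using that h hY by (auto simp: \<tau>_def bij_betw_inv_into_left)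
  have "\<tau> permutes X" unfolding \<tau>_def by (rule permutes_bij_inv_into[OF \<sigma> h])
  moreover have "preserves X f \<tau>" if "f \<in> set fs" for f
    using pres[OF that] unfolding preserves_def hY[symmetric] ball_simps by (simp add: th)
  ultimately have "\<tau> = id" using sep by (auto simp: separating_def)
  then have "\<sigma> y = y" if "y \<in> Y" for y
    using th[OF that] that h permutes_in_image[OF \<sigma>] by (auto simp: bij_betw_def inj_on_def)
  then show "\<sigma> = id" using permutes_not_in[OF \<sigma>] by (metis eq_id_iff)
qed

lemma balanced_transfer:
  assumes h: "bij_betw h Y X" and f: "balanced X a b f"
  shows "balanced Y a b (f \<circ> h)"
  unfolding balanced_def
proof (intro conjI allI impI)
  have hY: "h ` Y = X" using h by (simp add: bij_betw_def)
  show "(f \<circ> h) ` Y \<subseteq> {..<a}" using f hY by (auto simp: balanced_def)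
  fix v assume "v < a"
  have "h ` {y \<in> Y. (f \<circ> h) y = v} = {x \<in> X. f x = v}" using hY by auto
  moreover have "inj_on h {y \<in> Y. (f \<circ> h) y = v}"
    using h by (auto simp: bij_betw_def intro: inj_on_subset)
  ultimately have "card {y \<in> Y. (f \<circ> h) y = v} = card {x \<in> X. f x = v}"
    by (metis card_image)
  then show "card {y \<in> Y. (f \<circ> h) y = v} = b" using f \<open>v < a\<close> by (simp add: balanced_def)
qed

lemma balanced_card:
  assumes "finite X" "balanced X a b f"
  shows "card X = a * b"
proof -
  have "X = (\<Union>v\<in>{..<a}. {x \<in> X. f x = v})" using assms by (auto simp: balanced_def)
  also have "card \<dots> = (\<Sum>v<a. card {x \<in> X. f x = v})"
    using assms(1) by (intro card_UN_disjoint) auto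
  finally show ?thesis using assms by (simp add: balanced_def)
qed

text \<open>Most constructions below take the edges of a graph as points; this brings them back to
  the points on which the group acts.\<close>

lemma separating_on_nat:
  assumes "finite X" "fs \<noteq> []" "\<forall>f\<in>set fs. balanced X a b f" "separating X fs"
  obtains gs where "length gs = length fs" "\<forall>g\<in>set gs. balanced {..<a * b} a b g"
    "separating {..<a * b} gs"
proof -
  obtain f where "f \<in> set fs" using assms(2) by (meson last_in_set)
  then have "card X = a * b" using balanced_card assms by blast
  then obtain h where "bij_betw h {..<a * b} X"
    using finite_same_card_bij[of "{..<a * b}" X] assms(1) by auto
  then show thesis
    using that[of "map (\<lambda>f. f \<circ> h) fs"] separating_transfer assms(3,4) balanced_transfer by fastforce
qed

text \<open>A permutation respecting the classes of \<open>f\<close> acts on the labels: the label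
  of the image does not depend on the representative chosen by \<open>SOME\<close>.\<close>

lemma preserves_induced_perm:
  assumes \<sigma>: "\<sigma> permutes X" "preserves X f \<sigma>" and f: "f ` X = {..<a}"
  obtains \<rho> where "\<rho> permutes {..<a}" "\<And>x. x \<in> X \<Longrightarrow> \<rho> (f x) = f (\<sigma> x)"
proof -
  define \<rho> where "\<rho> i = (if i < a then f (\<sigma> (SOME x. x \<in> X \<and> f x = i)) else i)" for i
  have \<rho>: "\<rho> (f x) = f (\<sigma> x)" if x: "x \<in> X" for x
  proof -
    have "(SOME y. y \<in> X \<and> f y = f x) \<in> X \<and> f (SOME y. y \<in> X \<and> f y = f x) = f x"
      by (rule someI[of _ x]) (simp add: x)
    moreover have "f x < a" using f x by auto
    ultimately show ?thesis using preservesD[OF \<sigma>(2)] x by (simp add: \<rho>_def)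
  qed
  have "inj_on \<rho> {..<a}"
    unfolding f[symmetric] inj_on_def using preservesD[OF \<sigma>(2)] by (auto simp: \<rho>)
  moreover have "\<rho> ` {..<a} \<subseteq> {..<a}"
    unfolding f[symmetric] using permutes_in_image[OF \<sigma>(1)] by (auto simp: \<rho>)
  ultimately have "bij_betw \<rho> {..<a} {..<a}" by (simp add: bij_betw_def endo_inj_surj)
  then have "\<rho> permutes {..<a}" by (intro bij_imp_permutes) (auto simp: \<rho>_def)
  then show thesis using that \<rho> by blast
qed

lemma balanced_image:
  assumes "balanced X a b f" "0 < b"
  shows "f ` X = {..<a}"
proof
  show "{..<a} \<subseteq> f ` X"
  proof
    fix v assume "v \<in> {..<a}"
    then have "card {x \<in> X. f x = v} \<noteq> 0" using assms by (simp add: balanced_def)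
    then have "{x \<in> X. f x = v} \<noteq> {}" by (metis card.empty)
    then show "v \<in> f ` X" by auto
  qed
qed (use assms in \<open>simp add: balanced_def\<close>)

section \<open>Regular bipartite graphs\<close>

definition regular :: "nat \<Rightarrow> nat \<Rightarrow> (nat \<times> nat) set \<Rightarrow> bool" where
  "regular a k E \<longleftrightarrow> E \<subseteq> {..<a} \<times> {..<a} \<and>
     (\<forall>i<a. card {j. (i, j) \<in> E} = k) \<and> (\<forall>j<a. card {i. (i, j) \<in> E} = k)"

text \<open>Rows and columns are permuted separately and never exchanged, since each of the two
  labellings has to be preserved by itself.\<close>

definition bip_rigid :: "nat \<Rightarrow> (nat \<times> nat) set \<Rightarrow> bool" where
  "bip_rigid a E \<longleftrightarrow> (\<forall>\<rho> \<gamma>. \<rho> permutes {..<a} \<and> \<gamma> permutes {..<a} \<and>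
     (\<forall>i j. (i, j) \<in> E \<longleftrightarrow> (\<rho> i, \<gamma> j) \<in> E) \<longrightarrow> \<rho> = id \<and> \<gamma> = id)"

lemma regular_converse: "regular a k E \<Longrightarrow> regular a k (E\<inverse>)"
  by (auto simp: regular_def)

lemma regular_finite: "regular a k E \<Longrightarrow> finite E"
  by (auto simp: regular_def intro: finite_subset[of E "{..<a} \<times> {..<a}"])

text \<open>Mapping edges to edges in one direction suffices:
  \<open>map_prod \<rho> \<gamma>\<close> is injective and \<open>E\<close> is finite, so the image
  of \<open>E\<close> is all of \<open>E\<close>.\<close>

lemma not_bip_rigidI:
  assumes "regular a k E" and \<rho>: "\<rho> permutes {..<a}" and \<gamma>: "\<gamma> permutes {..<a}"
    and E: "\<And>i j. (i, j) \<in> E \<Longrightarrow> (\<rho> i, \<gamma> j) \<in> E" and "\<rho> \<noteq> id \<or> \<gamma> \<noteq> id"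
  shows "\<not> bip_rigid a E"
proof -
  have fin: "finite E" by (rule regular_finite[OF assms(1)])
  have inj: "inj (map_prod \<rho> \<gamma>)"
    using permutes_inj[OF \<rho>] permutes_inj[OF \<gamma>] by (rule prod.inj_map)
  have "map_prod \<rho> \<gamma> ` E = E"
    by (rule endo_inj_surj[OF fin]) (use E inj in \<open>auto intro: inj_on_subset\<close>)
  then have "(i, j) \<in> E \<longleftrightarrow> (\<rho> i, \<gamma> j) \<in> E" for i j
    using inj_image_mem_iff[OF inj, of "(i, j)" E] by simp
  then show ?thesis using assms unfolding bip_rigid_def by blast
qed

lemma regular_balanced:
  assumes "regular a b E"
  shows "balanced E a b fst" and "balanced E a b snd"
proof -
  have "{e \<in> E. fst e = v} = Pair v ` {j. (v, j) \<in> E}" for v by force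
  then have "card {e \<in> E. fst e = v} = card {j. (v, j) \<in> E}" for v
    by (simp add: card_image inj_on_def)
  then show "balanced E a b fst" using assms by (auto simp: balanced_def regular_def)
  have "{e \<in> E. snd e = v} = (\<lambda>i. (i, v)) ` {i. (i, v) \<in> E}" for v by force
  then have "card {e \<in> E. snd e = v} = card {i. (i, v) \<in> E}" for v
    by (simp add: card_image inj_on_def)
  then show "balanced E a b snd" using assms by (auto simp: balanced_def regular_def)
qed

text \<open>A permutation of the edges preserving both labellings induces a row and a column
  permutation, which form an automorphism. If both are trivial, each edge is pinned by its two
  ends.\<close>

lemma bip_rigid_imp_separating:
  assumes reg: "regular a b E" and "bip_rigid a E" and "0 < b"
  shows "separating E [fst, snd]"
  unfolding separating_def
proof (intro allI impI)
  fix \<sigma> assume "\<sigma> permutes E \<and> (\<forall>f\<in>set [fst, snd]. preserves E f \<sigma>)"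
  then have \<sigma>: "\<sigma> permutes E" "preserves E fst \<sigma>" "preserves E snd \<sigma>" by auto
  obtain \<rho> where \<rho>: "\<rho> permutes {..<a}" "\<And>e. e \<in> E \<Longrightarrow> \<rho> (fst e) = fst (\<sigma> e)"
    using preserves_induced_perm[OF \<sigma>(1,2) balanced_image[OF regular_balanced(1)[OF reg] \<open>0 < b\<close>]] by blast
  obtain \<gamma> where \<gamma>: "\<gamma> permutes {..<a}" "\<And>e. e \<in> E \<Longrightarrow> \<gamma> (snd e) = snd (\<sigma> e)"
    using preserves_induced_perm[OF \<sigma>(1,3) balanced_image[OF regular_balanced(2)[OF reg] \<open>0 < b\<close>]] by blast
  have "(\<rho> i, \<gamma> j) \<in> E" if "(i, j) \<in> E" for i j
    using \<rho>(2)[OF that] \<gamma>(2)[OF that] permutes_in_image[OF \<sigma>(1), of "(i, j)"] that by simp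
  then have "\<rho> = id \<and> \<gamma> = id" using not_bip_rigidI[OF reg \<rho>(1) \<gamma>(1)] assms(2) by blast
  then have "\<sigma> e = e" if "e \<in> E" for e
    using \<rho>(2)[OF that] \<gamma>(2)[OF that] by (simp add: prod_eq_iff)
  then show "\<sigma> = id" using permutes_not_in[OF \<sigma>(1)] by (metis eq_id_iff)
qed

lemma separating_imp_bip_rigid:
  assumes f: "balanced X a b f" and g: "balanced X a b g" and "finite X" and "0 < b"
    and sep: "separating X [f, g]"
  obtains E where "regular a b E" "bip_rigid a E"
proof -
  define h where "h x = (f x, g x)" for x
  \<comment> \<open>Two points with the same pair of labels could be transposed unnoticed, so there
    are no parallel edges.\<close>
  have inj: "inj_on h X"
  proof (rule inj_onI)
    fix x y assume xy: "x \<in> X" "y \<in> X" "h x = h y"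
    have "f (transpose x y z) = f z" "g (transpose x y z) = g z" for z
      using xy(3) by (auto simp: h_def transpose_def)
    then have "preserves X f (transpose x y)" "preserves X g (transpose x y)"
      by (auto simp: preserves_def)
    moreover have "transpose x y permutes X" using xy by (intro permutes_swap_id)
    ultimately have "transpose x y = id" using sep by (simp add: separating_def)
    then show "x = y" by (metis id_apply transpose_apply_first)
  qed
  define E where "E = h ` X"
  have reg: "regular a b E"
    unfolding regular_def
  proof (intro conjI allI impI)
    show "E \<subseteq> {..<a} \<times> {..<a}" using f g by (auto simp: E_def h_def balanced_def)
    fix v assume v: "v < a"
    have "{j. (v, j) \<in> E} = g ` {x \<in> X. f x = v}" by (auto simp: E_def h_def)
    moreover have "inj_on g {x \<in> X. f x = v}" using inj by (auto simp: inj_on_def h_def)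
    ultimately show "card {j. (v, j) \<in> E} = b" using f v by (simp add: card_image balanced_def)
    have "{i. (i, v) \<in> E} = f ` {x \<in> X. g x = v}" by (auto simp: E_def h_def)
    moreover have "inj_on f {x \<in> X. g x = v}" using inj by (auto simp: inj_on_def h_def)
    ultimately show "card {i. (i, v) \<in> E} = b" using g v by (simp add: card_image balanced_def)
  qed
  have "bip_rigid a E"
    unfolding bip_rigid_def
  proof (intro allI impI)
    fix \<rho> \<gamma>
    assume "\<rho> permutes {..<a} \<and> \<gamma> permutes {..<a} \<and> (\<forall>i j. (i, j) \<in> E \<longleftrightarrow> (\<rho> i, \<gamma> j) \<in> E)"
    then have \<rho>: "\<rho> permutes {..<a}" and \<gamma>: "\<gamma> permutes {..<a}"
      and E: "\<And>i j. (i, j) \<in> E \<Longrightarrow> (\<rho> i, \<gamma> j) \<in> E" by auto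
    \<comment> \<open>The graph automorphism is lifted to the points: over each edge lies exactly
      one point.\<close>
    define \<sigma> where "\<sigma> x = (if x \<in> X then inv_into X h (\<rho> (f x), \<gamma> (g x)) else x)" for x
    have \<sigma>X: "\<sigma> x \<in> X" and h\<sigma>: "h (\<sigma> x) = (\<rho> (f x), \<gamma> (g x))" if "x \<in> X" for x
    proof -
      have "(\<rho> (f x), \<gamma> (g x)) \<in> h ` X" using E that by (auto simp: E_def h_def)
      then show "\<sigma> x \<in> X" "h (\<sigma> x) = (\<rho> (f x), \<gamma> (g x))"
        using that by (auto simp: \<sigma>_def inv_into_into f_inv_into_f)
    qed
    have f\<sigma>: "f (\<sigma> x) = \<rho> (f x)" and g\<sigma>: "g (\<sigma> x) = \<gamma> (g x)" if "x \<in> X" for x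
      using h\<sigma>[OF that] by (auto simp: h_def)
    have "inj_on \<sigma> X"
    proof (rule inj_onI)
      fix x y assume "x \<in> X" "y \<in> X" "\<sigma> x = \<sigma> y"
      then have "\<rho> (f x) = \<rho> (f y)" "\<gamma> (g x) = \<gamma> (g y)" using f\<sigma> g\<sigma> by metis+
      then have "h x = h y" using permutes_inj[OF \<rho>] permutes_inj[OF \<gamma>] by (simp add: h_def inj_eq)
      then show "x = y" using inj \<open>x \<in> X\<close> \<open>y \<in> X\<close> by (simp add: inj_on_eq_iff)
    qed
    then have "bij_betw \<sigma> X X"
      using \<sigma>X \<open>finite X\<close> by (simp add: bij_betw_def endo_inj_surj image_subset_iff)
    then have "\<sigma> permutes X" by (intro bij_imp_permutes) (auto simp: \<sigma>_def)
    moreover have "preserves X f \<sigma>" "preserves X g \<sigma>"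
      using permutes_inj[OF \<rho>] permutes_inj[OF \<gamma>] f\<sigma> g\<sigma> by (auto simp: preserves_def inj_eq)
    ultimately have "\<sigma> = id" using sep by (simp add: separating_def)
    have "\<rho> v = v \<and> \<gamma> v = v" for v
    proof (cases "v < a")
      case True
      then obtain x y where "x \<in> X" "f x = v" "y \<in> X" "g y = v"
        using balanced_image[OF f \<open>0 < b\<close>] balanced_image[OF g \<open>0 < b\<close>] by (metis imageE lessThan_iff)
      then show ?thesis using f\<sigma>[of x] g\<sigma>[of y] \<open>\<sigma> = id\<close> by simp
    qed (use permutes_not_in[OF \<rho>] permutes_not_in[OF \<gamma>] in auto)
    then show "\<rho> = id \<and> \<gamma> = id" by (auto simp: fun_eq_iff)
  qed
  then show thesis using that reg by blast
qed

section \<open>Degree at most two\<close>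

lemma regular_0_not_rigid:
  assumes "regular a 0 E" and "2 \<le> a"
  shows "\<not> bip_rigid a E"
proof -
  have "E = {}"
  proof (rule ccontr)
    assume "E \<noteq> {}"
    then obtain i j where ij: "(i, j) \<in> E" by auto
    then have "i < a" using assms(1) by (auto simp: regular_def)
    then have "card {j. (i, j) \<in> E} = 0" using assms(1) by (simp add: regular_def)
    moreover have "finite {j. (i, j) \<in> E}"
      using assms(1) by (auto simp: regular_def intro: finite_subset[of _ "{..<a}"])
    ultimately show False using ij by auto
  qed
  then show ?thesis
    using assms by (intro not_bip_rigidI[OF assms(1) permutes_swap_id[of 0 _ 1] permutes_id])
      (auto simp: fun_eq_iff intro: exI[of _ 0])
qed

text \<open>The graph is a perfect matching, and two of its edges can be exchanged.\<close>

lemma regular_1_not_rigid: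
  assumes reg: "regular a 1 E" and "2 \<le> a"
  shows "\<not> bip_rigid a E"
proof -
  have row: "\<exists>j. {j. (i, j) \<in> E} = {j}" if "i < a" for i
    using reg that by (simp add: regular_def card_1_singleton_iff)
  have col: "\<exists>i. {i. (i, j) \<in> E} = {i}" if "j < a" for j
    using reg that by (simp add: regular_def card_1_singleton_iff)
  have E: "i < a" "j < a" if "(i, j) \<in> E" for i j using reg that by (auto simp: regular_def)
  have row_eq: "j = j'" if h: "(i, j) \<in> E" "(i, j') \<in> E" for i j j'
    using row[OF E(1)[OF h(1)]] h by (metis mem_Collect_eq singletonD)
  have col_eq: "i = i'" if h: "(i, j) \<in> E" "(i', j) \<in> E" for i i' j
    using col[OF E(2)[OF h(1)]] h by (metis mem_Collect_eq singletonD)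
  obtain j0 j1 where j: "(0, j0) \<in> E" "(1, j1) \<in> E"
    using row[of 0] row[of 1] assms(2) by auto
  show ?thesis
  proof (rule not_bip_rigidI[OF reg])
    show "transpose 0 1 permutes {..<a}" using assms(2) by (intro permutes_swap_id) auto
    show "transpose j0 j1 permutes {..<a}" using j E(2) by (intro permutes_swap_id) auto
    show "transpose 0 1 \<noteq> (id :: nat \<Rightarrow> nat) \<or> transpose j0 j1 \<noteq> id"
      by (metis id_apply transpose_apply_first zero_neq_one)
    fix i j assume ij: "(i, j) \<in> E"
    consider "i = 0" | "i = 1" | "i \<noteq> 0" "i \<noteq> 1" by blast
    then show "(transpose 0 1 i, transpose j0 j1 j) \<in> E"
    proof cases
      case 1
      then have "j = j0" using row_eq ij j by blast
      then show ?thesis using 1 j by simp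
    next
      case 2
      then have "j = j1" using row_eq ij j by blast
      then show ?thesis using 2 j by simp
    next
      case 3
      then have "j \<noteq> j0" "j \<noteq> j1" using col_eq ij j by blast+
      then show ?thesis using 3 ij by simp
    qed
  qed
qed

text \<open>Classes of size two are encoded by the involution exchanging the two points of each
  class. Outside \<open>X\<close> it is the identity, so that \<open>p (p x) = x\<close> holds
  without a side condition.\<close>

lemma partner_of_balanced:
  assumes f: "balanced X a 2 f"
  obtains p where "p permutes X" "\<And>x. p (p x) = x" "\<And>x. x \<in> X \<Longrightarrow> p x \<noteq> x"
    "\<And>x y. x \<in> X \<Longrightarrow> y \<in> X \<Longrightarrow> f x = f y \<longleftrightarrow> y = x \<or> y = p x"
proof -
  have "\<exists>z. z \<noteq> x \<and> {y \<in> X. f y = f x} = {x, z}" if x: "x \<in> X" for x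
  proof -
    have "f x < a" using f x by (auto simp: balanced_def)
    then have "card {y \<in> X. f y = f x} = 2" using f by (simp add: balanced_def)
    then obtain u v where uv: "{y \<in> X. f y = f x} = {u, v}" "u \<noteq> v" by (meson card_2_iff)
    then have "x = u \<or> x = v" using x by blast
    then show ?thesis using uv by (metis insert_commute)
  qed
  then obtain q where q: "\<And>x. x \<in> X \<Longrightarrow> q x \<noteq> x" "\<And>x. x \<in> X \<Longrightarrow> {y \<in> X. f y = f x} = {x, q x}"
    by metis
  define p where "p x = (if x \<in> X then q x else x)" for x
  have mem: "y \<in> X \<and> f y = f x \<longleftrightarrow> y = x \<or> y = p x" if "x \<in> X" for x y
    using q(2)[OF that] that by (auto simp: p_def set_eq_iff)
  have ne: "p x \<noteq> x" if "x \<in> X" for x using q(1) that by (simp add: p_def)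
  have pp: "p (p x) = x" for x
  proof (cases "x \<in> X")
    case True
    then have px: "p x \<in> X" "f (p x) = f x" using mem by auto
    then have "x = p x \<or> x = p (p x)" using mem[OF px(1), of x] True by auto
    then show ?thesis using ne True by auto
  qed (simp add: p_def)
  have "p permutes X" using pp unfolding permutes_def by (metis p_def)
  moreover have "f x = f y \<longleftrightarrow> y = x \<or> y = p x" if "x \<in> X" "y \<in> X" for x y
    using mem[OF that(1), of y] that(2) by auto
  ultimately show thesis using that pp ne by blast
qed

text \<open>For pairings, preserving the classes amounts to commuting with the involution;
  \<open>preserves_commuting\<close> is the other direction.\<close>

lemma commuting_preserves:
  assumes p: "\<And>x y. x \<in> X \<Longrightarrow> y \<in> X \<Longrightarrow> f x = f y \<longleftrightarrow> y = x \<or> y = p x"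
    and \<sigma>: "\<sigma> permutes X" and comm: "\<And>x. x \<in> X \<Longrightarrow> \<sigma> (p x) = p (\<sigma> x)"
  shows "preserves X f \<sigma>"
  unfolding preserves_def
proof (intro ballI)
  fix x y assume xy: "x \<in> X" "y \<in> X"
  have "f (\<sigma> x) = f (\<sigma> y) \<longleftrightarrow> \<sigma> y = \<sigma> x \<or> \<sigma> y = \<sigma> (p x)"
    using p[of "\<sigma> x" "\<sigma> y"] xy permutes_in_image[OF \<sigma>] comm[OF xy(1)] by simp
  then show "f x = f y \<longleftrightarrow> f (\<sigma> x) = f (\<sigma> y)"
    using p[OF xy] permutes_inj[OF \<sigma>] by (simp add: inj_eq)
qed

lemma preserves_commuting:
  assumes p: "\<And>x y. x \<in> X \<Longrightarrow> y \<in> X \<Longrightarrow> f x = f y \<longleftrightarrow> y = x \<or> y = p x"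
    and \<sigma>: "\<sigma> permutes X" "preserves X f \<sigma>" and x: "x \<in> X" "p x \<in> X" "p x \<noteq> x"
  shows "\<sigma> (p x) = p (\<sigma> x)"
proof -
  have "f (\<sigma> x) = f (\<sigma> (p x))" using preservesD[OF \<sigma>(2) x(1,2)] p[OF x(1,2)] by simp
  then have "\<sigma> (p x) = \<sigma> x \<or> \<sigma> (p x) = p (\<sigma> x)"
    using p[of "\<sigma> x" "\<sigma> (p x)"] x permutes_in_image[OF \<sigma>(1)] by simp
  then show ?thesis using permutes_inj[OF \<sigma>(1)] x(3) by (simp add: inj_eq)
qed

text \<open>The graph with edge set \<open>{x, p x}\<close> and \<open>{x, q x}\<close> is a union of cycles of even length;
  \<open>\<sigma>\<close> is the rotation by two steps of one cycle, which acts as \<open>p \<circ> q\<close> on one half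
  of its vertices and as \<open>q \<circ> p\<close> on the other half.\<close>

lemma two_involutions_commuting_perm:
  assumes p: "p permutes X" "\<And>x. p (p x) = x" "\<And>x. x \<in> X \<Longrightarrow> p x \<noteq> x"
    and q: "q permutes X" "\<And>x. q (q x) = x" "\<And>x. x \<in> X \<Longrightarrow> q x \<noteq> x"
    and "finite X" "e \<in> X"
  obtains \<sigma> where "\<sigma> permutes X" "\<sigma> \<noteq> id" "\<And>x. \<sigma> (p x) = p (\<sigma> x)" "\<And>x. \<sigma> (q x) = q (\<sigma> x)"
proof (cases "p e = q e")
  \<comment> \<open>Here \<open>e\<close> and \<open>p e\<close> form a cycle of length two, on
    which two steps are the identity; its two points are exchanged instead.\<close>
  case True
  have pe: "p e \<in> X" using permutes_in_image[OF p(1)] \<open>e \<in> X\<close> by simp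
  have comm: "transpose e (p e) (t x) = t (transpose e (p e) x)"
    if t: "t e = p e" "t (p e) = e" "\<And>x. t (t x) = x" for t x
    using t by (cases "x = e"; cases "x = p e") (auto simp: transpose_def, metis+)
  have "q (p e) = e" using True q(2)[of e] by simp
  then show thesis
    using that[of "transpose e (p e)"] comm[of p] comm[of q] True p(2,3) q(2)
      permutes_swap_id[OF \<open>e \<in> X\<close> pe] \<open>e \<in> X\<close>
    by (metis id_apply transpose_apply_first)
next
  case False
  define r where "r = p \<circ> q"
  define s where "s = q \<circ> p"
  have rs: "r (s x) = x" "s (r x) = x" for x using p(2) q(2) by (auto simp: r_def s_def)
  have rX: "r x \<in> X \<longleftrightarrow> x \<in> X" for x
    using permutes_in_image[OF p(1)] permutes_in_image[OF q(1)] by (simp add: r_def)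
  have rkX: "(r ^^ k) x \<in> X" if "x \<in> X" for k x using that by (induction k) (auto simp: rX)
  \<comment> \<open>Descent by two: the relation for \<open>x\<close> and exponent
    \<open>k + 2\<close> implies it for \<open>r x\<close> and exponent \<open>k\<close>. At the
    bottom it would give a fixed point of \<open>p\<close> or of \<open>q\<close>. Hence an
    \<open>r\<close>-orbit is disjoint from its image under \<open>p\<close>, which splits each
    cycle into two halves.\<close>
  have not_refl: "p x \<noteq> (r ^^ k) x" if "x \<in> X" for k x
    using that
  proof (induction k arbitrary: x rule: induct_nat_012)
    case 0
    then show ?case using p(3) by simp
  next
    case 1
    show ?case
    proof
      assume "p x = (r ^^ Suc 0) x"
      then have "p (p x) = p (p (q x))" by (simp add: r_def)
      then show False using p(2) q(3)[OF 1] by simp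
    qed
  next
    case (ge2 k)
    show ?case
    proof
      assume "p x = (r ^^ Suc (Suc k)) x"
      then have "s (p x) = (r ^^ Suc k) x" by (simp add: rs)
      then have "q x = (r ^^ k) (r x)" using p(2) by (simp add: s_def funpow_swap1)
      moreover have "q x = p (r x)" using p(2) by (simp add: r_def)
      ultimately show False using ge2.IH(1)[of "r x"] rX ge2.prems by simp
    qed
  qed
  \<comment> \<open>One half of the cycle through \<open>e\<close>; by finiteness it is closed under
    the inverse \<open>s\<close> of \<open>r\<close> as well.\<close>
  define A where "A = (\<lambda>k. (r ^^ k) e) ` UNIV"
  have AX: "A \<subseteq> X" using rkX \<open>e \<in> X\<close> by (auto simp: A_def)
  have rA: "r ` A \<subseteq> A"
  proof
    fix x assume "x \<in> r ` A"
    then obtain k where "x = (r ^^ Suc k) e" by (auto simp: A_def)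
    then show "x \<in> A" unfolding A_def by blast
  qed
  have "inj r" by (metis injI rs(2))
  then have "r ` A = A"
    using endo_inj_surj[OF finite_subset[OF AX \<open>finite X\<close>] rA] by (auto intro: inj_on_subset)
  then have A_iff: "r x \<in> A \<longleftrightarrow> x \<in> A" for x
    using inj_image_mem_iff[OF \<open>inj r\<close>, of x A] by simp
  have sA: "s x \<in> A \<longleftrightarrow> x \<in> A" for x using A_iff[of "s x"] rs by simp
  have pA: "p x \<notin> A" if x: "x \<in> A" for x
  proof
    assume "p x \<in> A"
    then obtain k l where k: "x = (r ^^ k) e" and l: "p x = (r ^^ l) e" using x unfolding A_def by blast
    show False
    proof (cases "k \<le> l")
      case True
      then have "p x = (r ^^ (l - k)) x"
        using k l by (metis comp_apply funpow_add le_add_diff_inverse2)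
      then show False using not_refl AX x by blast
    next
      case False
      then have "x = (r ^^ (k - l)) (p x)"
        using k l by (metis comp_apply funpow_add le_add_diff_inverse2 nat_le_linear)
      then show False using not_refl[of "p x" "k - l"] AX \<open>p x \<in> A\<close> p(2) by auto
    qed
  qed
  \<comment> \<open>Applying \<open>p\<close> reverses the sense of rotation, so on the other half
    the same rotation is given by \<open>s\<close>.\<close>
  define \<sigma> where "\<sigma> x = (if x \<in> A then r x else if p x \<in> A then s x else x)" for x
  have rp: "r (p x) = p (s x)" and sp: "s (p x) = p (r x)" and rq: "r (q x) = q (s x)" and sq: "s (q x) = q (r x)" for x
    using p(2) q(2) by (simp_all add: r_def s_def)
  have pqA: "p (q x) \<in> A \<longleftrightarrow> x \<in> A" for x using A_iff[of x] by (simp add: r_def)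
  have qA: "q x \<in> A \<longleftrightarrow> p x \<in> A" for x using sA[of "p x"] p(2) by (simp add: s_def)
  have pA': "x \<notin> A" if "p x \<in> A" for x using pA[OF that] p(2) by simp
  have \<sigma>1: "\<sigma> x = r x" if "x \<in> A" for x using that by (simp add: \<sigma>_def)
  have \<sigma>2: "\<sigma> x = s x" if "p x \<in> A" for x using that pA' by (simp add: \<sigma>_def)
  have \<sigma>3: "\<sigma> x = x" if "x \<notin> A" "p x \<notin> A" for x using that by (simp add: \<sigma>_def)
  have \<sigma>p: "\<sigma> (p x) = p (\<sigma> x)" for x
  proof -
    consider "x \<in> A" | "p x \<in> A" | "x \<notin> A" "p x \<notin> A" by blast
    then show ?thesis
      by cases (use p(2) in \<open>simp_all add: \<sigma>1 \<sigma>2 \<sigma>3 rp sp\<close>)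
  qed
  have \<sigma>q: "\<sigma> (q x) = q (\<sigma> x)" for x
  proof -
    consider "x \<in> A" | "p x \<in> A" | "x \<notin> A" "p x \<notin> A" by blast
    then show ?thesis
      by cases (simp_all add: \<sigma>1 \<sigma>2 \<sigma>3 rq sq pqA qA)
  qed
  have \<sigma>A: "\<sigma> x \<in> A \<longleftrightarrow> x \<in> A" "p (\<sigma> x) \<in> A \<longleftrightarrow> p x \<in> A" for x
  proof -
    show *: "\<sigma> x \<in> A \<longleftrightarrow> x \<in> A" for x
    proof -
      consider "x \<in> A" | "p x \<in> A" | "x \<notin> A" "p x \<notin> A" by blast
      then show ?thesis by cases (simp_all add: \<sigma>1 \<sigma>2 \<sigma>3 A_iff sA)
    qed
    show "p (\<sigma> x) \<in> A \<longleftrightarrow> p x \<in> A" using *[of "p x"] by (simp add: \<sigma>p)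
  qed
  have "inj \<sigma>"
  proof (rule injI)
    fix x y assume eq: "\<sigma> x = \<sigma> y"
    then have "x \<in> A \<longleftrightarrow> y \<in> A" "p x \<in> A \<longleftrightarrow> p y \<in> A" using \<sigma>A by metis+
    then show "x = y" using eq rs \<sigma>1 \<sigma>2 \<sigma>3 by metis
  qed
  then have "\<sigma> permutes X"
    using AX permutes_in_image[OF p(1)] permutes_in_image[OF q(1)] \<open>finite X\<close>
    by (intro inj_imp_permutes) (auto simp: \<sigma>_def r_def s_def intro: inj_on_subset)
  moreover have "\<sigma> \<noteq> id"
  proof
    assume "\<sigma> = id"
    moreover have "(r ^^ 0) e \<in> A" unfolding A_def by blast
    ultimately have "r e = e" using \<sigma>1[of e] by simp
    then show False using False p(2) by (metis comp_apply r_def)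
  qed
  ultimately show thesis using that \<sigma>p \<sigma>q by blast
qed

lemma two_pairings_not_separating:
  assumes "finite X" "X \<noteq> {}" and f: "balanced X a 2 f" and g: "balanced X a 2 g"
  shows "\<not> separating X [f, g]"
proof -
  obtain p where p: "p permutes X" "\<And>x. p (p x) = x" "\<And>x. x \<in> X \<Longrightarrow> p x \<noteq> x"
    "\<And>x y. x \<in> X \<Longrightarrow> y \<in> X \<Longrightarrow> f x = f y \<longleftrightarrow> y = x \<or> y = p x"
    using partner_of_balanced[OF f] by blast
  obtain q where q: "q permutes X" "\<And>x. q (q x) = x" "\<And>x. x \<in> X \<Longrightarrow> q x \<noteq> x"
    "\<And>x y. x \<in> X \<Longrightarrow> y \<in> X \<Longrightarrow> g x = g y \<longleftrightarrow> y = x \<or> y = q x"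
    using partner_of_balanced[OF g] by blast
  obtain e where "e \<in> X" using \<open>X \<noteq> {}\<close> by blast
  obtain \<sigma> where \<sigma>: "\<sigma> permutes X" "\<sigma> \<noteq> id" "\<And>x. \<sigma> (p x) = p (\<sigma> x)" "\<And>x. \<sigma> (q x) = q (\<sigma> x)"
    using two_involutions_commuting_perm[OF p(1-3) q(1-3) \<open>finite X\<close> \<open>e \<in> X\<close>] by blast
  have "preserves X f \<sigma>" by (rule commuting_preserves[OF p(4) \<sigma>(1) \<sigma>(3)])
  moreover have "preserves X g \<sigma>" by (rule commuting_preserves[OF q(4) \<sigma>(1) \<sigma>(4)])
  ultimately show ?thesis using \<sigma>(1,2) by (auto simp: separating_def)
qed

lemma regular_2_not_rigid:
  assumes reg: "regular a 2 E" and "0 < a"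
  shows "\<not> bip_rigid a E"
proof
  assume "bip_rigid a E"
  then have "separating E [fst, snd]" by (intro bip_rigid_imp_separating[OF reg]) simp_all
  moreover have "E \<noteq> {}"
    using balanced_card[OF regular_finite[OF reg] regular_balanced(1)[OF reg]] assms(2) by auto
  ultimately show False
    using two_pairings_not_separating regular_finite[OF reg] regular_balanced[OF reg] by blast
qed

section \<open>Cubic graphs on six or seven rows\<close>

text \<open>
  A state of the search consists of lists \<open>T\<close> and \<open>F\<close> of known edges and known non-edges between
  \<open>nr\<close> rows and \<open>nc\<close> columns found so far, which are numbered in order of discovery. \<open>Split\<close> decides
  whether a pair is an edge. When a row of degree less than three has no undecided column left, its
  next neighbour is a new column (\<open>RowNew\<close>). A branch ends when the vertices that are left cannot
  complete a row (\<open>RowFull\<close>), or with a permutation of the numbers that preserves \<open>T\<close> and moves only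
  vertices all of whose edges are known (\<open>Aut\<close>): it extends by the identity to the whole graph.
  With flag \<open>q\<close> the graph is assumed to contain no 4-cycle, so finding one also ends a
  branch (\<open>Quad\<close>).
\<close>

datatype cert = Aut "nat list" "nat list" | Quad nat nat nat nat | RowFull nat | ColFull nat
  | Split nat nat cert cert | RowNew nat cert | ColNew nat cert

definition row_nbrs :: "nat \<Rightarrow> (nat \<times> nat) list \<Rightarrow> nat list" where
  "row_nbrs i T = map snd (filter (\<lambda>e. fst e = i) T)"

definition flip :: "(nat \<times> nat) list \<Rightarrow> (nat \<times> nat) list" where
  "flip T = map prod.swap T"

definition open_cols :: "nat \<Rightarrow> (nat \<times> nat) list \<Rightarrow> (nat \<times> nat) list \<Rightarrow> nat \<Rightarrow> nat list" where
  "open_cols nc T F i = filter (\<lambda>j. \<not> List.member T (i, j) \<and> \<not> List.member F (i, j)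
     \<and> length (row_nbrs j (flip T)) < 3) [0..<nc]"

definition moves_full :: "nat \<Rightarrow> (nat \<times> nat) list \<Rightarrow> nat list \<Rightarrow> bool" where
  "moves_full m T p \<longleftrightarrow> length p = m \<and> distinct p \<and> list_all (\<lambda>i. i < m) p \<and>
     list_all (\<lambda>i. p ! i = i \<or> length (row_nbrs i T) = 3) [0..<m]"

fun check :: "bool \<Rightarrow> nat \<Rightarrow> nat \<Rightarrow> nat \<Rightarrow> (nat \<times> nat) list \<Rightarrow> (nat \<times> nat) list \<Rightarrow> cert \<Rightarrow> bool" where
  "check q n nr nc T F (Aut p r) \<longleftrightarrow> moves_full nr T p \<and> moves_full nc (flip T) r \<and>
     (p \<noteq> [0..<nr] \<or> r \<noteq> [0..<nc]) \<and> list_all (\<lambda>e. List.member T (p ! fst e, r ! snd e)) T"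
| "check q n nr nc T F (Quad i i' j j') \<longleftrightarrow> q \<and> i \<noteq> i' \<and> j \<noteq> j' \<and>
     List.member T (i, j) \<and> List.member T (i, j') \<and> List.member T (i', j) \<and> List.member T (i', j')"
| "check q n nr nc T F (RowFull i) \<longleftrightarrow> i < nr \<and>
     length (row_nbrs i T) + length (open_cols nc T F i) + (n - nc) < 3"
| "check q n nr nc T F (ColFull j) \<longleftrightarrow> j < nc \<and>
     length (row_nbrs j (flip T)) + length (open_cols nr (flip T) (flip F) j) + (n - nr) < 3"
| "check q n nr nc T F (Split i j c d) \<longleftrightarrow> i < nr \<and> j < nc \<and> \<not> List.member T (i, j) \<and>
     check q n nr nc ((i, j) # T) F c \<and> check q n nr nc T ((i, j) # F) d"
| "check q n nr nc T F (RowNew i c) \<longleftrightarrow> i < nr \<and> length (row_nbrs i T) < 3 \<and>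
     open_cols nc T F i = [] \<and> check q n nr (Suc nc) ((i, nc) # T) F c"
| "check q n nr nc T F (ColNew j c) \<longleftrightarrow> j < nc \<and> length (row_nbrs j (flip T)) < 3 \<and>
     open_cols nr (flip T) (flip F) j = [] \<and> check q n (Suc nr) nc ((nr, j) # T) F c"

text \<open>Ties a search state to an actual graph: number \<open>i\<close> stands for row
  \<open>xs ! i\<close>, and likewise for columns. Distinctness of \<open>T\<close> makes
  \<open>length (row_nbrs i T)\<close> the true number of known neighbours.\<close>

definition embeds ::
  "nat \<Rightarrow> (nat \<times> nat) set \<Rightarrow> nat list \<Rightarrow> nat list \<Rightarrow> (nat \<times> nat) list \<Rightarrow> (nat \<times> nat) list \<Rightarrow> bool" where
  "embeds n E xs ys T F \<longleftrightarrow> distinct xs \<and> distinct ys \<and> set xs \<subseteq> {..<n} \<and> set ys \<subseteq> {..<n} \<and> distinct T \<and>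
     (\<forall>(i, j) \<in> set T. i < length xs \<and> j < length ys \<and> (xs ! i, ys ! j) \<in> E) \<and>
     (\<forall>(i, j) \<in> set F. i < length xs \<and> j < length ys \<and> (xs ! i, ys ! j) \<notin> E)"

lemma in_flip [simp]: "(i, j) \<in> set (flip T) \<longleftrightarrow> (j, i) \<in> set T"
  by (force simp: flip_def)

lemma set_row_nbrs: "set (row_nbrs i T) = {j. (i, j) \<in> set T}"
  by (force simp: row_nbrs_def)

lemma embeds_flip: "embeds n E xs ys T F \<Longrightarrow> embeds n (E\<inverse>) ys xs (flip T) (flip F)"
  by (auto simp: embeds_def flip_def distinct_map inj_on_def)

lemma embeds_row_nbrs:
  assumes "embeds n E xs ys T F"
  shows "nth ys ` set (row_nbrs i T) \<subseteq> {y. (xs ! i, y) \<in> E}"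
    and "card (nth ys ` set (row_nbrs i T)) = length (row_nbrs i T)"
proof -
  show "nth ys ` set (row_nbrs i T) \<subseteq> {y. (xs ! i, y) \<in> E}"
    using assms by (auto simp: embeds_def set_row_nbrs)
  have "distinct (row_nbrs i T)"
    using assms by (auto simp: embeds_def row_nbrs_def distinct_map inj_on_def)
  moreover have "inj_on (nth ys) (set (row_nbrs i T))"
    using assms by (intro inj_on_nth) (auto simp: embeds_def set_row_nbrs)
  ultimately show "card (nth ys ` set (row_nbrs i T)) = length (row_nbrs i T)"
    by (simp add: card_image distinct_card)
qed

text \<open>Three known neighbours are three distinct columns, and a cubic row has no
  others.\<close>

lemma embeds_full_row:
  assumes emb: "embeds n E xs ys T F" and reg: "regular n 3 E" and i: "i < length xs"
    and full: "length (row_nbrs i T) = 3" and "(xs ! i, y) \<in> E"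
  obtains j where "(i, j) \<in> set T" "y = ys ! j"
proof -
  have "xs ! i < n" using emb i by (force simp: embeds_def)
  then have c: "card {y. (xs ! i, y) \<in> E} = 3" using reg by (simp add: regular_def)
  then have "finite {y. (xs ! i, y) \<in> E}" by (intro card_ge_0_finite) simp
  then have "nth ys ` set (row_nbrs i T) = {y. (xs ! i, y) \<in> E}"
    using embeds_row_nbrs[OF emb, of i] c full by (intro card_subset_eq) auto
  then have "y \<in> nth ys ` set (row_nbrs i T)" using assms(5) by simp
  then show thesis using that by (auto simp: set_row_nbrs)
qed

text \<open>A numbered neighbour missing from \<open>T\<close> must be open: it is not in
  \<open>F\<close>, and all edges of a column with three known edges are already in
  \<open>T\<close>.\<close>

lemma embeds_row_cover:
  assumes emb: "embeds n E xs ys T F" and reg: "regular n 3 E" and i: "i < length xs"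
  shows "{y. (xs ! i, y) \<in> E} \<subseteq> nth ys ` set (row_nbrs i T) \<union>
           (nth ys ` set (open_cols (length ys) T F i) \<union> ({..<n} - set ys))"
proof
  fix y assume "y \<in> {y. (xs ! i, y) \<in> E}"
  then have xy: "(xs ! i, y) \<in> E" by simp
  then have "y < n" using reg by (auto simp: regular_def)
  show "y \<in> nth ys ` set (row_nbrs i T) \<union>
           (nth ys ` set (open_cols (length ys) T F i) \<union> ({..<n} - set ys))"
  proof (cases "y \<in> set ys")
    case True
    then obtain j where j: "j < length ys" "y = ys ! j" by (auto simp: in_set_conv_nth)
    show ?thesis
    proof (cases "(i, j) \<in> set T")
      case True
      then show ?thesis using j by (auto simp: set_row_nbrs)
    next
      case notT: False
      have notF: "(i, j) \<notin> set F" using emb i j xy by (auto simp: embeds_def)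
      have "length (row_nbrs j (flip T)) \<noteq> 3"
      proof
        assume "length (row_nbrs j (flip T)) = 3"
        moreover have "(ys ! j, xs ! i) \<in> E\<inverse>" using xy j by simp
        ultimately obtain i' where i': "(j, i') \<in> set (flip T)" "xs ! i = xs ! i'"
          using embeds_full_row[OF embeds_flip[OF emb] regular_converse[OF reg] j(1)] by metis
        then have "i' < length xs" using emb by (auto simp: embeds_def)
        then have "i' = i" using i' i emb by (auto simp: embeds_def nth_eq_iff_index_eq)
        then show False using i' notT by simp
      qed
      moreover have "length (row_nbrs j (flip T)) \<le> 3"
      proof -
        have "ys ! j < n" using \<open>y < n\<close> j by simp
        then have c: "card {x. (ys ! j, x) \<in> E\<inverse>} = 3" using reg by (auto simp: regular_def)
        then have "finite {x. (ys ! j, x) \<in> E\<inverse>}" by (intro card_ge_0_finite) simp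
        then show ?thesis
          using embeds_row_nbrs[OF embeds_flip[OF emb], of j] card_mono c by metis
      qed
      ultimately have "j \<in> set (open_cols (length ys) T F i)"
        using j notT notF by (simp add: open_cols_def)
      then show ?thesis using j by blast
    qed
  qed (use \<open>y < n\<close> in auto)
qed

text \<open>Soundness of \<open>RowFull\<close>, by counting in \<open>embeds_row_cover\<close>:
  exactly \<open>n - length ys\<close> columns are still unnumbered.\<close>

lemma embeds_row_bound:
  assumes emb: "embeds n E xs ys T F" and reg: "regular n 3 E" and i: "i < length xs"
  shows "3 \<le> length (row_nbrs i T) + length (open_cols (length ys) T F i) + (n - length ys)"
proof -
  have "xs ! i < n" using emb i by (force simp: embeds_def)
  then have "3 = card {y. (xs ! i, y) \<in> E}" using reg by (simp add: regular_def)
  also have "\<dots> \<le> card (nth ys ` set (row_nbrs i T) \<union>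
           (nth ys ` set (open_cols (length ys) T F i) \<union> ({..<n} - set ys)))"
    by (rule card_mono[OF _ embeds_row_cover[OF assms]]) simp
  also have "\<dots> \<le> card (nth ys ` set (row_nbrs i T)) +
           (card (nth ys ` set (open_cols (length ys) T F i)) + card ({..<n} - set ys))"
    by (meson add_left_mono card_Un_le order_trans)
  also have "card ({..<n} - set ys) = n - length ys"
    using emb by (subst card_Diff_subset) (auto simp: embeds_def distinct_card)
  also have "card (nth ys ` set (open_cols (length ys) T F i)) \<le> length (open_cols (length ys) T F i)"
    by (meson card_image_le card_length finite_set order_trans)
  finally show ?thesis using embeds_row_nbrs(2)[OF emb, of i] by simp
qed

text \<open>Soundness of \<open>RowNew\<close>: if no column is open, a neighbour that is still
  missing is an unnumbered column, which may receive the next number.\<close>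

lemma embeds_new_col:
  assumes emb: "embeds n E xs ys T F" and reg: "regular n 3 E" and i: "i < length xs"
    and "length (row_nbrs i T) < 3" and "open_cols (length ys) T F i = []"
  obtains y where "y < n" "y \<notin> set ys" "(xs ! i, y) \<in> E"
proof -
  have "xs ! i < n" using emb i by (force simp: embeds_def)
  then have "card {y. (xs ! i, y) \<in> E} = 3" using reg by (simp add: regular_def)
  moreover have "card (nth ys ` set (row_nbrs i T)) < 3"
    using embeds_row_nbrs(2)[OF emb] assms by simp
  ultimately have "\<not> {y. (xs ! i, y) \<in> E} \<subseteq> nth ys ` set (row_nbrs i T)"
    by (metis List.finite_set card_mono finite_imageI not_less)
  then show thesis using embeds_row_cover[OF emb reg i] assms(5) that by auto
qed

lemma embeds_add_col:
  assumes emb: "embeds n E xs ys T F" and i: "i < length xs" and y: "y < n" "y \<notin> set ys" "(xs ! i, y) \<in> E"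
  shows "embeds n E xs (ys @ [y]) ((i, length ys) # T) F"
proof -
  have T: "i < length xs \<and> j < length ys \<and> (xs ! i, ys ! j) \<in> E" if "(i, j) \<in> set T" for i j
    using emb that by (auto simp: embeds_def)
  have F: "i < length xs \<and> j < length ys \<and> (xs ! i, ys ! j) \<notin> E" if "(i, j) \<in> set F" for i j
    using emb that by (auto simp: embeds_def)
  have "(i, length ys) \<notin> set T" using T by blast
  then have "distinct ((i, length ys) # T)" using emb by (simp add: embeds_def)
  moreover have "i' < length xs \<and> j < length (ys @ [y]) \<and> (xs ! i', (ys @ [y]) ! j) \<in> E"
    if "(i', j) \<in> set ((i, length ys) # T)" for i' j
  proof (cases "(i', j) = (i, length ys)")
    case False
    then have "(i', j) \<in> set T" using that by auto
    from T[OF this] show ?thesis by (simp add: nth_append)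
  qed (use i y in simp)
  then have "\<forall>(i', j) \<in> set ((i, length ys) # T).
      i' < length xs \<and> j < length (ys @ [y]) \<and> (xs ! i', (ys @ [y]) ! j) \<in> E"
    by blast
  moreover have "i' < length xs \<and> j < length (ys @ [y]) \<and> (xs ! i', (ys @ [y]) ! j) \<notin> E"
    if "(i', j) \<in> set F" for i' j
    using F[OF that] by (simp add: nth_append)
  then have "\<forall>(i, j) \<in> set F. i < length xs \<and> j < length (ys @ [y]) \<and> (xs ! i, (ys @ [y]) ! j) \<notin> E"
    by blast
  moreover have "distinct xs" "distinct (ys @ [y])" "set xs \<subseteq> {..<n}" "set (ys @ [y]) \<subseteq> {..<n}"
    using emb y by (auto simp: embeds_def)
  ultimately show ?thesis unfolding embeds_def by (intro conjI)
qed

text \<open>A permutation of numbers turned into a map of actual vertices; unnumbered vertices stay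
  fixed.\<close>

definition act :: "nat list \<Rightarrow> nat list \<Rightarrow> nat \<Rightarrow> nat" where
  "act xs p x = (if x \<in> set xs then xs ! (p ! inv_into {..<length xs} (nth xs) x) else x)"

lemma act_nth:
  assumes "distinct xs" "i < length xs"
  shows "act xs p (xs ! i) = xs ! (p ! i)"
proof -
  have "inj_on (nth xs) {..<length xs}" using assms by (intro inj_on_nth) auto
  then show ?thesis using assms by (simp add: act_def inv_into_f_f)
qed

lemma act_permutes:
  assumes "distinct xs" "set xs \<subseteq> {..<n}" "moves_full (length xs) T p"
  shows "act xs p permutes {..<n}"
proof -
  have p: "p ! i < length xs" if "i < length xs" for i
    using assms(3) that by (auto simp: moves_full_def list_all_iff)
  have in_xs: "act xs p x \<in> set xs" if x: "x \<in> set xs" for x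
  proof -
    obtain i where i: "i < length xs" "x = xs ! i" using x unfolding in_set_conv_nth by blast
    have "act xs p x = xs ! (p ! i)" unfolding i(2) by (rule act_nth[OF assms(1) i(1)])
    then show ?thesis using nth_mem[OF p[OF i(1)]] by metis
  qed
  have "inj_on (act xs p) (set xs)"
  proof (rule inj_onI)
    fix x y assume xy: "x \<in> set xs" "y \<in> set xs" and eq: "act xs p x = act xs p y"
    obtain i j where ij: "i < length xs" "x = xs ! i" "j < length xs" "y = xs ! j"
      using xy unfolding in_set_conv_nth by blast
    then have "xs ! (p ! i) = xs ! (p ! j)" using eq assms(1) by (simp add: act_nth)
    then have "p ! i = p ! j" using p ij assms(1) by (simp add: nth_eq_iff_index_eq)
    then have "i = j" using ij assms(3) by (simp add: moves_full_def nth_eq_iff_index_eq)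
    then show "x = y" using ij by simp
  qed
  moreover have "act xs p x = x" if "x \<notin> set xs" for x
    using that by (simp add: act_def)
  ultimately have "inj_on (act xs p) {..<n}"
    using in_xs unfolding inj_on_def by metis
  moreover have "act xs p ` {..<n} \<subseteq> {..<n}"
  proof
    fix y assume "y \<in> act xs p ` {..<n}"
    then obtain x where "y = act xs p x" "x < n" by blast
    then show "y \<in> {..<n}" using in_xs[of x] assms(2) by (cases "x \<in> set xs") (auto simp: act_def)
  qed
  ultimately have "bij_betw (act xs p) {..<n} {..<n}"
    by (simp add: bij_betw_def endo_inj_surj)
  moreover have "act xs p x = x" if "x \<notin> {..<n}" for x
    using that assms(2) by (auto simp: act_def)
  ultimately show ?thesis by (intro bij_imp_permutes) auto
qed

lemma act_nontrivial:
  assumes "distinct xs" "moves_full (length xs) T p" "p \<noteq> [0..<length xs]"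
  shows "act xs p \<noteq> id"
proof -
  have len: "length p = length xs" using assms(2) by (simp add: moves_full_def)
  then obtain i where i: "i < length xs" "p ! i \<noteq> i"
    using assms(3) by (metis add_0 diff_zero length_upt nth_equalityI nth_upt)
  then have "p ! i < length xs" using assms(2) len by (auto simp: moves_full_def list_all_iff)
  then have "xs ! (p ! i) \<noteq> xs ! i" using i assms(1) by (simp add: nth_eq_iff_index_eq)
  then show ?thesis using act_nth[OF assms(1) i(1), of p] by (metis id_apply)
qed

lemma act_moved_full:
  assumes "distinct xs" "moves_full (length xs) T p" "act xs p x \<noteq> x"
  obtains i where "i < length xs" "x = xs ! i" "length (row_nbrs i T) = 3"
proof -
  have "x \<in> set xs" using assms(3) by (auto simp: act_def split: if_splits)
  then obtain i where i: "i < length xs" "x = xs ! i" by (auto simp: in_set_conv_nth)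
  then have "p ! i \<noteq> i" using assms act_nth[OF assms(1) i(1)] by metis
  then have "length (row_nbrs i T) = 3" using assms(2) i by (auto simp: moves_full_def list_all_iff)
  then show thesis using that i by blast
qed

text \<open>Induction on the certificate. The column rules are the row rules for the converse
  relation, with \<open>T\<close> and \<open>F\<close> flipped.\<close>

lemma check_sound:
  assumes "check q n (length xs) (length ys) T F c" "embeds n E xs ys T F" and reg: "regular n 3 E"
    and quad: "\<And>x x' y y'. q \<Longrightarrow> {(x, y), (x, y'), (x', y), (x', y')} \<subseteq> E \<Longrightarrow> x = x' \<or> y = y'"
  shows "\<not> bip_rigid n E"
  using assms(1,2)
proof (induction c arbitrary: xs ys T F)
  case (Aut p r)
  then have p: "moves_full (length xs) T p" and r: "moves_full (length ys) (flip T) r"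
    and ne: "p \<noteq> [0..<length xs] \<or> r \<noteq> [0..<length ys]"
    and T: "\<And>i j. (i, j) \<in> set T \<Longrightarrow> (p ! i, r ! j) \<in> set T"
    by (auto simp: list_all_iff)
  have xs: "distinct xs" "set xs \<subseteq> {..<n}" and ys: "distinct ys" "set ys \<subseteq> {..<n}"
    using Aut.prems(2) by (auto simp: embeds_def)
  have known: "(act xs p (xs ! i), act ys r (ys ! j)) \<in> E" if "(i, j) \<in> set T" for i j
  proof -
    have "i < length xs" "j < length ys" "(xs ! (p ! i), ys ! (r ! j)) \<in> E"
      using that T[OF that] Aut.prems(2) by (auto simp: embeds_def)
    then show ?thesis using xs ys by (simp add: act_nth)
  qed
  show ?case
  proof (rule not_bip_rigidI[OF reg act_permutes[OF xs p] act_permutes[OF ys r]])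
    show "act xs p \<noteq> id \<or> act ys r \<noteq> id"
      using ne act_nontrivial xs(1) ys(1) p r by blast
    fix x y assume xy: "(x, y) \<in> E"
    \<comment> \<open>An edge at a moved vertex lies in \<open>T\<close>, because that vertex is
      full, and \<open>T\<close> is mapped into itself; an edge between fixed vertices stays in
      place.\<close>
    consider "act xs p x \<noteq> x" | "act ys r y \<noteq> y" | "act xs p x = x" "act ys r y = y" by blast
    then show "(act xs p x, act ys r y) \<in> E"
    proof cases
      case 1
      then obtain i where "i < length xs" "x = xs ! i" "length (row_nbrs i T) = 3"
        using act_moved_full[OF xs(1) p] by metis
      then obtain j where "(i, j) \<in> set T" "y = ys ! j"
        using embeds_full_row[OF Aut.prems(2) reg] xy by metis
      then show ?thesis using known \<open>x = xs ! i\<close> by simp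
    next
      case 2
      then obtain j where "j < length ys" "y = ys ! j" "length (row_nbrs j (flip T)) = 3"
        using act_moved_full[OF ys(1) r] by metis
      moreover have "(y, x) \<in> E\<inverse>" using xy by simp
      ultimately obtain i where "(j, i) \<in> set (flip T)" "x = xs ! i"
        using embeds_full_row[OF embeds_flip[OF Aut.prems(2)] regular_converse[OF reg]] by metis
      then show ?thesis using known \<open>y = ys ! j\<close> by simp
    qed (use xy in simp)
  qed
next
  case (Quad i i' j j')
  then have lt: "i < length xs" "i' < length xs" "j < length ys" "j' < length ys"
    and sub: "{(xs ! i, ys ! j), (xs ! i, ys ! j'), (xs ! i', ys ! j), (xs ! i', ys ! j')} \<subseteq> E"
    and ne: "i \<noteq> i'" "j \<noteq> j'" and q
    by (auto simp: embeds_def)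
  have "xs ! i \<noteq> xs ! i'" "ys ! j \<noteq> ys ! j'"
    using Quad.prems(2) lt ne by (auto simp: embeds_def nth_eq_iff_index_eq)
  then show ?case using quad[OF \<open>q\<close> sub] by blast
next
  case (RowFull i)
  then show ?case using embeds_row_bound[OF RowFull.prems(2) reg] by force
next
  case (ColFull j)
  then show ?case
    using embeds_row_bound[OF embeds_flip[OF ColFull.prems(2)] regular_converse[OF reg]] by force
next
  case (Split i j c d)
  show ?case
  proof (cases "(xs ! i, ys ! j) \<in> E")
    case True
    then have "embeds n E xs ys ((i, j) # T) F"
      using Split.prems by (auto simp: embeds_def)
    then show ?thesis using Split.prems(1) by (intro Split.IH(1)) auto
  next
    case False
    then have "embeds n E xs ys T ((i, j) # F)"
      using Split.prems by (auto simp: embeds_def)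
    then show ?thesis using Split.prems(1) by (intro Split.IH(2)) auto
  qed
next
  case (RowNew i c)
  then have i: "i < length xs" "length (row_nbrs i T) < 3" "open_cols (length ys) T F i = []"
    by auto
  obtain y where y: "y < n" "y \<notin> set ys" "(xs ! i, y) \<in> E"
    using embeds_new_col[OF RowNew.prems(2) reg i] by blast
  then have "embeds n E xs (ys @ [y]) ((i, length ys) # T) F"
    using embeds_add_col[OF RowNew.prems(2)] i(1) by blast
  then show ?case using RowNew.prems(1) by (intro RowNew.IH) auto
next
  case (ColNew j c)
  then have j: "j < length ys" "length (row_nbrs j (flip T)) < 3"
      "open_cols (length xs) (flip T) (flip F) j = []"
    by auto
  obtain x where x: "x < n" "x \<notin> set xs" "(ys ! j, x) \<in> E\<inverse>"
    using embeds_new_col[OF embeds_flip[OF ColNew.prems(2)] regular_converse[OF reg] j] by blast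
  then have "embeds n E (xs @ [x]) ys ((length xs, j) # T) F"
    using embeds_flip[OF embeds_add_col[OF embeds_flip[OF ColNew.prems(2)] j(1)]]
    by (simp add: flip_def comp_def)
  then show ?case using ColNew.prems(1) by (intro ColNew.IH) auto
qed

text \<open>The search \<open>c\<close> starts from a 4-cycle and shows that a rigid graph contains
  none. This licenses \<open>Quad\<close> in the search \<open>d\<close>, which starts from a single
  row.\<close>

lemma cubic_not_rigid:
  assumes reg: "regular n 3 E" and "0 < n"
    and quad: "check False n 2 2 [(0, 0), (0, 1), (1, 0), (1, 1)] [] c"
    and root: "check True n 1 0 [] [] d"
  shows "\<not> bip_rigid n E"
proof
  assume rigid: "bip_rigid n E"
  have "embeds n E [0] [] [] []" using assms(2) by (simp add: embeds_def)
  moreover have "x = x' \<or> y = y'" if E: "{(x, y), (x, y'), (x', y), (x', y')} \<subseteq> E" for x x' y y'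
  proof (rule ccontr)
    assume "\<not> (x = x' \<or> y = y')"
    then have "embeds n E [x, x'] [y, y'] [(0, 0), (0, 1), (1, 0), (1, 1)] []"
      using E reg by (auto simp: embeds_def regular_def)
    then have "\<not> bip_rigid n E"
      by (intro check_sound[of False n "[x, x']" "[y, y']", OF _ _ reg])
        (use quad in \<open>auto simp: numeral_2_eq_2\<close>)
    then show False using rigid by simp
  qed
  ultimately have "\<not> bip_rigid n E"
    by (intro check_sound[of True n "[0]" "[]", OF _ _ reg]) (use root in auto)
  then show False using rigid by simp
qed

text \<open>Reading the start of the tree: \<open>RowNew 0\<close> and \<open>ColNew 0\<close>
  introduce column 2 and row 2. If row 1 also meets column 2, rows 0 and 1 have the same neighbours
  and \<open>Aut [1,0,2] [0,1,2]\<close> exchanges them; otherwise row 1 gets its own third column,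
  and so on.\<close>

lemma check_quad_6: "check False 6 2 2 [(0, 0), (0, 1), (1, 0), (1, 1)] [] (RowNew 0 (ColNew 0 (Split 1 2 (Aut [1,0,2] [0,1,2]) (RowNew 1 (Split 2 1 (Aut [0,1,2] [1,0,2,3])
    (ColNew 1 (Split 2 2 (Split 2 3 (Split 3 2 (Aut [0,2,1,3] [0,2,1,3]) (ColNew 2 (Split 3 3 (Aut
    [2,1,0,3,4] [0,3,2,1]) (RowNew 3 (RowNew 3 (Split 4 3 (Aut [1,0,2,3,4] [0,1,3,2,4,5]) (ColNew 3
    (Split 4 4 (Split 4 5 (Aut [0,2,1,4,3,5] [0,2,1,3,4,5]) (RowFull 4)) (RowFull 4))))))))) (RowNew
    2 (Split 3 2 (Split 3 3 (Aut [0,3,2,1] [2,1,0,3,4]) (ColNew 3 (ColNew 3 (Split 3 4 (Aut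
    [0,1,3,2,4,5] [1,0,2,3,4]) (RowNew 3 (Split 4 4 (Split 4 5 (Split 5 4 (Aut [0,2,1,3,4,5]
    [0,2,1,4,3,5]) (RowFull 5)) (RowFull 4)) (RowFull 4))))))) (ColNew 2 (Split 3 3 (Split 3 4
    (Split 4 3 (Aut [1,0,3,2,4] [1,0,3,2,4]) (ColNew 3 (Split 4 4 (RowFull 5) (RowFull 4)))) (RowNew
    3 (Split 4 3 (Split 4 4 (ColFull 5) (ColFull 4)) (ColNew 3 (Split 4 4 (Split 4 5 (Split 5 4 (Aut
    [0,2,1,4,3,5] [0,2,1,4,3,5]) (RowFull 5)) (RowFull 4)) (RowFull 4)))))) (Split 3 4 (RowNew 3
    (Split 4 4 (Split 4 3 (Aut [2,4,0,3,1] [2,4,0,3,1,5]) (ColFull 3)) (ColNew 4 (Split 4 3 (Split 5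
    3 (Split 4 5 (Aut [0,2,1,4,3,5] [0,2,1,4,3,5]) (RowFull 4)) (RowFull 5)) (RowFull 4)))))
    (RowFull 3))))))) (Split 2 3 (RowNew 2 (Split 3 3 (Split 3 2 (Aut [3,1,2,0] [3,1,2,0,4]) (ColNew
    2 (ColNew 2 (Split 3 4 (Aut [0,1,3,2,4,5] [1,0,2,3,4]) (RowNew 3 (Split 4 4 (Split 4 5 (Split 5
    4 (Aut [2,1,0,3,4,5] [0,3,4,1,2,5]) (RowFull 5)) (RowFull 4)) (RowFull 4))))))) (ColNew 3 (Split
    3 2 (Split 4 2 (Split 3 4 (Aut [1,0,3,2,4] [1,0,3,2,4]) (RowNew 3 (Split 4 4 (ColFull 5)
    (ColFull 4)))) (ColNew 2 (Split 3 4 (Split 4 4 (RowFull 5) (RowFull 4)) (RowNew 3 (Split 4 4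
    (Split 4 5 (Split 5 4 (Aut [2,1,0,4,3,5] [0,3,4,1,2,5]) (RowFull 5)) (RowFull 4)) (RowFull
    4)))))) (Split 4 2 (ColNew 2 (Split 4 4 (Split 3 4 (Aut [4,2,1,3,0,5] [3,4,2,0,1]) (RowFull 3))
    (RowNew 4 (Split 3 4 (Split 3 5 (Split 5 4 (Aut [2,1,0,4,3,5] [0,3,4,1,2,5]) (RowFull 5))
    (RowFull 3)) (RowFull 3))))) (ColFull 2)))))) (RowNew 2 (RowNew 2 (Split 3 2 (ColNew 2 (Split 3
    3 (Split 4 3 (Aut [1,0,2,3,4] [0,1,3,2,4,5]) (ColNew 3 (Split 4 4 (Split 4 5 (Aut [0,3,4,1,2,5]
    [2,1,0,3,4,5]) (RowFull 4)) (RowFull 4)))) (Split 4 3 (ColNew 3 (Split 3 4 (Split 4 4 (Aut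
    [3,4,2,0,1,5] [4,2,1,3,0,5]) (Split 4 5 (Split 5 4 (Aut [0,3,4,1,2,5] [2,1,0,4,3,5]) (RowFull
    5)) (RowFull 4))) (Split 3 5 (Split 4 4 (Split 5 4 (Split 5 5 (Aut [5,4,1,2,3,0] [3,4,5,2,1,0])
    (RowFull 5)) (RowFull 5)) (ColFull 4)) (RowFull 3)))) (ColFull 3)))) (ColNew 2 (ColNew 2 (Split
    3 3 (Split 3 4 (Split 4 3 (Split 4 4 (Aut [4,3,2,1,0,5] [4,3,2,1,0,5]) (Split 4 5 (Split 5 4
    (Aut [3,1,4,0,2,5] [3,1,4,0,2,5]) (RowFull 5)) (RowFull 4))) (Split 5 3 (Split 4 4 (Split 4 5
    (Split 5 5 (Aut [5,4,0,2,1,3] [2,5,3,4,0,1]) (RowFull 5)) (RowFull 4)) (RowFull 4)) (ColFull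
    3))) (Split 3 5 (Split 4 3 (Split 4 4 (Split 5 4 (Split 5 5 (Aut [4,5,0,2,3,1] [2,4,3,5,1,0])
    (RowFull 5)) (RowFull 5)) (ColFull 4)) (Split 5 3 (Split 5 4 (Split 4 4 (Split 4 5 (Aut
    [5,4,0,2,1,3] [2,4,3,5,1,0]) (RowFull 4)) (RowFull 4)) (ColFull 4)) (ColFull 3))) (RowFull 3)))
    (Split 3 4 (Split 3 5 (Aut [0,1,3,2,4,5] [1,0,2,3,4,5]) (RowFull 3)) (RowFull 3))))))))))))))))"
  by code_simp

text \<open>Without 4-cycles, a row and the two further rows at each of its three columns are seven
  distinct rows. Six are too few, so every branch ends in \<open>Quad\<close> or
  \<open>RowFull\<close>.\<close>

lemma check_root_6: "check True 6 1 0 [] [] (RowNew 0 (RowNew 0 (RowNew 0 (ColNew 0 (ColNew 0 (Split 1 1 (Quad 1 0 0 1) (Split 1 2 (Quad 1 0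
    0 2) (RowNew 1 (RowNew 1 (Split 2 1 (Quad 2 0 0 1) (ColNew 1 (ColNew 1 (Split 2 2 (Quad 2 0 0 2)
    (Split 2 3 (Quad 2 1 0 3) (Split 2 4 (Quad 2 1 0 4) (RowFull 2))))))))))))))))"
  by code_simp

lemma check_quad_7: "check False 7 2 2 [(0, 0), (0, 1), (1, 0), (1, 1)] [] (RowNew 0 (ColNew 0 (Split 1 2 (Aut [1,0,2] [0,1,2]) (RowNew 1 (Split 2 1 (Aut [0,1,2] [1,0,2,3])
    (ColNew 1 (Split 2 2 (Split 2 3 (Split 3 2 (Aut [0,2,1,3] [0,2,1,3]) (ColNew 2 (Split 3 3 (Aut
    [2,1,0,3,4] [0,3,2,1]) (RowNew 3 (RowNew 3 (Split 4 3 (Aut [1,0,2,3,4] [0,1,3,2,4,5]) (ColNew 3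
    (Split 4 4 (Split 4 5 (Aut [0,2,1,4,3,5] [0,2,1,3,4,5]) (RowNew 4 (Split 5 4 (Split 5 5 (Aut
    [2,1,0,5,4,3] [0,3,2,1,4,5,6]) (ColFull 5)) (ColNew 4 (Split 5 5 (Split 5 6 (Split 6 5 (Aut
    [1,0,2,3,5,4,6] [0,1,3,2,5,4,6]) (RowFull 6)) (RowFull 5)) (RowFull 5)))))) (Split 4 5 (RowNew 4
    (Split 5 5 (Split 5 4 (Aut [2,1,0,5,4,3] [0,3,2,1,4,5,6]) (ColFull 4)) (ColNew 5 (Split 5 4
    (Split 6 4 (Split 5 6 (Aut [1,0,2,3,5,4,6] [0,1,3,2,5,4,6]) (RowFull 5)) (RowFull 6)) (RowFull
    5))))) (RowFull 4)))))))))) (RowNew 2 (Split 3 2 (Split 3 3 (Aut [0,3,2,1] [2,1,0,3,4]) (ColNew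
    3 (ColNew 3 (Split 3 4 (Aut [0,1,3,2,4,5] [1,0,2,3,4]) (RowNew 3 (Split 4 4 (Split 4 5 (Split 5
    4 (Aut [0,2,1,3,4,5] [0,2,1,4,3,5]) (ColNew 4 (Split 5 5 (Aut [0,3,2,1,4,5,6] [2,1,0,5,4,3])
    (RowFull 5)))) (RowNew 4 (Split 5 4 (Aut [0,2,1,3,4,5] [0,2,1,4,3,5,6]) (ColNew 4 (Split 5 5
    (Split 5 6 (Split 6 5 (Aut [0,1,3,2,5,4,6] [1,0,2,3,5,4,6]) (RowFull 6)) (RowFull 5)) (RowFull
    5)))))) (Split 4 5 (RowNew 4 (Split 5 5 (Aut [0,3,2,1,4,5] [2,1,0,5,4,3,6]) (ColNew 5 (Split 5 4
    (Split 6 4 (Split 5 6 (Aut [0,1,3,2,5,4,6] [1,0,2,3,5,4,6]) (RowFull 5)) (RowFull 6)) (RowFull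
    5))))) (RowFull 4)))))))) (ColNew 2 (Split 3 3 (Split 3 4 (Split 4 3 (Aut [1,0,3,2,4]
    [1,0,3,2,4]) (ColNew 3 (Split 4 4 (RowNew 4 (Split 5 5 (RowNew 5 (ColFull 6)) (RowFull 5)))
    (RowNew 4 (RowNew 4 (Split 5 4 (Split 5 5 (ColFull 6) (ColFull 5)) (ColNew 4 (Split 5 5 (Split 5
    6 (Aut [1,0,3,2,5,4,6] [1,0,3,2,4,5,6]) (RowFull 5)) (RowFull 5))))))))) (RowNew 3 (Split 4 3
    (Split 4 4 (ColNew 4 (Split 5 5 (RowNew 5 (ColFull 6)) (RowFull 5))) (ColNew 4 (ColNew 4 (Split
    4 5 (Split 5 5 (RowFull 6) (RowFull 5)) (RowNew 4 (Split 5 5 (Split 5 6 (Split 6 5 (Aut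
    [1,0,3,2,4,5,6] [1,0,3,2,5,4,6]) (RowFull 6)) (RowFull 5)) (RowFull 5))))))) (ColNew 3 (Split 4
    4 (Split 4 5 (Split 5 4 (Aut [0,2,1,4,3,5] [0,2,1,4,3,5]) (ColNew 4 (Split 5 5 (RowFull 6)
    (RowFull 5)))) (RowNew 4 (Split 5 4 (Split 5 5 (ColFull 6) (ColFull 5)) (ColNew 4 (Split 5 5
    (Split 5 6 (Split 6 5 (Aut [1,0,3,2,5,4,6] [1,0,3,2,5,4,6]) (RowFull 6)) (RowFull 5)) (RowFull
    5)))))) (Split 4 5 (RowNew 4 (Split 5 5 (Split 5 4 (Aut [3,1,5,0,4,2] [3,1,5,0,4,2,6]) (ColFull
    4)) (ColNew 5 (Split 5 4 (Split 6 4 (Split 5 6 (Aut [1,0,3,2,5,4,6] [1,0,3,2,5,4,6]) (RowFull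
    5)) (RowFull 6)) (RowFull 5))))) (RowFull 4))))))) (Split 3 4 (RowNew 3 (Split 4 4 (Split 4 3
    (Aut [2,4,0,3,1] [2,4,0,3,1,5]) (ColNew 3 (ColNew 3 (Split 4 5 (Split 5 5 (RowFull 6) (RowFull
    5)) (RowNew 4 (Split 5 5 (Split 5 6 (Split 6 5 (Split 6 6 (Aut [2,4,0,3,1,6,5] [2,4,0,6,1,5,3])
    (RowFull 6)) (RowFull 6)) (RowFull 5)) (RowFull 5))))))) (ColNew 4 (Split 4 3 (Split 5 3 (Split
    4 5 (Aut [0,2,1,4,3,5] [0,2,1,4,3,5]) (RowNew 4 (Split 5 5 (ColFull 6) (ColFull 5)))) (ColNew 3
    (Split 4 5 (Split 5 5 (RowFull 6) (RowFull 5)) (RowNew 4 (Split 5 5 (Split 5 6 (Split 6 5 (Split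
    6 6 (Aut [0,2,1,4,3,6,5] [0,2,1,4,3,6,5]) (RowFull 6)) (RowFull 6)) (RowFull 5)) (RowFull
    5)))))) (Split 5 3 (ColNew 3 (Split 5 5 (Split 4 5 (RowFull 6) (RowFull 4)) (RowNew 5 (Split 4 5
    (Split 4 6 (Split 6 5 (Split 6 6 (Aut [6,4,5,3,1,2,0] [6,5,3,2,4,1,0]) (RowFull 6)) (RowFull 6))
    (RowFull 4)) (RowFull 4))))) (ColFull 3)))))) (RowNew 3 (RowNew 3 (Split 4 3 (ColNew 3 (Split 4
    4 (Split 5 4 (Split 5 5 (ColFull 6) (ColFull 5)) (ColNew 4 (Split 5 5 (Split 5 6 (Split 6 5
    (Split 6 6 (Aut [2,4,0,6,1,5,3] [2,4,0,3,1,6,5]) (RowFull 6)) (RowFull 6)) (RowFull 5)) (RowFull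
    5)))) (Split 5 4 (ColNew 4 (Split 4 5 (Split 5 5 (RowFull 6) (Split 5 6 (Split 6 5 (Split 6 6
    (Aut [6,5,3,2,4,1,0] [6,4,5,3,1,2,0]) (RowFull 6)) (RowFull 6)) (RowFull 5))) (Split 4 6 (Split
    5 5 (Split 6 5 (Split 6 6 (Aut [6,5,3,2,4,1,0] [5,4,6,3,1,0,2]) (RowFull 6)) (RowFull 6))
    (ColFull 5)) (RowFull 4)))) (ColFull 4)))) (ColNew 3 (ColNew 3 (Split 4 4 (Split 4 5 (Split 5 4
    (Split 5 5 (Aut [4,5,2,3,0,1,6] [4,5,2,3,0,1,6]) (Split 5 6 (Split 6 5 (Aut [2,4,0,5,1,3,6]
    [2,4,0,5,1,3,6]) (RowFull 6)) (RowFull 5))) (Split 6 4 (Split 5 5 (Split 5 6 (Split 6 6 (Aut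
    [2,4,0,6,1,5,3] [2,4,0,5,1,3,6]) (RowFull 6)) (RowFull 5)) (RowFull 5)) (ColFull 4))) (Split 4 6
    (Split 5 4 (Split 5 5 (Split 6 5 (Split 6 6 (Aut [2,4,0,5,1,3,6] [2,4,0,6,1,5,3]) (RowFull 6))
    (RowFull 6)) (ColFull 5)) (Split 6 4 (Split 6 5 (Split 5 5 (Split 5 6 (Aut [2,4,0,6,1,5,3]
    [2,4,0,6,1,5,3]) (RowFull 5)) (RowFull 5)) (ColFull 5)) (ColFull 4))) (RowFull 4))) (Split 4 5
    (Split 4 6 (Split 5 5 (Split 5 4 (Split 6 4 (Aut [0,2,1,4,3,5,6] [0,2,1,4,3,5,6]) (RowFull 6))
    (ColFull 4)) (Split 6 5 (Split 6 4 (Split 5 4 (Aut [0,2,1,4,3,5,6] [0,2,1,4,3,5,6]) (RowFull 5))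
    (ColFull 4)) (ColFull 5))) (RowFull 4)) (RowFull 4)))))))))))))) (Split 2 3 (RowNew 2 (Split 3 3
    (Split 3 2 (Aut [3,1,2,0] [3,1,2,0,4]) (ColNew 2 (ColNew 2 (Split 3 4 (Aut [0,1,3,2,4,5]
    [1,0,2,3,4]) (RowNew 3 (Split 4 4 (Split 4 5 (Split 5 4 (Aut [2,1,0,3,4,5] [0,3,4,1,2,5])
    (ColNew 4 (Split 5 5 (Aut [3,1,2,0,4,5,6] [3,1,5,0,4,2]) (RowFull 5)))) (RowNew 4 (Split 5 4
    (Aut [2,1,0,3,4,5] [0,3,4,1,2,5,6]) (ColNew 4 (Split 5 5 (Split 5 6 (Split 6 5 (Aut
    [0,1,3,2,5,4,6] [1,0,2,3,5,4,6]) (RowFull 6)) (RowFull 5)) (RowFull 5)))))) (Split 4 5 (RowNew 4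
    (Split 5 5 (Aut [3,1,2,0,4,5] [3,1,5,0,4,2,6]) (ColNew 5 (Split 5 4 (Split 6 4 (Split 5 6 (Aut
    [0,1,3,2,5,4,6] [1,0,2,3,5,4,6]) (RowFull 5)) (RowFull 6)) (RowFull 5))))) (RowFull 4))))))))
    (ColNew 3 (Split 3 2 (Split 4 2 (Split 3 4 (Aut [1,0,3,2,4] [1,0,3,2,4]) (RowNew 3 (Split 4 4
    (ColNew 4 (Split 5 5 (RowNew 5 (ColFull 6)) (RowFull 5))) (ColNew 4 (ColNew 4 (Split 4 5 (Split
    5 5 (RowFull 6) (RowFull 5)) (RowNew 4 (Split 5 5 (Split 5 6 (Split 6 5 (Aut [1,0,3,2,4,5,6]
    [1,0,3,2,5,4,6]) (RowFull 6)) (RowFull 5)) (RowFull 5))))))))) (ColNew 2 (Split 3 4 (Split 4 4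
    (RowNew 4 (Split 5 5 (RowNew 5 (ColFull 6)) (RowFull 5))) (RowNew 4 (RowNew 4 (Split 5 4 (Split
    5 5 (ColFull 6) (ColFull 5)) (ColNew 4 (Split 5 5 (Split 5 6 (Aut [1,0,3,2,5,4,6]
    [1,0,3,2,4,5,6]) (RowFull 5)) (RowFull 5))))))) (RowNew 3 (Split 4 4 (Split 4 5 (Split 5 4 (Aut
    [2,1,0,4,3,5] [0,3,4,1,2,5]) (ColNew 4 (Split 5 5 (RowFull 6) (RowFull 5)))) (RowNew 4 (Split 5
    4 (Split 5 5 (ColFull 6) (ColFull 5)) (ColNew 4 (Split 5 5 (Split 5 6 (Split 6 5 (Aut
    [1,0,3,2,5,4,6] [1,0,3,2,5,4,6]) (RowFull 6)) (RowFull 5)) (RowFull 5)))))) (Split 4 5 (RowNew 4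
    (Split 5 5 (Split 5 4 (Aut [0,3,5,1,4,2] [2,1,0,5,4,3,6]) (ColFull 4)) (ColNew 5 (Split 5 4
    (Split 6 4 (Split 5 6 (Aut [1,0,3,2,5,4,6] [1,0,3,2,5,4,6]) (RowFull 5)) (RowFull 6)) (RowFull
    5))))) (RowFull 4))))))) (Split 4 2 (ColNew 2 (Split 4 4 (Split 3 4 (Aut [4,2,1,3,0,5]
    [3,4,2,0,1]) (RowNew 3 (RowNew 3 (Split 5 4 (Split 5 5 (ColFull 6) (ColFull 5)) (ColNew 4 (Split
    5 5 (Split 5 6 (Split 6 5 (Split 6 6 (Aut [4,2,1,6,0,5,3] [3,4,2,0,1,6,5]) (RowFull 6)) (RowFull
    6)) (RowFull 5)) (RowFull 5))))))) (RowNew 4 (Split 3 4 (Split 3 5 (Split 5 4 (Aut [2,1,0,4,3,5]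
    [0,3,4,1,2,5]) (ColNew 4 (Split 5 5 (RowFull 6) (RowFull 5)))) (RowNew 3 (Split 5 4 (Split 5 5
    (ColFull 6) (ColFull 5)) (ColNew 4 (Split 5 5 (Split 5 6 (Split 6 5 (Split 6 6 (Aut
    [2,1,0,4,3,6,5] [0,3,4,1,2,6,5]) (RowFull 6)) (RowFull 6)) (RowFull 5)) (RowFull 5)))))) (Split
    3 5 (RowNew 3 (Split 5 5 (Split 5 4 (ColFull 6) (ColFull 4)) (ColNew 5 (Split 5 4 (Split 6 4
    (Split 5 6 (Split 6 6 (Aut [5,6,3,2,4,0,1] [6,4,2,5,1,3,0]) (RowFull 6)) (RowFull 5)) (RowFull
    6)) (RowFull 5))))) (RowFull 3)))))) (ColNew 2 (ColNew 2 (Split 3 4 (RowNew 3 (Split 4 4 (Split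
    4 5 (Split 5 5 (RowFull 6) (RowFull 5)) (RowNew 4 (Split 5 5 (Split 5 6 (Split 6 5 (Split 6 6
    (Aut [4,2,1,3,0,6,5] [3,4,6,0,1,5,2]) (RowFull 6)) (RowFull 6)) (RowFull 5)) (RowFull 5))))
    (Split 4 5 (RowNew 4 (Split 5 4 (Split 5 5 (RowFull 6) (Split 5 6 (Split 6 5 (Split 6 6 (Aut
    [4,6,5,3,0,2,1] [6,5,3,2,4,1,0]) (RowFull 6)) (RowFull 6)) (RowFull 5))) (Split 6 4 (Split 5 5
    (Split 5 6 (Split 6 6 (Aut [4,5,6,3,0,1,2] [6,5,3,2,4,1,0]) (RowFull 6)) (RowFull 5)) (RowFull
    5)) (ColFull 4)))) (RowFull 4)))) (RowNew 3 (RowNew 3 (Split 4 4 (Split 4 5 (Split 5 4 (Split 5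
    5 (Aut [5,4,2,3,1,0,6] [4,5,2,3,0,1,6]) (Split 5 6 (Split 6 5 (Aut [4,2,1,5,0,3,6]
    [3,4,5,0,1,2,6]) (RowFull 6)) (RowFull 5))) (Split 6 4 (Split 5 5 (Split 5 6 (Split 6 6 (Aut
    [4,2,1,6,0,5,3] [3,4,5,0,1,2,6]) (RowFull 6)) (RowFull 5)) (RowFull 5)) (ColFull 4))) (Split 4 6
    (Split 5 4 (Split 5 5 (Split 6 5 (Split 6 6 (Aut [4,2,1,5,0,3,6] [3,4,6,0,1,5,2]) (RowFull 6))
    (RowFull 6)) (ColFull 5)) (Split 6 4 (Split 6 5 (Split 5 5 (Split 5 6 (Aut [4,2,1,6,0,5,3]
    [3,4,6,0,1,5,2]) (RowFull 5)) (RowFull 5)) (ColFull 5)) (ColFull 4))) (RowFull 4))) (Split 4 5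
    (Split 4 6 (Split 5 5 (Split 5 4 (Split 6 4 (Aut [2,1,0,4,3,5,6] [0,3,4,1,2,5,6]) (RowFull 6))
    (ColFull 4)) (Split 6 5 (Split 6 4 (Split 5 4 (Aut [2,1,0,4,3,5,6] [0,3,4,1,2,5,6]) (RowFull 5))
    (ColFull 4)) (ColFull 5))) (RowFull 4)) (RowFull 4))))))))))))) (RowNew 2 (RowNew 2 (Split 3 2
    (ColNew 2 (Split 3 3 (Split 4 3 (Aut [1,0,2,3,4] [0,1,3,2,4,5]) (ColNew 3 (Split 4 4 (Split 4 5
    (Aut [0,3,4,1,2,5] [2,1,0,3,4,5]) (RowNew 4 (Split 5 4 (Split 5 5 (Aut [3,1,5,0,4,2]
    [3,1,2,0,4,5,6]) (ColFull 5)) (ColNew 4 (Split 5 5 (Split 5 6 (Split 6 5 (Aut [1,0,2,3,5,4,6]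
    [0,1,3,2,5,4,6]) (RowFull 6)) (RowFull 5)) (RowFull 5)))))) (Split 4 5 (RowNew 4 (Split 5 5
    (Split 5 4 (Aut [3,1,5,0,4,2] [3,1,2,0,4,5,6]) (ColFull 4)) (ColNew 5 (Split 5 4 (Split 6 4
    (Split 5 6 (Aut [1,0,2,3,5,4,6] [0,1,3,2,5,4,6]) (RowFull 5)) (RowFull 6)) (RowFull 5)))))
    (RowFull 4))))) (Split 4 3 (ColNew 3 (Split 3 4 (Split 4 4 (Aut [3,4,2,0,1,5] [4,2,1,3,0,5])
    (Split 4 5 (Split 5 4 (Aut [0,3,4,1,2,5] [2,1,0,4,3,5]) (ColNew 4 (Split 5 5 (RowFull 6)
    (RowFull 5)))) (RowNew 4 (Split 5 4 (Split 5 5 (ColFull 6) (ColFull 5)) (ColNew 4 (Split 5 5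
    (Split 5 6 (Split 6 5 (Split 6 6 (Aut [0,3,4,1,2,6,5] [2,1,0,4,3,6,5]) (RowFull 6)) (RowFull 6))
    (RowFull 5)) (RowFull 5))))))) (Split 3 5 (Split 4 4 (Split 5 4 (Split 5 5 (Aut [5,4,1,2,3,0]
    [3,4,5,2,1,0]) (RowNew 5 (ColFull 6))) (ColNew 4 (Split 5 5 (Aut [0,3,4,1,2,5,6] [2,1,0,5,4,3])
    (RowFull 5)))) (Split 4 5 (Aut [3,4,2,0,1,5] [5,2,1,3,4,0]) (RowNew 4 (Split 5 5 (Split 5 4
    (ColFull 6) (ColFull 4)) (ColNew 5 (Split 5 4 (Split 6 4 (Split 5 6 (Split 6 6 (Aut
    [0,3,4,1,2,6,5] [2,1,0,5,6,3,4]) (RowFull 6)) (RowFull 5)) (RowFull 6)) (RowFull 5)))))))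
    (RowNew 3 (Split 4 4 (Split 5 4 (Split 5 5 (ColFull 6) (ColFull 5)) (ColNew 4 (Split 5 5 (Split
    5 6 (Split 6 5 (Split 6 6 (Aut [6,5,3,2,4,1,0] [6,5,4,3,2,1,0]) (RowFull 6)) (RowFull 6))
    (RowFull 5)) (RowFull 5)))) (Split 5 4 (ColNew 4 (Split 4 5 (Split 5 5 (RowFull 6) (Split 5 6
    (Split 6 5 (Split 6 6 (Aut [6,5,3,2,4,1,0] [6,4,5,3,1,2,0]) (RowFull 6)) (RowFull 6)) (RowFull
    5))) (Split 4 6 (Split 5 5 (Split 6 5 (Aut [0,1,2,3,4,5,6] [0,1,2,3,5,4,6]) (RowFull 6))
    (ColFull 5)) (RowFull 4)))) (ColFull 4))))))) (ColNew 3 (ColNew 3 (Split 3 4 (Split 4 4 (Split 4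
    5 (Split 5 5 (RowFull 6) (RowFull 5)) (RowNew 4 (Split 5 5 (Split 5 6 (Split 6 5 (Split 6 6 (Aut
    [3,4,2,0,1,6,5] [4,2,1,6,0,5,3]) (RowFull 6)) (RowFull 6)) (RowFull 5)) (RowFull 5)))) (Split 4
    5 (RowNew 4 (Split 5 4 (Split 5 5 (RowFull 6) (Split 5 6 (Split 6 5 (Split 6 6 (Aut
    [6,4,2,5,1,3,0] [5,6,3,2,4,0,1]) (RowFull 6)) (RowFull 6)) (RowFull 5))) (Split 6 4 (Split 5 5
    (Split 5 6 (Split 6 6 (Aut [5,4,2,6,1,0,3] [5,6,3,2,4,0,1]) (RowFull 6)) (RowFull 5)) (RowFull
    5)) (ColFull 4)))) (RowFull 4))) (Split 3 5 (Split 4 4 (Split 4 5 (Split 5 4 (RowFull 6)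
    (RowFull 5)) (RowNew 4 (Split 5 4 (Split 5 5 (RowFull 6) (Split 5 6 (Split 6 5 (Split 6 6 (Aut
    [5,4,2,6,1,0,3] [4,6,3,2,0,5,1]) (RowFull 6)) (RowFull 6)) (RowFull 5))) (Split 6 4 (Split 5 5
    (Split 5 6 (Split 6 6 (Aut [6,4,2,5,1,3,0] [4,6,3,2,0,5,1]) (RowFull 6)) (RowFull 5)) (RowFull
    5)) (ColFull 4))))) (Split 4 5 (RowNew 4 (Split 5 4 (Split 6 4 (Split 5 6 (Split 6 6 (Aut
    [3,4,2,0,1,6,5] [5,2,1,6,4,0,3]) (RowFull 6)) (RowFull 5)) (RowFull 6)) (RowFull 5))) (RowFull
    4))) (RowNew 3 (Split 4 4 (Split 4 5 (Split 5 4 (Split 5 5 (Aut [0,1,2,3,4,5,6] [0,1,2,3,5,4,6])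
    (Split 5 6 (Split 6 5 (Split 6 6 (Aut [0,3,4,1,2,6,5] [2,1,0,6,5,4,3]) (RowFull 6)) (RowFull 6))
    (RowFull 5))) (Split 6 4 (Split 5 5 (Split 5 6 (Split 6 6 (Aut [0,3,4,1,2,6,5] [2,1,0,6,5,4,3])
    (RowFull 6)) (RowFull 5)) (RowFull 5)) (ColFull 4))) (Split 4 6 (Split 5 4 (Split 5 5 (Split 6 5
    (Split 6 6 (Aut [3,4,6,0,1,5,2] [6,2,1,4,3,5,0]) (RowFull 6)) (RowFull 6)) (ColFull 5)) (Split 6
    4 (Split 6 5 (Split 5 5 (Split 5 6 (Aut [3,4,5,0,1,2,6] [6,2,1,4,3,5,0]) (RowFull 5)) (RowFull
    5)) (ColFull 5)) (ColFull 4))) (RowFull 4))) (Split 4 5 (Split 4 6 (Split 5 5 (Split 5 4 (Split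
    6 4 (Split 6 6 (Aut [3,4,6,0,1,5,2] [6,2,1,5,4,3,0]) (RowFull 6)) (RowFull 6)) (ColFull 4))
    (Split 6 5 (Split 6 4 (Split 5 4 (Split 5 6 (Aut [3,4,5,0,1,2,6] [6,2,1,5,4,3,0]) (RowFull 5))
    (RowFull 5)) (ColFull 4)) (ColFull 5))) (RowFull 4)) (RowFull 4))))))))))) (ColNew 2 (ColNew 2
    (Split 3 3 (Split 3 4 (Split 4 3 (Split 4 4 (Aut [4,3,2,1,0,5] [4,3,2,1,0,5]) (Split 4 5 (Split
    5 4 (Aut [3,1,4,0,2,5] [3,1,4,0,2,5]) (ColNew 4 (Split 5 5 (RowFull 6) (RowFull 5)))) (RowNew 4
    (Split 5 4 (Split 5 5 (ColFull 6) (ColFull 5)) (ColNew 4 (Split 5 5 (Split 5 6 (Split 6 5 (Split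
    6 6 (Aut [3,1,4,0,2,6,5] [3,1,4,0,2,6,5]) (RowFull 6)) (RowFull 6)) (RowFull 5)) (RowFull
    5))))))) (Split 5 3 (Split 4 4 (Split 4 5 (Split 5 5 (Aut [5,4,0,2,1,3] [2,5,3,4,0,1]) (RowNew 5
    (ColFull 6))) (RowNew 4 (Split 5 5 (Aut [3,1,5,0,4,2] [3,1,4,0,2,5,6]) (ColFull 5)))) (Split 5 4
    (Aut [5,3,2,1,4,0] [4,3,2,1,0,5]) (ColNew 4 (Split 5 5 (Split 4 5 (RowFull 6) (RowFull 4))
    (RowNew 5 (Split 4 5 (Split 4 6 (Split 6 5 (Split 6 6 (Aut [3,1,5,0,6,2,4] [3,1,4,0,2,6,5])
    (RowFull 6)) (RowFull 6)) (RowFull 4)) (RowFull 4))))))) (ColNew 3 (Split 4 4 (Split 4 5 (Split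
    5 5 (RowFull 6) (RowFull 5)) (RowNew 4 (Split 5 5 (Split 5 6 (Split 6 5 (Split 6 6 (Aut
    [6,5,2,4,3,1,0] [5,6,3,2,4,0,1]) (RowFull 6)) (RowFull 6)) (RowFull 5)) (RowFull 5)))) (Split 4
    5 (RowNew 4 (Split 5 4 (Split 5 5 (RowFull 6) (Split 5 6 (Split 6 5 (Split 6 6 (Aut
    [6,4,2,5,1,3,0] [5,6,3,2,4,0,1]) (RowFull 6)) (RowFull 6)) (RowFull 5))) (Split 6 4 (Split 5 5
    (Split 5 6 (Aut [0,1,2,3,5,4,6] [0,1,2,3,4,5,6]) (RowFull 5)) (RowFull 5)) (ColFull 4))))
    (RowFull 4)))))) (Split 3 5 (Split 4 3 (Split 4 4 (Split 5 4 (Split 5 5 (Aut [4,5,0,2,3,1]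
    [2,4,3,5,1,0]) (RowNew 5 (ColFull 6))) (ColNew 4 (Split 5 5 (Aut [3,1,4,0,2,5,6] [3,1,5,0,4,2])
    (RowFull 5)))) (Split 4 5 (Aut [4,3,2,1,0,5] [5,3,2,1,4,0]) (RowNew 4 (Split 5 5 (Split 5 4
    (ColFull 6) (ColFull 4)) (ColNew 5 (Split 5 4 (Split 6 4 (Split 5 6 (Split 6 6 (Aut
    [3,1,4,0,2,6,5] [3,1,5,0,6,2,4]) (RowFull 6)) (RowFull 5)) (RowFull 6)) (RowFull 5))))))) (Split
    5 3 (Split 5 4 (Split 4 4 (Split 4 5 (Aut [5,4,0,2,1,3] [2,4,3,5,1,0]) (RowNew 4 (ColFull 6)))
    (ColNew 4 (Split 4 5 (Aut [3,1,5,0,4,2,6] [3,1,5,0,4,2]) (RowFull 4)))) (Split 5 5 (Aut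
    [5,3,2,1,4,0] [5,3,2,1,4,0]) (RowNew 5 (Split 4 5 (Split 4 4 (ColFull 6) (ColFull 4)) (ColNew 5
    (Split 4 4 (Split 4 6 (Split 6 4 (Split 6 6 (Aut [3,1,5,0,6,2,4] [3,1,5,0,6,2,4]) (RowFull 6))
    (RowFull 6)) (RowFull 4)) (RowFull 4))))))) (ColNew 3 (Split 4 4 (Split 4 5 (Split 5 4 (RowFull
    6) (RowFull 5)) (RowNew 4 (Split 5 4 (Split 5 5 (RowFull 6) (Split 5 6 (Aut [0,1,2,3,5,4,6]
    [0,1,2,3,4,5,6]) (RowFull 5))) (Split 6 4 (Split 5 5 (Split 5 6 (Split 6 6 (Aut [6,4,2,5,1,3,0]
    [4,6,3,2,0,5,1]) (RowFull 6)) (RowFull 5)) (RowFull 5)) (ColFull 4))))) (Split 4 5 (RowNew 4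
    (Split 5 4 (Split 6 4 (Split 5 6 (Split 6 6 (Aut [6,5,2,4,3,1,0] [4,6,3,2,0,5,1]) (RowFull 6))
    (RowFull 5)) (RowFull 6)) (RowFull 5))) (RowFull 4)))))) (RowNew 3 (Split 4 3 (Split 4 4 (Split
    5 4 (Split 5 5 (ColFull 6) (ColFull 5)) (ColNew 4 (Split 5 5 (Split 5 6 (Split 6 5 (Split 6 6
    (Aut [5,6,3,2,4,0,1] [6,5,2,4,3,1,0]) (RowFull 6)) (RowFull 6)) (RowFull 5)) (RowFull 5))))
    (Split 5 4 (ColNew 4 (Split 4 5 (Split 5 5 (RowFull 6) (Split 5 6 (Split 6 5 (Split 6 6 (Aut
    [5,6,3,2,4,0,1] [6,4,2,5,1,3,0]) (RowFull 6)) (RowFull 6)) (RowFull 5))) (Split 4 6 (Split 5 5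
    (Split 6 5 (Aut [0,1,2,3,4,5,6] [0,1,2,3,5,4,6]) (RowFull 6)) (ColFull 5)) (RowFull 4))))
    (ColFull 4))) (Split 5 3 (Split 4 4 (Split 5 4 (Split 4 5 (ColFull 6) (ColFull 5)) (ColNew 4
    (Split 4 5 (Split 5 5 (RowFull 6) (Split 5 6 (Split 6 5 (Aut [0,1,2,3,4,5,6] [0,1,2,3,5,4,6])
    (RowFull 6)) (RowFull 5))) (Split 4 6 (Split 5 5 (Split 6 5 (Split 6 6 (Aut [4,6,3,2,0,5,1]
    [6,4,2,5,1,3,0]) (RowFull 6)) (RowFull 6)) (ColFull 5)) (RowFull 4))))) (Split 5 4 (ColNew 4
    (Split 4 5 (Split 4 6 (Split 6 5 (Split 6 6 (Aut [4,6,3,2,0,5,1] [6,5,2,4,3,1,0]) (RowFull 6))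
    (RowFull 6)) (RowFull 4)) (RowFull 4))) (ColFull 4))) (ColNew 3 (Split 4 4 (Split 4 5 (Split 5 4
    (Split 5 5 (Aut [0,1,2,3,5,4,6] [0,1,2,3,5,4,6]) (Split 5 6 (Split 6 5 (Split 6 6 (Aut
    [6,3,5,1,4,2,0] [6,3,5,1,4,2,0]) (RowFull 6)) (RowFull 6)) (RowFull 5))) (Split 6 4 (Split 5 5
    (Split 5 6 (Split 6 6 (Aut [6,3,5,1,4,2,0] [6,3,4,1,2,5,0]) (RowFull 6)) (RowFull 5)) (RowFull
    5)) (ColFull 4))) (Split 4 6 (Split 5 4 (Split 5 5 (Split 6 5 (Split 6 6 (Aut [6,3,4,1,2,5,0]
    [6,3,5,1,4,2,0]) (RowFull 6)) (RowFull 6)) (ColFull 5)) (Split 6 4 (Split 6 5 (Split 5 5 (Split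
    5 6 (Aut [3,1,6,0,5,4,2] [3,1,6,0,5,4,2]) (RowFull 5)) (RowFull 5)) (ColFull 5)) (ColFull 4)))
    (RowFull 4))) (Split 4 5 (Split 4 6 (Split 5 5 (Split 5 4 (Split 6 4 (Split 6 6 (Aut
    [6,3,4,1,2,5,0] [6,3,4,1,2,5,0]) (RowFull 6)) (RowFull 6)) (ColFull 4)) (Split 6 5 (Split 6 4
    (Split 5 4 (Split 5 6 (Aut [3,1,6,0,5,4,2] [3,1,6,0,5,4,2]) (RowFull 5)) (RowFull 5)) (ColFull
    4)) (ColFull 5))) (RowFull 4)) (RowFull 4))))))))) (Split 3 4 (Split 3 5 (Aut [0,1,3,2,4,5]
    [1,0,2,3,4,5]) (RowNew 3 (Split 4 4 (Split 4 3 (Split 5 3 (Aut [1,0,2,3,4,5] [0,1,3,2,4,5,6])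
    (ColNew 3 (Split 5 5 (Split 5 6 (Split 6 5 (Split 6 6 (Aut [6,5,3,2,4,1,0] [6,5,3,2,4,1,0])
    (RowFull 6)) (RowFull 6)) (RowFull 5)) (RowFull 5)))) (Split 5 3 (ColNew 3 (Split 4 5 (Split 5 5
    (RowFull 6) (Split 5 6 (Split 6 5 (Split 6 6 (Aut [5,6,1,3,0,4,2] [3,6,2,5,1,0,4]) (RowFull 6))
    (RowFull 6)) (RowFull 5))) (Split 4 6 (Split 5 5 (Split 6 5 (Split 6 6 (Aut [5,6,2,1,0,4,3]
    [5,3,2,6,0,4,1]) (RowFull 6)) (RowFull 6)) (ColFull 5)) (RowFull 4)))) (ColFull 3))) (Split 5 4
    (Split 4 3 (Split 5 3 (Aut [1,0,2,3,4,5] [0,1,3,2,4,5,6]) (ColNew 3 (Split 4 5 (Split 5 5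
    (RowFull 6) (Split 5 6 (Split 6 5 (Split 6 6 (Aut [5,3,2,6,0,4,1] [4,6,2,1,5,0,3]) (RowFull 6))
    (RowFull 6)) (RowFull 5))) (Split 4 6 (Split 5 5 (Split 6 5 (Split 6 6 (Aut [5,2,6,3,0,4,1]
    [5,4,2,0,6,3,1]) (RowFull 6)) (RowFull 6)) (ColFull 5)) (RowFull 4))))) (Split 5 3 (ColNew 3
    (Split 4 5 (Split 4 6 (Split 6 5 (Split 6 6 (Aut [6,4,3,2,1,5,0] [6,5,3,2,4,1,0]) (RowFull 6))
    (RowFull 6)) (RowFull 4)) (RowFull 4))) (ColFull 3))) (ColNew 4 (Split 4 3 (Split 5 3 (Aut
    [1,0,2,3,4,5,6] [0,1,3,2,4,5,6]) (Split 6 3 (Split 4 5 (Split 5 5 (Split 5 6 (Split 6 6 (Aut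
    [5,4,2,0,6,3,1] [5,2,6,3,0,4,1]) (RowFull 6)) (RowFull 5)) (RowFull 5)) (Split 4 6 (Split 6 5
    (Split 5 5 (Split 5 6 (Aut [5,4,0,3,6,2,1] [2,6,5,3,1,0,4]) (RowFull 5)) (RowFull 5)) (ColFull
    5)) (RowFull 4))) (ColFull 3))) (Split 5 3 (Split 6 3 (Split 5 5 (Split 4 5 (Split 4 6 (Split 6
    6 (Aut [4,5,2,0,3,6,1] [5,2,6,3,0,4,1]) (RowFull 6)) (RowFull 4)) (RowFull 4)) (Split 5 6 (Split
    6 5 (Split 4 5 (Split 4 6 (Aut [4,5,0,3,2,6,1] [2,6,5,3,1,0,4]) (RowFull 4)) (RowFull 4))
    (ColFull 5)) (RowFull 5))) (ColFull 3)) (ColFull 3)))))))) (Split 3 5 (RowNew 3 (Split 4 5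
    (Split 4 3 (Split 5 3 (Aut [1,0,2,3,4,5] [0,1,3,2,4,5,6]) (ColNew 3 (Split 5 4 (Split 6 4 (Split
    5 6 (Split 6 6 (Aut [6,5,3,2,4,1,0] [6,4,3,2,1,5,0]) (RowFull 6)) (RowFull 5)) (RowFull 6))
    (RowFull 5)))) (Split 5 3 (ColNew 3 (Split 4 4 (Split 5 4 (RowFull 6) (Split 6 4 (Split 5 6
    (Split 6 6 (Aut [5,6,1,3,0,4,2] [3,6,2,4,0,1,5]) (RowFull 6)) (RowFull 5)) (RowFull 6))) (Split
    4 6 (Split 5 4 (Split 6 4 (Split 6 6 (Aut [5,6,2,1,0,4,3] [4,3,2,6,5,0,1]) (RowFull 6)) (RowFull
    6)) (ColFull 4)) (RowFull 4)))) (ColFull 3))) (Split 5 5 (Split 4 3 (Split 5 3 (Aut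
    [1,0,2,3,4,5] [0,1,3,2,4,5,6]) (ColNew 3 (Split 4 4 (Split 5 4 (RowFull 6) (Split 6 4 (Split 5 6
    (Split 6 6 (Aut [5,3,2,6,0,4,1] [5,6,2,1,0,4,3]) (RowFull 6)) (RowFull 5)) (RowFull 6))) (Split
    4 6 (Split 5 4 (Split 6 4 (Split 6 6 (Aut [5,2,6,3,0,4,1] [4,5,2,0,3,6,1]) (RowFull 6)) (RowFull
    6)) (ColFull 4)) (RowFull 4))))) (Split 5 3 (ColNew 3 (Split 4 4 (Split 4 6 (Split 6 4 (Split 6
    6 (Aut [6,4,3,2,1,5,0] [6,4,3,2,1,5,0]) (RowFull 6)) (RowFull 6)) (RowFull 4)) (RowFull 4)))
    (ColFull 3))) (ColNew 5 (Split 4 3 (Split 5 3 (Aut [1,0,2,3,4,5,6] [0,1,3,2,4,5,6]) (Split 6 3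
    (Split 4 4 (Split 5 4 (Split 5 6 (Split 6 6 (Aut [5,4,2,0,6,3,1] [4,2,6,3,5,0,1]) (RowFull 6))
    (RowFull 5)) (RowFull 5)) (Split 4 6 (Split 6 4 (Split 5 4 (Split 5 6 (Aut [5,4,0,3,6,2,1]
    [2,6,4,3,0,1,5]) (RowFull 5)) (RowFull 5)) (ColFull 4)) (RowFull 4))) (ColFull 3))) (Split 5 3
    (Split 6 3 (Split 5 4 (Split 4 4 (Split 4 6 (Split 6 6 (Aut [4,5,2,0,3,6,1] [4,2,6,3,5,0,1])
    (RowFull 6)) (RowFull 4)) (RowFull 4)) (Split 5 6 (Split 6 4 (Split 4 4 (Split 4 6 (Aut
    [4,5,0,3,2,6,1] [2,6,4,3,0,1,5]) (RowFull 4)) (RowFull 4)) (ColFull 4)) (RowFull 5))) (ColFull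
    3)) (ColFull 3))))))) (RowFull 3)))))))))))))))))"
  by code_simp

text \<open>With seven rows and no 4-cycle each row meets every other row exactly once, so the graph
  is the incidence graph of the Fano plane. The surviving branches end in one of its many
  automorphisms.\<close>

lemma check_root_7: "check True 7 1 0 [] [] (RowNew 0 (RowNew 0 (RowNew 0 (ColNew 0 (ColNew 0 (Split 1 1 (Quad 1 0 0 1) (Split 1 2 (Quad 1 0
    0 2) (RowNew 1 (RowNew 1 (Split 2 1 (Quad 2 0 0 1) (ColNew 1 (ColNew 1 (Split 2 2 (Quad 2 0 0 2)
    (Split 2 3 (Quad 2 1 0 3) (Split 2 4 (Quad 2 1 0 4) (RowNew 2 (RowNew 2 (Split 3 2 (Quad 3 0 1
    2) (Split 4 2 (Quad 4 0 1 2) (ColNew 2 (ColNew 2 (Split 3 3 (Split 3 4 (Quad 3 1 3 4) (Split 3 5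
    (Split 4 3 (Quad 4 3 1 3) (Split 5 3 (Split 5 4 (Quad 5 1 3 4) (Split 5 5 (Quad 5 3 3 5) (Split
    5 6 (Split 4 5 (Quad 4 3 1 5) (Split 6 5 (Aut [3,1,5,0,4,2,6] [3,1,5,0,4,2,6]) (ColFull 5)))
    (RowFull 5)))) (Split 6 3 (Split 4 5 (Quad 4 3 1 5) (Split 5 5 (Split 5 4 (Aut [3,5,2,0,4,1,6]
    [5,1,3,2,4,0,6]) (Split 5 6 (Quad 5 2 5 6) (RowFull 5))) (Split 6 5 (Quad 6 3 3 5) (ColFull
    5)))) (ColFull 3)))) (Split 3 6 (Split 4 3 (Quad 4 3 1 3) (Split 5 3 (Split 5 4 (Quad 5 1 3 4)
    (Split 5 5 (Split 4 5 (Aut [5,1,3,2,4,0,6] [3,5,2,0,4,1,6]) (Split 6 5 (Quad 6 5 2 5) (ColFull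
    5))) (Split 5 6 (Quad 5 3 3 6) (RowFull 5)))) (Split 6 3 (Split 6 4 (Quad 6 1 3 4) (Split 6 5
    (Split 4 5 (Aut [6,1,3,2,4,5,0] [3,5,2,0,4,1,6]) (Split 5 5 (Quad 6 5 2 5) (ColFull 5))) (Split
    6 6 (Quad 6 3 3 6) (RowFull 6)))) (ColFull 3)))) (RowFull 3)))) (Split 3 4 (Split 3 5 (Split 4 4
    (Quad 4 3 1 4) (Split 5 4 (Split 5 3 (Quad 5 1 3 4) (Split 5 5 (Quad 5 3 4 5) (Split 5 6 (Split
    4 5 (Quad 4 3 1 5) (Split 6 5 (Aut [3,1,5,0,4,2,6] [4,1,5,3,0,2,6]) (ColFull 5))) (RowFull 5))))
    (Split 6 4 (Split 4 5 (Quad 4 3 1 5) (Split 5 5 (Split 5 3 (Aut [3,5,2,0,4,1,6] [5,1,4,3,2,0,6])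
    (Split 5 6 (Quad 5 2 5 6) (RowFull 5))) (Split 6 5 (Quad 6 3 4 5) (ColFull 5)))) (ColFull 4))))
    (Split 3 6 (Split 4 4 (Quad 4 3 1 4) (Split 5 4 (Split 5 3 (Quad 5 1 3 4) (Split 5 5 (Split 4 5
    (Aut [5,1,3,2,4,0,6] [4,5,2,3,0,1,6]) (Split 6 5 (Quad 6 5 2 5) (ColFull 5))) (Split 5 6 (Quad 5
    3 4 6) (RowFull 5)))) (Split 6 4 (Split 6 3 (Quad 6 1 3 4) (Split 6 5 (Split 4 5 (Aut
    [6,1,3,2,4,5,0] [4,5,2,3,0,1,6]) (Split 5 5 (Quad 6 5 2 5) (ColFull 5))) (Split 6 6 (Quad 6 3 4
    6) (RowFull 6)))) (ColFull 4)))) (RowFull 3))) (Split 3 5 (Split 3 6 (Quad 3 2 5 6) (RowFull 3))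
    (RowFull 3)))))))))))))))))))))))))"
  by code_simp

lemma cubic_6_7_not_rigid:
  assumes "regular n 3 E" and "n = 6 \<or> n = 7"
  shows "\<not> bip_rigid n E"
  using assms cubic_not_rigid[OF _ _ check_quad_6 check_root_6] cubic_not_rigid[OF _ _ check_quad_7 check_root_7]
  by auto

section \<open>Complements\<close>

definition bip_compl :: "nat \<Rightarrow> (nat \<times> nat) set \<Rightarrow> (nat \<times> nat) set" where
  "bip_compl a E = {..<a} \<times> {..<a} - E"

lemma regular_compl:
  assumes "regular a k E"
  shows "regular a (a - k) (bip_compl a E)"
  unfolding regular_def
proof (intro conjI allI impI)
  fix v assume v: "v < a"
  have "{j. (v, j) \<in> bip_compl a E} = {..<a} - {j. (v, j) \<in> E}" using v by (auto simp: bip_compl_def)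
  moreover have "{j. (v, j) \<in> E} \<subseteq> {..<a}" using assms by (auto simp: regular_def)
  ultimately show "card {j. (v, j) \<in> bip_compl a E} = a - k"
    using assms v by (simp add: card_Diff_subset finite_subset[of _ "{..<a}"] regular_def)
  have "{i. (i, v) \<in> bip_compl a E} = {..<a} - {i. (i, v) \<in> E}" using v by (auto simp: bip_compl_def)
  moreover have "{i. (i, v) \<in> E} \<subseteq> {..<a}" using assms by (auto simp: regular_def)
  ultimately show "card {i. (i, v) \<in> bip_compl a E} = a - k"
    using assms v by (simp add: card_Diff_subset finite_subset[of _ "{..<a}"] regular_def)
qed (auto simp: bip_compl_def)

text \<open>Row and column permutations keep the full grid, so they preserve a graph iff they
  preserve its complement.\<close>

lemma bip_rigid_compl:
  assumes "E \<subseteq> {..<a} \<times> {..<a}" and "bip_rigid a E"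
  shows "bip_rigid a (bip_compl a E)"
  unfolding bip_rigid_def
proof (intro allI impI)
  fix \<rho> \<gamma>
  assume *: "\<rho> permutes {..<a} \<and> \<gamma> permutes {..<a} \<and>
    (\<forall>i j. (i, j) \<in> bip_compl a E \<longleftrightarrow> (\<rho> i, \<gamma> j) \<in> bip_compl a E)"
  then have "\<rho> i < a \<longleftrightarrow> i < a" "\<gamma> i < a \<longleftrightarrow> i < a" for i
    using permutes_in_image[of \<rho> "{..<a}"] permutes_in_image[of \<gamma> "{..<a}"] by auto
  then have "(i, j) \<in> E \<longleftrightarrow> (\<rho> i, \<gamma> j) \<in> E" for i j
    using * assms(1) unfolding bip_compl_def by (smt (verit) Diff_iff SigmaD1 SigmaD2 SigmaI lessThan_iff subsetD)
  then show "\<rho> = id \<and> \<gamma> = id" using * assms(2) unfolding bip_rigid_def by blast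
qed

text \<open>Here \<open>k\<close> is the forbidden degree, attained either by the graph itself or by
  its complement.\<close>

lemma no_rigid_regular:
  assumes "2 \<le> a" and k: "k \<le> 2 \<or> k = 3 \<and> (a = 6 \<or> a = 7)"
    and "regular a b E" "b = k \<or> b + k = a"
  shows "\<not> bip_rigid a E"
proof -
  have *: "\<not> bip_rigid a E" if "regular a k E" for E
  proof -
    consider "k = 0" | "k = 1" | "k = 2" | "k = 3" "a = 6 \<or> a = 7" using k by linarith
    then show ?thesis
      using that assms(1) regular_0_not_rigid regular_1_not_rigid regular_2_not_rigid cubic_6_7_not_rigid
      by cases auto
  qed
  show ?thesis
  proof (cases "b = k")
    case False
    then have "b + k = a" using assms by simp
    then have "regular a k (bip_compl a E)" using regular_compl[OF assms(3)] by auto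
    then have "\<not> bip_rigid a (bip_compl a E)" by (rule *)
    then show ?thesis using bip_rigid_compl[of E a] assms(3) by (auto simp: regular_def)
  qed (use * assms in auto)
qed

section \<open>Three partitions into blocks of size at least three\<close>

text \<open>The circulant in which row \<open>i\<close> has the columns \<open>i\<close>, ...,
  \<open>i + k - 1\<close> modulo \<open>a\<close>; the last disjunct is the part that wraps around.
  Avoiding \<open>mod\<close> keeps membership linear.\<close>

definition band :: "nat \<Rightarrow> nat \<Rightarrow> (nat \<times> nat) set" where
  "band a k = {(i, j). i < a \<and> j < a \<and> (i \<le> j \<and> j < i + k \<or> j + a < i + k)}"

lemma regular_band:
  assumes "k \<le> a"
  shows "regular a k (band a k)"
  unfolding regular_def
proof (intro conjI allI impI)
  show "band a k \<subseteq> {..<a} \<times> {..<a}" by (auto simp: band_def)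
next
  fix i assume i: "i < a"
  show "card {j. (i, j) \<in> band a k} = k"
  proof (cases "i + k \<le> a")
    case True
    then have "{j. (i, j) \<in> band a k} = {i..<i + k}" using i by (auto simp: band_def)
    then show ?thesis by simp
  next
    case False
    then have "{j. (i, j) \<in> band a k} = {i..<a} \<union> {..<i + k - a}"
      using i assms by (auto simp: band_def)
    moreover have "{i..<a} \<inter> {..<i + k - a} = {}" using assms by auto
    ultimately show ?thesis using False i assms by (simp add: card_Un_disjoint)
  qed
next
  fix j assume j: "j < a"
  show "card {i. (i, j) \<in> band a k} = k"
  proof (cases "k \<le> j + 1")
    case True
    then have "{i. (i, j) \<in> band a k} = {j + 1 - k..<j + 1}" using j assms by (auto simp: band_def)
    then show ?thesis using True by simp
  next
    case False
    then have "{i. (i, j) \<in> band a k} = {..<j + 1} \<union> {j + a + 1 - k..<a}"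
      using j assms by (auto simp: band_def)
    moreover have "{..<j + 1} \<inter> {j + a + 1 - k..<a} = {}" using assms by auto
    ultimately show ?thesis using False j assms by (simp add: card_Un_disjoint)
  qed
qed

locale three_partitions =
  fixes a b :: nat
  assumes b3: "3 \<le> b" and ba: "b \<le> a"
begin

text \<open>The diagonal points, except that the last row takes its point in column 0. This
  exception breaks the cyclic symmetry.\<close>

definition special :: "nat \<Rightarrow> nat \<times> nat" where
  "special i = (i, if i = a - 1 then 0 else i)"

text \<open>The third partition shifts one special point of each row to the previous row.
  Column \<open>0\<close> contains two special points, column \<open>a - 1\<close> none and every other column exactly one.\<close>

definition third :: "nat \<times> nat \<Rightarrow> nat" where
  "third x = (if x = special (fst x) then (if fst x = 0 then a - 1 else fst x - 1) else fst x)"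

lemma special_in: "i < a \<Longrightarrow> special i \<in> band a b"
  using b3 ba by (auto simp: special_def band_def)

lemma fst_special [simp]: "fst (special i) = i"
  by (simp add: special_def)

lemma third_special: "third (special i) = (if i = 0 then a - 1 else i - 1)"
  by (simp add: third_def)

lemma band_less: "x \<in> band a b \<Longrightarrow> fst x < a \<and> snd x < a"
  by (auto simp: band_def)

lemma card_row: "i < a \<Longrightarrow> card {x \<in> band a b. fst x = i} = b"
  using regular_balanced(1)[OF regular_band[OF ba]] by (simp add: balanced_def)

lemma finite_band: "finite (band a b)"
  by (rule regular_finite[OF regular_band[OF ba]])

text \<open>Class \<open>v\<close> gives away its own special point and receives that of the
  cyclically next row \<open>w\<close>.\<close>

lemma balanced_third: "balanced (band a b) a b third"
  unfolding balanced_def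
proof (intro conjI allI impI)
  show "third ` band a b \<subseteq> {..<a}" using band_less by (force simp: third_def)
  fix v assume v: "v < a"
  define w where "w = (if v = a - 1 then 0 else v + 1)"
  have w: "w < a" "w \<noteq> v" using v b3 ba by (auto simp: w_def)
  have key: "third x = v \<longleftrightarrow> x = special w \<or> fst x = v \<and> x \<noteq> special v" if "x \<in> band a b" for x
    using band_less[OF that] v b3 ba by (auto simp: third_def w_def special_def split: if_splits)
  then have "{x \<in> band a b. third x = v} = insert (special w) ({x \<in> band a b. fst x = v} - {special v})"
    using key special_in[OF w(1)] by blast
  moreover have "special w \<notin> {x \<in> band a b. fst x = v} - {special v}" using w by simp
  ultimately show "card {x \<in> band a b. third x = v} = b"
    using card_row[OF v] special_in[OF v] finite_band b3 by (simp add: card_Diff_singleton)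
qed

lemma two_ordinary:
  assumes "i < a"
  obtains y z where "y \<in> band a b" "z \<in> band a b" "fst y = i" "fst z = i" "y \<noteq> z"
    "y \<noteq> special i" "z \<noteq> special i"
proof -
  have "card ({x \<in> band a b. fst x = i} - {special i}) = b - 1"
    using card_row[OF assms] special_in[OF assms] finite_band by (simp add: card_Diff_singleton)
  then have "2 \<le> card ({x \<in> band a b. fst x = i} - {special i})" using b3 by simp
  then obtain Y where Y: "Y \<subseteq> {x \<in> band a b. fst x = i} - {special i}" "card Y = 2"
    by (rule obtain_subset_with_card_n)
  then obtain y z where "Y = {y, z}" "y \<noteq> z" by (meson card_2_iff)
  then show thesis using that[of y z] Y(1) by auto
qed

text \<open>Special points are visible to the first and third labelling alone. Having left its row,
  a special point is alone with its pair of labels; an ordinary one is not, because a row has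
  \<open>b - 1 \<ge> 2\<close> ordinary points. This is the use of \<open>b \<ge> 3\<close>.\<close>

lemma special_iff:
  assumes x: "x \<in> band a b"
  shows "x = special (fst x) \<longleftrightarrow> (\<forall>y \<in> band a b. fst y = fst x \<and> third y = third x \<longrightarrow> y = x)"
proof
  assume sp: "x = special (fst x)"
  show "\<forall>y \<in> band a b. fst y = fst x \<and> third y = third x \<longrightarrow> y = x"
  proof (intro ballI impI)
    fix y assume y: "y \<in> band a b" "fst y = fst x \<and> third y = third x"
    have "third x \<noteq> fst x" using sp third_special[of "fst x"] b3 ba by (auto split: if_splits)
    then show "y = x" using y sp by (auto simp: third_def split: if_splits)
  qed
next
  assume uniq: "\<forall>y \<in> band a b. fst y = fst x \<and> third y = third x \<longrightarrow> y = x"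
  have "fst x < a" using band_less[OF x] by simp
  then obtain y z where yz: "y \<in> band a b" "z \<in> band a b" "fst y = fst x" "fst z = fst x" "y \<noteq> z"
    "y \<noteq> special (fst x)" "z \<noteq> special (fst x)"
    by (rule two_ordinary)
  show "x = special (fst x)"
  proof (rule ccontr)
    assume "x \<noteq> special (fst x)"
    then have "third y = third x" "third z = third x" using yz by (auto simp: third_def)
    then show False using uniq yz by metis
  qed
qed

text \<open>\<sigma> permutes the special points and thereby the rows, via \<open>pos\<close>. The
  third labelling makes \<open>pos\<close> respect the cyclic order, and the second one anchors it
  at the last row.\<close>

lemma three_separating: "separating (band a b) [fst, snd, third]"
  unfolding separating_def
proof (intro allI impI)
  fix \<sigma>
  assume "\<sigma> permutes band a b \<and> (\<forall>f\<in>set [fst, snd, third]. preserves (band a b) f \<sigma>)"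
  then have \<sigma>: "\<sigma> permutes band a b" and pr: "preserves (band a b) fst \<sigma>"
      "preserves (band a b) snd \<sigma>" "preserves (band a b) third \<sigma>"
    by auto
  have mem: "\<sigma> x \<in> band a b \<longleftrightarrow> x \<in> band a b" for x by (rule permutes_in_image[OF \<sigma>])
  have inj: "\<sigma> x = \<sigma> y \<longleftrightarrow> x = y" for x y using permutes_inj[OF \<sigma>] by (simp add: inj_eq)
  have spec: "\<sigma> x = special (fst (\<sigma> x)) \<longleftrightarrow> x = special (fst x)" if x: "x \<in> band a b" for x
  proof -
    have "\<sigma> x = special (fst (\<sigma> x)) \<longleftrightarrow>
        (\<forall>y \<in> \<sigma> ` band a b. fst y = fst (\<sigma> x) \<and> third y = third (\<sigma> x) \<longrightarrow> y = \<sigma> x)"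
      using special_iff[of "\<sigma> x"] mem x permutes_image[OF \<sigma>] by simp
    also have "\<dots> \<longleftrightarrow> x = special (fst x)"
      using special_iff[OF x] preservesD[OF pr(1) _ x] preservesD[OF pr(3) _ x] by (auto simp: inj)
    finally show ?thesis .
  qed
  define pos where "pos i = fst (\<sigma> (special i))" for i
  have \<sigma>s: "\<sigma> (special i) = special (pos i)" "pos i < a" if "i < a" for i
    using spec[OF special_in[OF that]] band_less[of "\<sigma> (special i)"] mem special_in[OF that]
    by (simp_all add: pos_def)
  \<comment> \<open>Apart from \<open>special i\<close>, its third class consists of the ordinary
    points of row \<open>i - 1\<close>; so the image of row \<open>i\<close> determines that of row
    \<open>i - 1\<close>.\<close>
  have prev: "pos (i - 1) = (if pos i = 0 then a - 1 else pos i - 1)" if i: "0 < i" "i < a" for i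
  proof -
    have i': "i - 1 < a" using i by simp
    obtain z where z: "z \<in> band a b" "fst z = i - 1" "z \<noteq> special (i - 1)"
      using two_ordinary[OF i'] by metis
    have "third z = third (special i)" using z i by (simp add: third_def third_special)
    then have "third (\<sigma> z) = third (special (pos i))"
      using preservesD[OF pr(3) z(1) special_in[OF i(2)]] \<sigma>s[OF i(2)] by simp
    moreover have "third (\<sigma> z) = fst (\<sigma> z)" using spec[OF z(1)] z by (simp add: third_def)
    moreover have "fst (\<sigma> z) = fst (\<sigma> (special (i - 1)))"
      using preservesD[OF pr(1) z(1) special_in[OF i']] z by simp
    ultimately show ?thesis by (simp add: third_special pos_def)
  qed
  \<comment> \<open>\<open>special 0\<close> and \<open>special (a - 1)\<close> are the only special
    points sharing a column, so they are fixed or exchanged. An exchange would give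
    \<open>pos (a - 2) = pos 0\<close>, impossible for \<open>a \<ge> 3\<close>.\<close>
  have last: "pos (a - 1) = a - 1"
  proof -
    have a0: "0 < a" "a - 1 < a" "0 \<noteq> a - 1" using b3 ba by auto
    have "snd (special 0) = snd (special (a - 1))" by (simp add: special_def)
    then have "snd (\<sigma> (special 0)) = snd (\<sigma> (special (a - 1)))"
      using preservesD[OF pr(2) special_in[OF a0(1)] special_in[OF a0(2)]] by blast
    then have "snd (special (pos 0)) = snd (special (pos (a - 1)))"
      unfolding \<sigma>s(1)[OF a0(1)] \<sigma>s(1)[OF a0(2)] .
    moreover have "pos 0 \<noteq> pos (a - 1)"
      using inj[of "special 0" "special (a - 1)"] \<sigma>s a0 by (metis fst_special)
    ultimately have "pos 0 = 0 \<and> pos (a - 1) = a - 1 \<or> pos 0 = a - 1 \<and> pos (a - 1) = 0"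
      using \<sigma>s(2)[OF a0(1)] \<sigma>s(2)[OF a0(2)] by (auto simp: special_def split: if_splits)
    moreover have "\<not> (pos 0 = a - 1 \<and> pos (a - 1) = 0)"
    proof
      assume w: "pos 0 = a - 1 \<and> pos (a - 1) = 0"
      have "pos (a - 1 - 1) = a - 1" using prev[of "a - 1"] a0 w by simp
      then have "special (a - 1 - 1) = special 0"
        using inj[of "special (a - 1 - 1)" "special 0"] \<sigma>s[of "a - 1 - 1"] \<sigma>s[OF a0(1)] w by simp
      then have "a - 1 - 1 = 0" by (metis fst_special)
      then show False using b3 ba by simp
    qed
    ultimately show ?thesis by blast
  qed
  have pos_down: "pos (a - 1 - d) = a - 1 - d" if "d < a" for d
    using that
  proof (induction d)
    case (Suc d)
    then show ?case using prev[of "a - 1 - d"] by simp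
  qed (use last in simp)
  have fixed: "\<sigma> (special i) = special i" if "i < a" for i
    using pos_down[of "a - 1 - i"] \<sigma>s[OF that] that by simp
  have "\<sigma> x = x" if x: "x \<in> band a b" for x
  proof -
    have lt: "fst x < a" "snd x < a" using band_less[OF x] by auto
    have 1: "fst (\<sigma> x) = fst x"
      using preservesD[OF pr(1) x special_in[OF lt(1)]] fixed[OF lt(1)] by simp
    \<comment> \<open>A column other than the last is recognised by a fixed special point in it; the
      last column, which has none, is left by exclusion.\<close>
    have col: "snd (\<sigma> x) = c \<longleftrightarrow> snd x = c" if c: "c < a - 1" for c
    proof -
      have "c < a" "snd (special c) = c" using c by (auto simp: special_def)
      then show ?thesis using preservesD[OF pr(2) x special_in] fixed by metis
    qed
    have "snd (\<sigma> x) = snd x"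
    proof (cases "snd x < a - 1")
      case True
      then show ?thesis using col by blast
    next
      case False
      then have "\<not> snd (\<sigma> x) < a - 1" using col by metis
      then show ?thesis using False lt band_less[of "\<sigma> x"] mem[of x] x by linarith
    qed
    then show ?thesis using 1 by (simp add: prod_eq_iff)
  qed
  then show "\<sigma> = id" using permutes_not_in[OF \<sigma>] by (metis eq_id_iff)
qed

end

section \<open>Pairings\<close>

lemma half_Suc: "odd x \<Longrightarrow> (y + 1) div 2 = (x + 1) div 2 \<Longrightarrow> y \<noteq> x \<Longrightarrow> y = Suc x" for x y :: nat
  by presburger

lemma half_Suc': "even x \<Longrightarrow> y div 2 = x div 2 \<Longrightarrow> y \<noteq> x \<Longrightarrow> y = Suc x" for x y :: nat
  by presburger

lemma half_pos: "y \<noteq> 0 \<Longrightarrow> (y + 1) div 2 \<noteq> 0" for y :: nat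
  by presburger

lemma half_pred: "s div 2 = (2 * a - 1) div 2 \<Longrightarrow> s \<noteq> 2 * a - 1 \<Longrightarrow> 4 \<le> a \<Longrightarrow> s = 2 * a - 2" for s a :: nat
  by presburger

locale three_pairings =
  fixes a :: nat
  assumes a4: "4 \<le> a"
begin

definition pairing1 :: "nat \<Rightarrow> nat" where "pairing1 x = x div 2"
definition pairing2 :: "nat \<Rightarrow> nat" where "pairing2 x = (if x = 2 * a - 1 then 0 else (x + 1) div 2)"
text \<open>\<open>pairing1\<close> and \<open>pairing2\<close> alternate along the cycle 0, 1, ...,
  \<open>2a - 1\<close>. The pairs here are \<open>{0, 1}\<close>, \<open>{2, 4}\<close>,
  \<open>{3, 2a - 1}\<close> and \<open>{2v - 1, 2v}\<close> for \<open>v \<ge> 3\<close>: the first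
  marks one edge of the cycle, and the next two, proper chords, break the reflection that swaps its
  ends.\<close>

definition pairing3 :: "nat \<Rightarrow> nat" where
  "pairing3 x = (if x < 2 then 0 else if x = 2 \<or> x = 4 then 1 else if x = 3 \<or> x = 2 * a - 1 then 2
     else (x + 1) div 2)"

lemma pairing3_big: "5 \<le> x \<Longrightarrow> pairing3 x = (if x = 2 * a - 1 then 2 else (x + 1) div 2)"
  by (simp add: pairing3_def)

lemma pairing3_small:
  "pairing3 0 = 0" "pairing3 (Suc 0) = 0" "pairing3 2 = 1" "pairing3 3 = 2" "pairing3 4 = 1" "pairing3 (2 * a - 1) = 2"
proof -
  have "2 * a - 1 \<noteq> 2" "2 * a - 1 \<noteq> 4" "\<not> 2 * a - 1 < 2" using a4 by presburger+
  then show "pairing3 0 = 0" "pairing3 (Suc 0) = 0" "pairing3 2 = 1" "pairing3 3 = 2" "pairing3 4 = 1" "pairing3 (2 * a - 1) = 2"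
    by (auto simp: pairing3_def)
qed

lemma pairing2_small: "pairing2 0 = 0" "pairing2 (Suc 0) = 1" "pairing2 2 = 1" "pairing2 3 = 2" "pairing2 4 = 2"
proof -
  have "2 * a - 1 \<noteq> 0" "2 * a - 1 \<noteq> Suc 0" "2 * a - 1 \<noteq> 2" "2 * a - 1 \<noteq> 3" "2 * a - 1 \<noteq> 4"
    using a4 by presburger+
  then show "pairing2 0 = 0" "pairing2 (Suc 0) = 1" "pairing2 2 = 1" "pairing2 3 = 2" "pairing2 4 = 2"
    by (simp_all add: pairing2_def)
qed

lemma pairing3_pair:
  assumes "1 \<le> m"
  shows "pairing3 (2 * m) \<noteq> pairing3 (2 * m + 1)"
proof -
  consider "m = 1" | "m = 2" | "3 \<le> m" using assms by linarith
  then show ?thesis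
  proof cases
    case 2
    then show ?thesis using a4 by (simp add: pairing3_small pairing3_big)
  next
    case 3
    moreover have "2 * m \<noteq> 2 * a - 1" using a4 by presburger
    ultimately show ?thesis by (simp add: pairing3_big)
  qed (simp add: pairing3_small)
qed

lemma less_5_cases:
  fixes x :: nat
  obtains "x = 0" | "x = Suc 0" | "x = 2" | "x = 3" | "x = 4" | "5 \<le> x"
  by linarith

lemma pairing3_iff:
  assumes "x < 2 * a" "v < a"
  shows "pairing3 x = v \<longleftrightarrow> (if v = 0 then x = 0 \<or> x = 1 else if v = 1 then x = 2 \<or> x = 4
    else if v = 2 then x = 3 \<or> x = 2 * a - 1 else x = 2 * v - 1 \<or> x = 2 * v)"
proof (cases x rule: less_5_cases)
  case 6
  show ?thesis
  proof (cases "x = 2 * a - 1")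
    case True
    then have "pairing3 x = 2" using pairing3_small(6) by metis
    moreover have "x \<noteq> 0" "x \<noteq> 1" "x \<noteq> 2" "x \<noteq> 4" "x \<noteq> 2 * v - 1 \<and> x \<noteq> 2 * v"
      using True 6 assms(2) by presburger+
    ultimately show ?thesis using True by auto
  next
    case False
    have "3 \<le> (x + 1) div 2" using 6 by simp
    moreover have "(x + 1) div 2 = v \<longleftrightarrow> x = 2 * v - 1 \<or> x = 2 * v" using 6 by presburger
    ultimately show ?thesis using False 6 by (auto simp: pairing3_big)
  qed
qed (use a4 in \<open>auto simp: pairing3_small\<close>)

lemma balanced_two_pointsI:
  fixes f :: "nat \<Rightarrow> nat"
  assumes "\<And>v. v < a \<Longrightarrow> \<exists>x y. x \<noteq> y \<and> {x \<in> {..<2 * a}. f x = v} = {x, y}"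
    and "\<And>x. x < 2 * a \<Longrightarrow> f x < a"
  shows "balanced {..<2 * a} a 2 f"
  unfolding balanced_def
proof (intro conjI allI impI)
  fix v assume "v < a"
  then show "card {x \<in> {..<2 * a}. f x = v} = 2" using assms(1) by (simp add: card_2_iff) metis
qed (use assms(2) in auto)

lemma balanced_pairing1: "balanced {..<2 * a} a 2 pairing1"
proof (rule balanced_two_pointsI)
  fix v assume "v < a"
  then have "{x \<in> {..<2 * a}. pairing1 x = v} = {2 * v, 2 * v + 1}"
    by (auto simp: pairing1_def)
  moreover have "2 * v \<noteq> 2 * v + 1" by simp
  ultimately show "\<exists>x y. x \<noteq> y \<and> {x \<in> {..<2 * a}. pairing1 x = v} = {x, y}" by metis
qed (auto simp: pairing1_def)

lemma balanced_pairing2: "balanced {..<2 * a} a 2 pairing2"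
proof (rule balanced_two_pointsI)
  fix v assume v: "v < a"
  show "\<exists>x y. x \<noteq> y \<and> {x \<in> {..<2 * a}. pairing2 x = v} = {x, y}"
  proof (cases "v = 0")
    case True
    have "{x \<in> {..<2 * a}. pairing2 x = v} = {0, 2 * a - 1}" using True a4 by (auto simp: pairing2_def)
    moreover have "0 \<noteq> 2 * a - 1" using a4 by simp
    ultimately show ?thesis by metis
  next
    case False
    have "{x \<in> {..<2 * a}. pairing2 x = v} = {2 * v - 1, 2 * v}" using False v by (auto simp: pairing2_def)
    moreover have "2 * v - 1 \<noteq> 2 * v" using False by simp
    ultimately show ?thesis by metis
  qed
qed (auto simp: pairing2_def)

lemma balanced_pairing3: "balanced {..<2 * a} a 2 pairing3"
proof (rule balanced_two_pointsI)
  fix v assume v: "v < a"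
  consider "v = 0" | "v = 1" | "v = 2" | "3 \<le> v" by linarith
  then obtain x y where "x \<noteq> y" "x < 2 * a" "y < 2 * a"
    and *: "\<And>z. z < 2 * a \<Longrightarrow> pairing3 z = v \<longleftrightarrow> z = x \<or> z = y"
  proof cases
    case 1
    then show thesis using that[of 0 1] pairing3_iff[OF _ v] a4 by simp
  next
    case 2
    then show thesis using that[of 2 4] pairing3_iff[OF _ v] a4 by simp
  next
    case 3
    then show thesis using that[of 3 "2 * a - 1"] pairing3_iff[OF _ v] a4 by simp
  next
    case 4
    then show thesis using that[of "2 * v - 1" "2 * v"] pairing3_iff[OF _ v] v by simp
  qed
  then have "{x \<in> {..<2 * a}. pairing3 x = v} = {x, y}" by auto
  then show "\<exists>x y. x \<noteq> y \<and> {x \<in> {..<2 * a}. pairing3 x = v} = {x, y}" using \<open>x \<noteq> y\<close> by metis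
next
  fix x assume x: "x < 2 * a"
  show "pairing3 x < a"
  proof (cases x rule: less_5_cases)
    case 6
    then show ?thesis using x a4 by (simp add: pairing3_big) presburger
  qed (use a4 in \<open>auto simp: pairing3_small\<close>)
qed

text \<open>\<open>{0, 1}\<close> is the only pair common to \<open>pairing1\<close> and
  \<open>pairing3\<close>, so \<sigma> keeps it. If its ends are fixed, walking along the cycle
  fixes everything; otherwise \<sigma> would have to be a reflection.\<close>

lemma three_pairings_separating: "separating {..<2 * a} [pairing1, pairing2, pairing3]"
  unfolding separating_def
proof (intro allI impI)
  fix \<sigma> assume "\<sigma> permutes {..<2 * a} \<and> (\<forall>f\<in>set [pairing1, pairing2, pairing3]. preserves {..<2 * a} f \<sigma>)"
  then have \<sigma>: "\<sigma> permutes {..<2 * a}" and pr: "preserves {..<2 * a} pairing1 \<sigma>"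
      "preserves {..<2 * a} pairing2 \<sigma>" "preserves {..<2 * a} pairing3 \<sigma>"
    by auto
  have lt: "\<sigma> x < 2 * a \<longleftrightarrow> x < 2 * a" for x using permutes_in_image[OF \<sigma>] by simp
  have inj: "\<sigma> x = \<sigma> y \<longleftrightarrow> x = y" for x y using permutes_inj[OF \<sigma>] by (simp add: inj_eq)
  have pr1: "pairing1 (\<sigma> x) = pairing1 (\<sigma> y)" if "pairing1 x = pairing1 y" "x < 2 * a" "y < 2 * a" for x y
    using preservesD[OF pr(1), of x y] that by simp
  have pr2: "pairing2 (\<sigma> x) = pairing2 (\<sigma> y)" if "pairing2 x = pairing2 y" "x < 2 * a" "y < 2 * a" for x y
    using preservesD[OF pr(2), of x y] that by simp
  have pr3: "pairing3 (\<sigma> x) = pairing3 (\<sigma> y)" if "pairing3 x = pairing3 y" "x < 2 * a" "y < 2 * a" for x y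
    using preservesD[OF pr(3), of x y] that by simp
  have common: "x < 2" if h: "pairing1 x = pairing1 y" "pairing3 x = pairing3 y" "x \<noteq> y" for x y
  proof -
    define m where "m = x div 2"
    have "x = 2 * m \<and> y = 2 * m + 1 \<or> y = 2 * m \<and> x = 2 * m + 1"
      using h(1,3) unfolding pairing1_def m_def by presburger
    then have "pairing3 (2 * m) = pairing3 (2 * m + 1)" using h(2) by metis
    then have "m = 0" using pairing3_pair[of m] by linarith
    then show ?thesis unfolding m_def by presburger
  qed
  have s01: "pairing1 (\<sigma> 0) = pairing1 (\<sigma> 1)" "pairing3 (\<sigma> 0) = pairing3 (\<sigma> 1)"
    using pr1[of 0 1] pr3[of 0 1] a4 by (simp_all add: pairing1_def pairing3_small)
  have "\<sigma> 0 < 2"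
    using common[OF s01] inj[of 0 1] lt[of 0] lt[of 1] a4 by simp
  moreover have "\<sigma> 1 < 2"
    using common[OF s01[symmetric]] inj[of 0 1] lt[of 0] lt[of 1] a4 by simp
  moreover have "\<sigma> 0 \<noteq> \<sigma> 1" using inj by simp
  ultimately consider "\<sigma> 0 = 0" "\<sigma> 1 = 1" | "\<sigma> 0 = 1" "\<sigma> 1 = 0" by linarith
  then show "\<sigma> = id"
  proof cases
    case 1
    have "\<sigma> x = x" if "x < 2 * a" for x
      using that
    proof (induction x)
      case (Suc x)
      then have IH: "\<sigma> x = x" by simp
      have ne: "\<sigma> (Suc x) \<noteq> x" using inj[of "Suc x" x] IH by simp
      have l: "\<sigma> (Suc x) < 2 * a" using lt Suc.prems by simp
      show ?case
      proof (cases "even x")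
        case True
        then have "pairing1 x = pairing1 (Suc x)" by (auto simp: pairing1_def)
        then have "pairing1 (\<sigma> (Suc x)) = pairing1 x" using pr1 Suc.prems IH by (metis Suc_lessD)
        then show ?thesis using half_Suc'[OF True, of "\<sigma> (Suc x)"] ne unfolding pairing1_def by simp
      next
        case False
        then have "(Suc x + 1) div 2 = (x + 1) div 2" "2 * a - 1 \<noteq> Suc x" using Suc.prems by presburger+
        then have "pairing2 x = pairing2 (Suc x)" using Suc.prems by (simp add: pairing2_def)
        then have "pairing2 (\<sigma> (Suc x)) = pairing2 x" using pr2 Suc.prems IH by (metis Suc_lessD)
        moreover have "pairing2 x = (x + 1) div 2" using Suc.prems by (simp add: pairing2_def)
        moreover have "(x + 1) div 2 \<noteq> 0" using half_pos[of x] odd_pos[OF False] by simp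
        ultimately have "(\<sigma> (Suc x) + 1) div 2 = (x + 1) div 2" by (simp add: pairing2_def split: if_splits)
        then show ?thesis using half_Suc[of x "\<sigma> (Suc x)"] ne False by simp
      qed
    qed (use 1 in simp)
    then show ?thesis using permutes_not_in[OF \<sigma>] by (metis eq_id_iff lessThan_iff)
  next
    case 2
    \<comment> \<open>The reflection sends 2, 3, 4 to \<open>2a - 1\<close>, \<open>2a - 2\<close>,
      \<open>2a - 3\<close>. The chord \<open>{2, 4}\<close> must go to the chord at
      \<open>2a - 1\<close>, whose other end is 3; this would need \<open>a = 3\<close>.\<close>
    have "pairing2 (\<sigma> 2) = 0" using pr2[of 2 1] 2 a4 by (simp add: pairing2_small)
    moreover have "\<sigma> 2 \<noteq> 0" using inj[of 2 1] 2 by simp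
    then have "(\<sigma> 2 + 1) div 2 \<noteq> 0" by (rule half_pos)
    ultimately have s2: "\<sigma> 2 = 2 * a - 1" by (simp add: pairing2_def split: if_splits)
    have "pairing3 (\<sigma> 4) = 2" using pr3[of 4 2] a4 unfolding s2 by (simp add: pairing3_small del: One_nat_def)
    moreover have "\<sigma> 4 \<noteq> 2 * a - 1" "\<sigma> 4 < 2 * a" using inj[of 4 2] s2 lt[of 4] a4 by auto
    ultimately have s4: "\<sigma> 4 = 3" using pairing3_iff[of "\<sigma> 4" 2] a4 by simp
    have "pairing1 (\<sigma> 3) = pairing1 (\<sigma> 2)" using pr1[of 3 2] a4 by (simp add: pairing1_def)
    then have "\<sigma> 3 div 2 = (2 * a - 1) div 2" by (simp add: pairing1_def s2)
    moreover have "\<sigma> 3 \<noteq> 2 * a - 1" using inj[of 3 2] s2 by simp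
    ultimately have s3: "\<sigma> 3 = 2 * a - 2" using half_pred a4 by blast
    have "pairing2 (\<sigma> 4) = pairing2 (\<sigma> 3)" using pr2[of 4 3] a4 by (simp add: pairing2_small)
    moreover have "pairing2 3 = 2" by (rule pairing2_small)
    moreover have "2 * a - 2 \<noteq> 2 * a - 1" "(2 * a - 2 + 1) div 2 = a - 1" using a4 by presburger+
    ultimately have "a - 1 = 2" unfolding s3 s4 pairing2_def by simp
    then have False using a4 by simp
    then show ?thesis ..
  qed
qed

end

section \<open>Pairings of six points: four suffice, three do not\<close>

lemma balanced_nth:
  assumes "list_all (\<lambda>v. length (filter (\<lambda>x. l ! x = v) [0..<length l]) = b) [0..<a]"
    and "list_all (\<lambda>v. v < a) l" and n: "n = length l"
  shows "balanced {..<n} a b (nth l)"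
  unfolding balanced_def n
proof (intro conjI allI impI)
  fix v assume "v < a"
  have "{x \<in> {..<length l}. l ! x = v} = set (filter (\<lambda>x. l ! x = v) [0..<length l])" by auto
  then show "card {x \<in> {..<length l}. l ! x = v} = b"
    using assms(1) \<open>v < a\<close> by (simp add: distinct_card list_all_iff del: set_filter)
qed (use assms(2) in \<open>auto simp: list_all_iff\<close>)

text \<open>The first two pairings form the hexagon 0, ..., 5, so \<sigma> is determined by
  \<open>\<sigma> 0\<close>. The third and fourth give second expressions for
  \<open>\<sigma> 1\<close> and \<open>\<sigma> 2\<close>, compatible only if
  \<open>\<sigma> 0 = 0\<close>.\<close>

lemma four_pairings:
  defines "fs \<equiv> map nth [[0, 0, 1, 1, 2, 2], [2, 0, 0, 1, 1, 2], [0, 0, 1, 2, 1, 2], [0, 1, 0, 1, 2, 2 :: nat]]"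
  shows "\<forall>f\<in>set fs. balanced {..<6} 3 2 f" and "separating {..<6} fs"
proof -
  have X: "{..<6} = {0, 1, 2, 3, 4, 5 :: nat}" by auto
  show "\<forall>f\<in>set fs. balanced {..<6} 3 2 f"
  proof -
    have "balanced {..<6} 3 2 (nth l)" if "l = [0, 0, 1, 1, 2, 2 :: nat]" for l
      unfolding that by (rule balanced_nth; code_simp)
    moreover have "balanced {..<6} 3 2 (nth l)" if "l = [2, 0, 0, 1, 1, 2 :: nat]" for l
      unfolding that by (rule balanced_nth; code_simp)
    moreover have "balanced {..<6} 3 2 (nth l)" if "l = [0, 0, 1, 2, 1, 2 :: nat]" for l
      unfolding that by (rule balanced_nth; code_simp)
    moreover have "balanced {..<6} 3 2 (nth l)" if "l = [0, 1, 0, 1, 2, 2 :: nat]" for l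
      unfolding that by (rule balanced_nth; code_simp)
    ultimately show ?thesis unfolding fs_def by simp
  qed
  show "separating {..<6} fs"
    unfolding separating_def
  proof (intro allI impI)
    fix \<sigma> assume \<sigma>: "\<sigma> permutes {..<6} \<and> (\<forall>f\<in>set fs. preserves {..<6} f \<sigma>)"
    have comm: "\<sigma> (p ! x) = p ! \<sigma> x"
      if "nth l \<in> set fs" "\<forall>x\<in>{..<6}. \<forall>y\<in>{..<6}. l ! x = l ! y \<longleftrightarrow> y = x \<or> y = p ! x"
        "x < 6" "p ! x < 6" "p ! x \<noteq> x" for l p x
    proof -
      have pr: "preserves {..<6} (nth l) \<sigma>" using \<sigma> that(1) by blast
      have "\<And>x y. x \<in> {..<6} \<Longrightarrow> y \<in> {..<6} \<Longrightarrow> l ! x = l ! y \<longleftrightarrow> y = x \<or> y = p ! x"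
        using that(2) by blast
      from preserves_commuting[OF this _ pr] show ?thesis using \<sigma> that(3-5) by simp
    qed
    have 1: "\<sigma> 1 = [1, 0, 3, 2, 5, 4] ! \<sigma> 0" "\<sigma> 3 = [1, 0, 3, 2, 5, 4] ! \<sigma> 2" "\<sigma> 5 = [1, 0, 3, 2, 5, 4] ! \<sigma> 4"
      using comm[of "[0, 0, 1, 1, 2, 2]" "[1, 0, 3, 2, 5, 4]" 0] comm[of "[0, 0, 1, 1, 2, 2]" "[1, 0, 3, 2, 5, 4]" 2]
        comm[of "[0, 0, 1, 1, 2, 2]" "[1, 0, 3, 2, 5, 4]" 4]
      by (simp_all add: fs_def X)
    have 2: "\<sigma> 2 = [5, 2, 1, 4, 3, 0] ! \<sigma> 1" "\<sigma> 4 = [5, 2, 1, 4, 3, 0] ! \<sigma> 3"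
      using comm[of "[2, 0, 0, 1, 1, 2]" "[5, 2, 1, 4, 3, 0]" 1] comm[of "[2, 0, 0, 1, 1, 2]" "[5, 2, 1, 4, 3, 0]" 3]
      by (simp_all add: fs_def X)
    have 3: "\<sigma> 1 = [1, 0, 4, 5, 2, 3] ! \<sigma> 0"
      using comm[of "[0, 0, 1, 2, 1, 2]" "[1, 0, 4, 5, 2, 3]" 0] by (simp add: fs_def X)
    have 4: "\<sigma> 2 = [2, 3, 0, 1, 5, 4] ! \<sigma> 0"
      using comm[of "[0, 1, 0, 1, 2, 2]" "[2, 3, 0, 1, 5, 4]" 0] by (simp add: fs_def X)
    have "\<sigma> 0 \<in> {..<6}" using \<sigma> permutes_in_image[of \<sigma> "{..<6}" 0] by simp
    then have "\<sigma> 0 = 0" using 1 2 3 4 unfolding X by auto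
    then have "\<sigma> x = x" if "x \<in> {..<6}" for x using that 1 2 unfolding X by auto
    then show "\<sigma> = id" using \<sigma> permutes_not_in[of \<sigma> "{..<6}"] by (metis eq_id_iff)
  qed
qed

text \<open>All fixed-point-free involutions of six points as lists of values: five choices for the
  image of 0 times three pairings of the remaining four points.\<close>

definition pairings6 :: "nat list list" where
  "pairings6 =
    [[1,0,3,2,5,4], [1,0,4,5,2,3], [1,0,5,4,3,2], [2,3,0,1,5,4], [2,4,0,5,1,3],
     [2,5,0,4,3,1], [3,2,1,0,5,4], [3,4,5,0,1,2], [3,5,4,0,2,1], [4,2,1,5,0,3],
     [4,3,5,1,0,2], [4,5,3,2,0,1], [5,2,1,4,3,0], [5,3,4,1,2,0], [5,4,3,2,1,0]]"

definition commute6 :: "nat list \<Rightarrow> nat list \<Rightarrow> bool" where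
  "commute6 p q \<longleftrightarrow> map (nth p) q = map (nth q) p"

definition cover :: "nat list list list \<Rightarrow> nat list list \<Rightarrow> bool" where
  "cover cs c \<longleftrightarrow> list_all (\<lambda>e. list_ex (List.member e) c) cs"

text \<open>Says that any three members of \<open>cs\<close> have a common element; the intersection
  of the first two is formed once and tested against every third.\<close>

definition common_commuting :: "nat list list list \<Rightarrow> bool" where
  "common_commuting cs \<longleftrightarrow> list_all (\<lambda>c. list_all (\<lambda>d. cover cs (filter (List.member d) c)) cs) cs"

text \<open>An outer automorphism of the symmetric group on six points turns pairings into the edges
  of the complete graph on six vertices, where commuting means equal or disjoint. Three edges
  covering at most four vertices avoid a further edge; otherwise one of the three is disjoint from
  the other two.\<close>

lemma common_commuting6: "common_commuting (map (\<lambda>p. filter (commute6 p) pairings6) pairings6)"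
  by code_simp

lemma involution_on_four:
  assumes "\<And>t. p (p t) = t" and "\<And>t. t \<in> {w, x, y, z} \<Longrightarrow> p t \<in> {w, x, y, z} - {t}" and "distinct [w, x, y, z]"
  shows "p w = x \<and> p x = w \<and> p y = z \<and> p z = y \<or> p w = y \<and> p y = w \<and> p x = z \<and> p z = x \<or>
    p w = z \<and> p z = w \<and> p x = y \<and> p y = x"
proof -
  have four: "p w \<in> {x, y, z}" "p x \<in> {w, y, z}" "p y \<in> {w, x, z}" "p z \<in> {w, x, y}"
    using assms(2)[of w] assms(2)[of x] assms(2)[of y] assms(2)[of z] by blast+
  have inj: "p s = p t \<longleftrightarrow> s = t" for s t using assms(1) by metis
  consider "p w = x" | "p w = y" | "p w = z" using four(1) by blast
  then show ?thesis
  proof cases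
    case 1
    then have "p x = w" using assms(1) by metis
    then have "p y = z" using four(3) 1 inj[of y x] inj[of y w] assms(3) by auto
    then show ?thesis using 1 \<open>p x = w\<close> assms(1) by metis
  next
    case 2
    then have "p y = w" using assms(1) by metis
    then have "p x = z" using four(2) 2 inj[of x y] inj[of x w] assms(3) by auto
    then show ?thesis using 2 \<open>p y = w\<close> assms(1) by metis
  next
    case 3
    then have "p z = w" using assms(1) by metis
    then have "p x = y" using four(2) 3 inj[of x z] inj[of x w] assms(3) by auto
    then show ?thesis using 3 \<open>p z = w\<close> assms(1) by metis
  qed
qed

lemma in_pairings6:
  assumes lt: "\<And>x. x < 6 \<Longrightarrow> p x < 6" and pp: "\<And>x. p (p x) = x" and ne: "\<And>x. x < 6 \<Longrightarrow> p x \<noteq> x"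
  shows "map p [0..<6] \<in> set pairings6"
proof -
  have X: "t < 6 \<longleftrightarrow> t \<in> {0, 1, 2, 3, 4, 5}" for t :: nat by auto
  have rest: "p w = x \<and> p x = w \<and> p y = z \<and> p z = y \<or> p w = y \<and> p y = w \<and> p x = z \<and> p z = x \<or>
      p w = z \<and> p z = w \<and> p x = y \<and> p y = x"
    if "p 0 = v" and d: "distinct [0, v, w, x, y, z]" and S: "{0, v, w, x, y, z} = {0, 1, 2, 3, 4, 5}" for v w x y z
  proof (rule involution_on_four[OF pp])
    fix t assume t: "t \<in> {w, x, y, z}"
    then have "t < 6" unfolding X S[symmetric] by blast
    then have "p t \<in> {0, v, w, x, y, z}" "p t \<noteq> t" using lt[of t] ne[of t] unfolding X S by auto
    moreover have "t \<noteq> 0" "t \<noteq> v" using t d by auto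
    then have "p t \<noteq> 0" "p t \<noteq> v" using pp \<open>p 0 = v\<close> by metis+
    ultimately show "p t \<in> {w, x, y, z} - {t}" by blast
  qed (use d in simp)
  have upt: "[0..<6] = [0, 1, 2, 3, 4, 5 :: nat]" by code_simp
  have "p 0 \<in> {0, 1, 2, 3, 4, 5} - {0}" using lt[of 0] ne[of 0] unfolding X by simp
  then consider "p 0 = 1" | "p 0 = 2" | "p 0 = 3" | "p 0 = 4" | "p 0 = 5" by blast
  then show ?thesis
  proof cases
    case 1
    show ?thesis using 1 pp[of 0] rest[OF 1, of 2 3 4 5] unfolding upt pairings6_def by auto
  next
    case 2
    show ?thesis using 2 pp[of 0] rest[OF 2, of 1 3 4 5] unfolding upt pairings6_def by auto
  next
    case 3
    show ?thesis using 3 pp[of 0] rest[OF 3, of 1 2 4 5] unfolding upt pairings6_def by auto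
  next
    case 4
    show ?thesis using 4 pp[of 0] rest[OF 4, of 1 2 3 5] unfolding upt pairings6_def by auto
  next
    case 5
    show ?thesis using 5 pp[of 0] rest[OF 5, of 1 2 3 4] unfolding upt pairings6_def by auto
  qed
qed

lemma pairings6_permute: "list_all (\<lambda>s. distinct s \<and> length s = 6 \<and> list_all (\<lambda>x. x < 6) s \<and> s \<noteq> [0..<6]) pairings6"
  by code_simp

text \<open>The permutation that escapes three pairings is itself a pairing, namely one commuting
  with all three involutions.\<close>

lemma three_pairings6_not_separating:
  fixes f g h :: "nat \<Rightarrow> nat"
  assumes "balanced {..<6} 3 2 f" "balanced {..<6} 3 2 g" "balanced {..<6} 3 2 h"
  shows "\<not> separating {..<6} [f, g, h]"
proof -
  define C where "C p = filter (commute6 p) pairings6" for p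
  have partner: "\<exists>p \<in> set pairings6. \<forall>s \<in> set (C p). \<forall>\<sigma>.
      \<sigma> permutes {..<6} \<and> (\<forall>x<6. \<sigma> x = s ! x) \<longrightarrow> preserves {..<6} f \<sigma>"
    if f: "balanced {..<6} 3 2 f" for f :: "nat \<Rightarrow> nat"
  proof -
    obtain p where p: "p permutes {..<6}" "\<And>x. p (p x) = x" "\<And>x. x \<in> {..<6} \<Longrightarrow> p x \<noteq> x"
      "\<And>x y. x \<in> {..<6} \<Longrightarrow> y \<in> {..<6} \<Longrightarrow> f x = f y \<longleftrightarrow> y = x \<or> y = p x"
      using partner_of_balanced[OF f] by blast
    have lt: "p x < 6" if "x < 6" for x using permutes_in_image[OF p(1), of x] that by simp
    define l where "l = map p [0..<6]"
    have l: "l ! x = p x" if "x < 6" for x using that by (simp add: l_def)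
    have "l \<in> set pairings6" unfolding l_def using lt p(2,3) by (intro in_pairings6) auto
    moreover have "preserves {..<6} f \<sigma>"
      if s: "s \<in> set (C l)" and \<sigma>: "\<sigma> permutes {..<6}" "\<forall>x<6. \<sigma> x = s ! x" for s \<sigma>
    proof (rule commuting_preserves[OF p(4) \<sigma>(1)])
      have len: "length s = 6" using s pairings6_permute by (auto simp: C_def list_all_iff)
      have comm: "map (nth l) s = map (nth s) l" using s by (simp add: C_def commute6_def)
      fix x :: nat assume "x \<in> {..<6}"
      then have x: "x < 6" by simp
      have "\<sigma> x < 6" using permutes_in_image[OF \<sigma>(1), of x] x by simp
      have "l ! (s ! x) = s ! (l ! x)"
        using arg_cong[OF comm, of "\<lambda>m. m ! x"] x len by (simp add: l_def)
      then show "\<sigma> (p x) = p (\<sigma> x)" using \<sigma>(2) x lt[OF x] l[OF x] l[OF \<open>\<sigma> x < 6\<close>] by simp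
    qed
    ultimately show ?thesis by blast
  qed
  obtain p where p: "p \<in> set pairings6"
    "\<And>s \<sigma>. s \<in> set (C p) \<Longrightarrow> \<sigma> permutes {..<6} \<Longrightarrow> \<forall>x<6. \<sigma> x = s ! x \<Longrightarrow> preserves {..<6} f \<sigma>"
    using partner[OF assms(1)] by blast
  obtain q where q: "q \<in> set pairings6"
    "\<And>s \<sigma>. s \<in> set (C q) \<Longrightarrow> \<sigma> permutes {..<6} \<Longrightarrow> \<forall>x<6. \<sigma> x = s ! x \<Longrightarrow> preserves {..<6} g \<sigma>"
    using partner[OF assms(2)] by blast
  obtain r where r: "r \<in> set pairings6"
    "\<And>s \<sigma>. s \<in> set (C r) \<Longrightarrow> \<sigma> permutes {..<6} \<Longrightarrow> \<forall>x<6. \<sigma> x = s ! x \<Longrightarrow> preserves {..<6} h \<sigma>"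
    using partner[OF assms(3)] by blast
  have "common_commuting (map C pairings6)" using common_commuting6 unfolding C_def[abs_def] .
  then have "\<exists>s. s \<in> set (C p) \<and> s \<in> set (C q) \<and> s \<in> set (C r)"
    using p(1) q(1) r(1) by (auto simp: common_commuting_def cover_def list_all_iff list_ex_iff)
  then obtain s where s: "s \<in> set (C p)" "s \<in> set (C q)" "s \<in> set (C r)" by blast
  then have s6: "distinct s" "length s = 6" "\<And>x. x \<in> set s \<Longrightarrow> x < 6" "s \<noteq> [0..<6]"
    using pairings6_permute by (auto simp: C_def list_all_iff)
  define \<sigma> where "\<sigma> x = (if x < 6 then s ! x else x)" for x
  have \<sigma>s: "\<forall>x<6. \<sigma> x = s ! x" by (simp add: \<sigma>_def)
  have "\<sigma> permutes {..<6}"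
    using s6(1-3) by (intro inj_imp_permutes) (auto simp: \<sigma>_def inj_on_def nth_eq_iff_index_eq)
  moreover have "\<sigma> \<noteq> id"
  proof
    assume "\<sigma> = id"
    then have "s = [0..<6]" using s6(2) \<sigma>s by (intro nth_equalityI) auto
    then show False using s6(4) by simp
  qed
  ultimately show ?thesis using p(2) q(2) r(2) s \<sigma>s by (auto simp: separating_def)
qed

section \<open>Rigid bipartite graphs\<close>

text \<open>For rows of equal size, half the size of their symmetric difference. It does not change
  when columns are renamed.\<close>

definition row_dist :: "(nat \<times> nat) set \<Rightarrow> nat \<Rightarrow> nat \<Rightarrow> nat" where
  "row_dist E i j = card (E `` {i} - E `` {j})"

text \<open>\<open>row_dist\<close> is blind to the column permutation, so the action on rows can be
  studied alone. Once all rows are fixed, a moved column would have the same rows as its image,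
  against \<open>cols\<close>.\<close>

lemma bip_rigidI:
  assumes E: "E \<subseteq> {..<a} \<times> {..<a}"
    and rows: "\<And>\<rho> i. \<rho> permutes {..<a} \<Longrightarrow>
      (\<And>i j. i < a \<Longrightarrow> j < a \<Longrightarrow> row_dist E (\<rho> i) (\<rho> j) = row_dist E i j) \<Longrightarrow> i < a \<Longrightarrow> \<rho> i = i"
    and cols: "\<And>j j'. j < j' \<Longrightarrow> j' < a \<Longrightarrow> \<exists>i. (i, j) \<in> E \<longleftrightarrow> (i, j') \<notin> E"
  shows "bip_rigid a E"
  unfolding bip_rigid_def
proof (intro allI impI)
  fix \<rho> \<gamma>
  assume "\<rho> permutes {..<a} \<and> \<gamma> permutes {..<a} \<and> (\<forall>i j. (i, j) \<in> E \<longleftrightarrow> (\<rho> i, \<gamma> j) \<in> E)"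
  then have \<rho>: "\<rho> permutes {..<a}" and \<gamma>: "\<gamma> permutes {..<a}"
    and aut: "\<And>i j. (\<rho> i, \<gamma> j) \<in> E \<longleftrightarrow> (i, j) \<in> E"
    by auto
  have img: "E `` {\<rho> i} = \<gamma> ` (E `` {i})" for i
  proof (intro set_eqI iffI)
    fix c assume "c \<in> E `` {\<rho> i}"
    moreover obtain j where "c = \<gamma> j" using permutes_surj[OF \<gamma>] by auto
    ultimately show "c \<in> \<gamma> ` (E `` {i})" using aut by auto
  qed (use aut in auto)
  have "row_dist E (\<rho> i) (\<rho> j) = row_dist E i j" for i j
    using permutes_inj[OF \<gamma>] unfolding row_dist_def img
    by (simp add: card_image image_set_diff[symmetric] inj_on_subset)
  then have \<rho>i: "\<rho> i = i" if "i < a" for i using rows[OF \<rho>] that by blast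
  then have "\<rho> = id" using permutes_not_in[OF \<rho>] by (metis eq_id_iff lessThan_iff)
  moreover have "\<gamma> j = j" if j: "j < a" for j
  proof (rule ccontr)
    assume ne: "\<gamma> j \<noteq> j"
    have "\<gamma> j < a" using permutes_in_image[OF \<gamma>, of j] j by simp
    then have "\<exists>i. (i, j) \<in> E \<longleftrightarrow> (i, \<gamma> j) \<notin> E"
      using cols[of j "\<gamma> j"] cols[of "\<gamma> j" j] j ne by (metis linorder_neqE_nat)
    then obtain i where "(i, j) \<in> E \<longleftrightarrow> (i, \<gamma> j) \<notin> E" by blast
    then show False using aut[of i j] \<open>\<rho> = id\<close> by simp
  qed
  then have "\<gamma> = id" using permutes_not_in[OF \<gamma>] by (metis eq_id_iff lessThan_iff)
  ultimately show "\<rho> = id \<and> \<gamma> = id" by blast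
qed

text \<open>The two edges trade their columns: each row and column involved loses one edge and gains
  one.\<close>

lemma regular_switch:
  assumes reg: "regular a k E" and E: "(i, c) \<in> E" "(i', c') \<in> E" "(i, c') \<notin> E" "(i', c) \<notin> E"
  shows "regular a k (insert (i, c') (insert (i', c) (E - {(i, c), (i', c')})))"
    (is "regular a k ?E")
  unfolding regular_def
proof (intro conjI allI impI)
  have lt: "i < a" "c < a" "i' < a" "c' < a" using E reg by (auto simp: regular_def)
  have ne: "i \<noteq> i'" "c \<noteq> c'" using E by auto
  show "?E \<subseteq> {..<a} \<times> {..<a}" using lt reg by (auto simp: regular_def)
  have exch: "card (insert y (A - {x})) = card A" if "x \<in> A" "y \<notin> A" "finite A" for x y :: nat and A
    using that by (metis Diff_iff card_insert_disjoint card_Suc_Diff1 finite_Diff)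
  have fin: "finite {j. (v, j) \<in> E}" "finite {u. (u, v) \<in> E}" for v
    by (rule finite_subset[of _ "{..<a}"]; use reg in \<open>auto simp: regular_def\<close>)+
  fix v assume v: "v < a"
  consider "v = i" | "v = i'" | "v \<noteq> i" "v \<noteq> i'" by blast
  then have "card {j. (v, j) \<in> ?E} = card {j. (v, j) \<in> E}"
  proof cases
    case 1
    then have "{j. (v, j) \<in> ?E} = insert c' ({j. (v, j) \<in> E} - {c})" using ne by auto
    then show ?thesis using exch[of c _ c'] E fin(1) 1 by simp
  next
    case 2
    then have "{j. (v, j) \<in> ?E} = insert c ({j. (v, j) \<in> E} - {c'})" using ne by auto
    then show ?thesis using exch[of c' _ c] E fin(1) 2 by simp
  qed simp
  then show "card {j. (v, j) \<in> ?E} = k" using reg v by (simp add: regular_def)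
  consider "v = c" | "v = c'" | "v \<noteq> c" "v \<noteq> c'" by blast
  then have "card {u. (u, v) \<in> ?E} = card {u. (u, v) \<in> E}"
  proof cases
    case 1
    then have "{u. (u, v) \<in> ?E} = insert i' ({u. (u, v) \<in> E} - {i})" using ne by auto
    then show ?thesis using exch[of i _ i'] E fin(2) 1 by simp
  next
    case 2
    then have "{u. (u, v) \<in> ?E} = insert i ({u. (u, v) \<in> E} - {i'})" using ne by auto
    then show ?thesis using exch[of i' _ i] E fin(2) 2 by simp
  qed simp
  then show "card {u. (u, v) \<in> ?E} = k" using reg v by (simp add: regular_def)
qed

lemma row_dist_commute:
  assumes "regular a k E" "i < a" "j < a"
  shows "row_dist E i j = row_dist E j i"
proof -
  have fin: "finite (E `` {v})" for v
    using regular_finite[OF assms(1)] by (rule finite_Image)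
  have card: "card (E `` {v}) = k" if "v < a" for v
    using assms(1) that by (simp add: regular_def Image_singleton)
  have "card (E `` {i} - E `` {j}) = card (E `` {i}) - card (E `` {i} \<inter> E `` {j})"
    using fin by (simp add: card_Diff_subset_Int)
  moreover have "card (E `` {j} - E `` {i}) = card (E `` {j}) - card (E `` {i} \<inter> E `` {j})"
    using fin by (simp add: card_Diff_subset_Int Int_commute)
  ultimately show ?thesis using card assms by (simp add: row_dist_def)
qed

text \<open>Walking from the fixed end \<open>s\<close>: the image of \<open>i\<close> is a
  neighbour of the fixed vertex \<open>i - 1\<close>, whose only other neighbour
  \<open>i - 2\<close> is already an image.\<close>

lemma path_fixed:
  fixes \<rho> :: "nat \<Rightarrow> nat" and adj :: "nat \<Rightarrow> nat \<Rightarrow> bool"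
  assumes inj: "inj \<rho>" and pres: "\<And>i j. i < a \<Longrightarrow> j < a \<Longrightarrow> adj (\<rho> i) (\<rho> j) \<longleftrightarrow> adj i j"
    and lt: "\<And>i. i < a \<Longrightarrow> \<rho> i < a" and e: "e < a"
    and start: "\<rho> s = s" "\<And>j. j < a \<Longrightarrow> adj s j \<Longrightarrow> j = Suc s"
    and path: "\<And>i. s \<le> i \<Longrightarrow> i < e \<Longrightarrow> adj i (Suc i)"
    and step: "\<And>i j. s < i \<Longrightarrow> i < e \<Longrightarrow> j < a \<Longrightarrow> adj i j \<Longrightarrow> j = i - 1 \<or> j = Suc i"
  shows "s \<le> i \<Longrightarrow> i \<le> e \<Longrightarrow> \<rho> i = i"
proof (induction i rule: less_induct)
  case (less i)
  show ?case
  proof (cases "i = s")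
    case False
    then obtain i' where i': "i = Suc i'" "s \<le> i'" using less.prems by (cases i) auto
    have fix': "\<rho> i' = i'" using less.IH[of i'] less.prems i' by simp
    have "adj i' i" using path[of i'] i' less.prems by simp
    then have adj: "adj i' (\<rho> i)" using pres[of i' i] fix' i' less.prems e by simp
    have ia: "\<rho> i < a" using lt less.prems e by simp
    show ?thesis
    proof (cases "i' = s")
      case True
      then show ?thesis using start(2)[OF ia] adj i' by simp
    next
      case False
      then have "\<rho> i = i' - 1 \<or> \<rho> i = i" using step[OF _ _ ia adj] i' less.prems by simp
      moreover have "\<rho> (i' - 1) = i' - 1" using less.IH[of "i' - 1"] less.prems i' False by simp
      then have "\<rho> i \<noteq> i' - 1" using inj i' unfolding inj_def by (metis Suc_n_not_le_n diff_le_self)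
      ultimately show ?thesis by blast
    qed
  qed (use start in simp)
qed

section \<open>The cubic graph on 8 + 8 vertices\<close>

definition rows8 :: "nat list list" where
  "rows8 = [[0,1,2], [0,2,3], [2,3,4], [1,3,5], [4,5,6], [5,6,7], [0,6,7], [1,4,7]]"

text \<open>A separate graph because the cubic band below needs \<open>a \<ge> 9\<close>: for
  \<open>a = 8\<close> its rows 5 and 7 would share columns 1 and 7, so row 5 would not be the end
  of a path.\<close>

definition graph8 :: "(nat \<times> nat) set" where
  "graph8 = {(i, j). i < 8 \<and> j \<in> set (rows8 ! i)}"

definition dist8 :: "int list list" where
  "dist8 = map (\<lambda>r. map (\<lambda>r'. int (length (filter (\<lambda>x. \<not> List.member r' x) r))) rows8) rows8"

lemma rows8_check:
  "length rows8 = 8" "list_all (\<lambda>r. distinct r \<and> length r = 3 \<and> list_all (\<lambda>j. j < 8) r) rows8"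
  "list_all (\<lambda>j. length (filter (\<lambda>i. List.member (rows8 ! i) j) [0..<8]) = 3) [0..<8]"
  "list_all (\<lambda>j. list_all (\<lambda>j'. j < j' \<longrightarrow>
     list_ex (\<lambda>i. List.member (rows8 ! i) j \<noteq> List.member (rows8 ! i) j') [0..<8]) [0..<8]) [0..<8]"
  by code_simp+

lemma regular_graph8: "regular 8 3 graph8"
  unfolding regular_def
proof (intro conjI allI impI)
  have r: "distinct r \<and> length r = 3 \<and> (\<forall>j\<in>set r. j < 8)" if "r \<in> set rows8" for r
    using rows8_check(2) that by (simp add: list_all_iff)
  have "j < 8" if "i < 8" "j \<in> set (rows8 ! i)" for i j
    using r[of "rows8 ! i"] rows8_check(1) that by simp
  then show "graph8 \<subseteq> {..<8} \<times> {..<8}" by (auto simp: graph8_def)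
  fix v :: nat assume v: "v < 8"
  have "{j. (v, j) \<in> graph8} = set (rows8 ! v)" using v by (simp add: graph8_def)
  then show "card {j. (v, j) \<in> graph8} = 3"
    using r[of "rows8 ! v"] v rows8_check(1) by (simp add: distinct_card)
  have "{i. (i, v) \<in> graph8} = set (filter (\<lambda>i. List.member (rows8 ! i) v) [0..<8])"
    by (auto simp: graph8_def)
  moreover have "length (filter (\<lambda>i. List.member (rows8 ! i) v) [0..<8]) = 3"
    using rows8_check(3) v by (simp add: list_all_iff)
  ultimately show "card {i. (i, v) \<in> graph8} = 3"
    by (metis distinct_card distinct_filter distinct_upt)
qed

text \<open>Iterating this operator on the constant \<open>1\<close> yields row weights that are invariant under
  automorphisms; for \<^term>\<open>graph8\<close> three iterations separate all rows.\<close>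

definition refine :: "int list \<Rightarrow> int list" where
  "refine w = map (\<lambda>r. sum_list (map (\<lambda>(d, x). d * d * x) (zip r w))) dist8"

lemma refine8: "distinct (refine (refine (refine (replicate 8 1))))"
  by code_simp

lemma dist8_nth:
  assumes "i < 8" "j < 8"
  shows "dist8 ! i ! j = int (row_dist graph8 i j)"
proof -
  have len: "length rows8 = 8" by (rule rows8_check(1))
  have d: "distinct (rows8 ! i)" using rows8_check(2) assms(1) len by (auto simp: list_all_iff)
  have "graph8 `` {i} - graph8 `` {j} = set (filter (\<lambda>x. \<not> List.member (rows8 ! j) x) (rows8 ! i))"
    using assms by (auto simp: graph8_def)
  then have "row_dist graph8 i j = length (filter (\<lambda>x. \<not> List.member (rows8 ! j) x) (rows8 ! i))"
    using d by (simp add: row_dist_def distinct_card del: set_filter)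
  then show ?thesis using assms len by (simp add: dist8_def)
qed

text \<open>The distances are squared because in a regular graph their plain sum over
  \<open>j\<close> is the same for every row, so that linear weights would stay constant.\<close>

lemma refine_nth:
  assumes "i < 8" "length w = 8"
  shows "refine w ! i = (\<Sum>j<8. int (row_dist graph8 i j) * int (row_dist graph8 i j) * w ! j)"
proof -
  have len: "length dist8 = 8" "length (dist8 ! i) = 8"
    using rows8_check(1) assms(1) by (simp_all add: dist8_def)
  have "refine w ! i = (\<Sum>j<8. dist8 ! i ! j * (dist8 ! i ! j) * w ! j)"
    using len assms by (simp add: refine_def sum_list_sum_nth atLeast0LessThan)
  then show ?thesis using dist8_nth[OF assms(1)] by simp
qed

lemma bip_rigid_graph8: "bip_rigid 8 graph8"
proof (rule bip_rigidI)
  show "graph8 \<subseteq> {..<8} \<times> {..<8}" using regular_graph8 by (simp add: regular_def)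
next
  fix j j' :: nat assume "j < j'" "j' < 8"
  then have "list_ex (\<lambda>i. List.member (rows8 ! i) j \<noteq> List.member (rows8 ! i) j') [0..<8]"
    using rows8_check(4) unfolding list_all_iff by simp
  then obtain i where "i \<in> set [0..<8]" "List.member (rows8 ! i) j \<noteq> List.member (rows8 ! i) j'"
    unfolding list_ex_iff by blast
  then show "\<exists>i. (i, j) \<in> graph8 \<longleftrightarrow> (i, j') \<notin> graph8" by (auto simp: graph8_def intro!: exI[of _ i])
next
  fix \<rho> :: "nat \<Rightarrow> nat" and i :: nat assume \<rho>: "\<rho> permutes {..<8}" and i: "i < 8"
    and dist: "\<And>i j. i < 8 \<Longrightarrow> j < 8 \<Longrightarrow> row_dist graph8 (\<rho> i) (\<rho> j) = row_dist graph8 i j"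
  have lt: "\<rho> i < 8" if "i < 8" for i using permutes_in_image[OF \<rho>, of i] that by simp
  have inv: "refine w ! \<rho> i = refine w ! i"
    if w: "length w = 8" "\<And>j. j < 8 \<Longrightarrow> w ! \<rho> j = w ! j" and "i < 8" for w i
  proof -
    have "refine w ! \<rho> i = (\<Sum>j<8. int (row_dist graph8 (\<rho> i) (\<rho> j)) * int (row_dist graph8 (\<rho> i) (\<rho> j)) * w ! \<rho> j)"
      unfolding refine_nth[OF lt[OF \<open>i < 8\<close>] w(1)]
      using sum.permute[OF \<rho>] by (simp add: comp_def)
    also have "\<dots> = refine w ! i"
      unfolding refine_nth[OF \<open>i < 8\<close> w(1)] using dist \<open>i < 8\<close> w(2) by (intro sum.cong) auto
    finally show ?thesis .
  qed
  have len: "length (refine w) = 8" for w using rows8_check(1) by (simp add: refine_def dist8_def)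
  have "refine (refine (refine (replicate 8 1))) ! \<rho> i = refine (refine (refine (replicate 8 1))) ! i"
    by (intro inv len i) (use lt in auto)
  then show "\<rho> i = i" using refine8 i lt[OF i] len by (simp add: nth_eq_iff_index_eq)
qed

section \<open>Adjacency of rows and its automorphisms\<close>

lemma row_dist_ge:
  assumes "finite E" "distinct cs" "\<And>c. c \<in> set cs \<Longrightarrow> (i, c) \<in> E \<and> (j, c) \<notin> E"
  shows "length cs \<le> row_dist E i j"
proof -
  have "finite (E `` {i} - E `` {j})" using assms(1) by (simp add: finite_Image)
  then have "card (set cs) \<le> row_dist E i j"
    unfolding row_dist_def using assms(3) by (intro card_mono) auto
  then show ?thesis using assms(2) by (simp add: distinct_card)
qed

lemma row_dist_le:
  assumes "\<And>c. (i, c) \<in> E \<Longrightarrow> (j, c) \<notin> E \<Longrightarrow> c \<in> set cs"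
  shows "row_dist E i j \<le> length cs"
proof -
  have "row_dist E i j \<le> card (set cs)"
    unfolding row_dist_def using assms by (intro card_mono) auto
  then show ?thesis using card_length[of cs] by simp
qed

lemma row_dist_le2:
  "(\<And>c. (i, c) \<in> E \<Longrightarrow> (j, c) \<notin> E \<Longrightarrow> c = x \<or> c = y) \<Longrightarrow> row_dist E i j \<le> 2"
  using row_dist_le[of i E j "[x, y]"] by auto

lemma row_dist_ge3:
  assumes "finite E" "x \<noteq> y" "x \<noteq> z" "y \<noteq> z" "(i, x) \<in> E" "(i, y) \<in> E" "(i, z) \<in> E"
    "(j, x) \<notin> E" "(j, y) \<notin> E" "(j, z) \<notin> E"
  shows "3 \<le> row_dist E i j"
proof -
  have "length [x, y, z] \<le> row_dist E i j" by (rule row_dist_ge) (use assms in auto)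
  then show ?thesis by simp
qed

text \<open>The rigidity proofs work in this graph on the rows, using the distinction between
  distance at most 2 and at least 3 as an additional mark.\<close>

definition adjacent :: "(nat \<times> nat) set \<Rightarrow> nat \<Rightarrow> nat \<Rightarrow> bool" where
  "adjacent E i j \<longleftrightarrow> i \<noteq> j \<and> row_dist E i j \<le> 1"

lemma not_adjacentI:
  assumes "finite E" "c \<noteq> d" "(i, c) \<in> E" "(i, d) \<in> E" "(j, c) \<notin> E" "(j, d) \<notin> E"
  shows "\<not> adjacent E i j"
proof -
  have "length [c, d] \<le> row_dist E i j" by (rule row_dist_ge) (use assms in auto)
  then show ?thesis by (simp add: adjacent_def)
qed

lemma adjacentI:
  "i \<noteq> j \<Longrightarrow> (\<And>c. (i, c) \<in> E \<Longrightarrow> (j, c) \<notin> E \<Longrightarrow> c = d) \<Longrightarrow> adjacent E i j"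
  using row_dist_le[of i E j "[d]"] by (auto simp: adjacent_def)

locale row_automorphism =
  fixes a k :: nat and E :: "(nat \<times> nat) set" and \<rho> :: "nat \<Rightarrow> nat"
  assumes reg: "regular a k E" and perm: "\<rho> permutes {..<a}"
    and dist: "\<And>i j. i < a \<Longrightarrow> j < a \<Longrightarrow> row_dist E (\<rho> i) (\<rho> j) = row_dist E i j"
begin

lemma less_iff: "\<rho> i < a \<longleftrightarrow> i < a"
  using permutes_in_image[OF perm] by simp

lemma eq_iff: "\<rho> i = \<rho> j \<longleftrightarrow> i = j"
  using permutes_inj[OF perm] by (simp add: inj_eq)

lemma adjacent_commute: "i < a \<Longrightarrow> j < a \<Longrightarrow> adjacent E i j \<longleftrightarrow> adjacent E j i"
  using row_dist_commute[OF reg] by (auto simp: adjacent_def)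

lemma adjacent_iff: "i < a \<Longrightarrow> j < a \<Longrightarrow> adjacent E (\<rho> i) (\<rho> j) \<longleftrightarrow> adjacent E i j"
  using dist by (simp add: adjacent_def eq_iff)

lemma preimage:
  assumes "u < a"
  obtains i where "i < a" "u = \<rho> i"
  using permutes_image[OF perm] assms by (metis imageE lessThan_iff)

text \<open>Being isolated is invariant under \<rho>, and \<open>s\<close> is the only isolated
  row.\<close>

lemma isolated_fixed:
  assumes "s < a" "\<And>j. j < a \<Longrightarrow> \<not> adjacent E s j"
    and "\<And>i. i < a \<Longrightarrow> i \<noteq> s \<Longrightarrow> \<exists>j<a. adjacent E i j"
  shows "\<rho> s = s"
  using assms adjacent_iff less_iff preimage by metis

lemma leaf_image:
  assumes "s < a" "\<And>j. j < a \<Longrightarrow> adjacent E s j \<Longrightarrow> j = s'" "u < a" "v < a"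
    "adjacent E (\<rho> s) u" "adjacent E (\<rho> s) v"
  shows "u = v"
  using assms adjacent_iff preimage by metis

text \<open>A row with at most one neighbour cannot be sent to an inner row of a path, which has one
  on either side.\<close>

lemma leaf_not_inner:
  assumes s: "s < a" "\<And>j. j < a \<Longrightarrow> adjacent E s j \<Longrightarrow> j = s'" and m: "Suc (\<rho> s) < a"
    and adj: "adjacent E (\<rho> s) (Suc (\<rho> s))" "adjacent E (\<rho> s) (\<rho> s - 1)"
  shows False
proof -
  have "\<rho> s - 1 < a" using m by simp
  then have "Suc (\<rho> s) = \<rho> s - 1" using leaf_image[OF s m _ adj] by blast
  then show False by simp
qed

lemma adjacent_path_fixed:
  assumes e: "e < a" and start: "\<rho> s = s" "\<And>j. j < a \<Longrightarrow> adjacent E s j \<Longrightarrow> j = Suc s"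
    and "\<And>i. s \<le> i \<Longrightarrow> i < e \<Longrightarrow> adjacent E i (Suc i)"
    and "\<And>i j. s < i \<Longrightarrow> i < e \<Longrightarrow> j < a \<Longrightarrow> adjacent E i j \<Longrightarrow> j = i - 1 \<or> j = Suc i"
    and "s \<le> i" "i \<le> e"
  shows "\<rho> i = i"
  by (rule path_fixed[of \<rho> a "adjacent E" e s])
    (use assms permutes_inj[OF perm] adjacent_iff less_iff in auto)

end

section \<open>A cyclic band with one switch\<close>

definition switched :: "nat \<Rightarrow> nat \<Rightarrow> nat \<Rightarrow> nat \<Rightarrow> (nat \<times> nat) set" where
  "switched a k t d = insert (0, d) (insert (t, 1) (band a k - {(0, 1), (t, d)}))"

text \<open>If row \<open>j\<close> does not wrap around to column \<open>i\<close>, it misses the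
  first two columns of row \<open>i\<close>; if it does, it misses the last two, because
  \<open>2 * k \<le> a\<close>.\<close>

lemma switched_far:
  assumes "2 * k \<le> a" "3 \<le> k" and ij: "0 < i" "i + 2 \<le> j" "j < a" "i \<noteq> t" "j \<noteq> t" and "1 < t" "t < a" "d < a"
  shows "\<not> adjacent (switched a k t d) i j"
proof -
  have row: "(v, c) \<in> switched a k t d \<longleftrightarrow> (v, c) \<in> band a k" if "v = i \<or> v = j" for v c
    using that ij by (auto simp: switched_def)
  have "finite (switched a k t d)"
    using regular_finite[OF regular_band[of k a]] assms by (simp add: switched_def)
  note far = not_adjacentI[OF this, of _ _ i j]
  show ?thesis
  proof (cases "j + k \<le> a + i")
    case True
    then show ?thesis by (intro far[of i "i + 1"]) (use assms in \<open>auto simp: row band_def\<close>)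
  next
    case False
    then show ?thesis by (intro far[of "i + k - 1" "i + k - 2"]) (use assms in \<open>auto simp: row band_def\<close>)
  qed
qed

section \<open>Degree at least four: an isolated row, a triangle and a path\<close>

context
  fixes a k :: nat
  assumes k: "4 \<le> k" and a: "2 * k \<le> a"
begin

text \<open>Consecutive rows of the band form a cycle. Moving column \<open>k\<close> from row 3 to
  row 0 and column 1 the other way isolates row 3 and makes row 0 adjacent to row 2 instead of row
  \<open>a - 1\<close>; the triangle 0, 1, 2 and the path 4, ..., \<open>a - 1\<close>
  remain.\<close>

abbreviation "wide \<equiv> switched a k 3 k"

lemma mem_wide:
  "(i, j) \<in> wide \<longleftrightarrow> i < a \<and> j < a \<and> (if i = 0 then j = 0 \<or> 2 \<le> j \<and> j \<le> k
     else if i = 3 then j = 1 \<or> 3 \<le> j \<and> j \<le> k + 2 \<and> j \<noteq> k else i \<le> j \<and> j < i + k \<or> j + a < i + k)"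
  using k a by (auto simp: switched_def band_def)

lemma regular_wide: "regular a k wide"
  unfolding switched_def using k a
  by (intro regular_switch regular_band) (auto simp: band_def)

lemma wide_far_3: "j < a \<Longrightarrow> \<not> adjacent wide 3 j"
proof -
  assume j: "j < a"
  note far = not_adjacentI[OF regular_finite[OF regular_wide], of _ _ 3 j]
  consider "j = 0" | "j = 1" | "j = 2" | "j = 3" | "4 \<le> j" "j + k \<le> a + 1" | "a + 2 \<le> j + k" "j \<noteq> k + 2" | "j = k + 2" "a + 2 \<le> j + k"
    by linarith
  then show ?thesis
  proof cases
    case 1 show ?thesis by (rule far[of 1 "k + 1"]) (use 1 k a in \<open>auto simp: mem_wide\<close>)
  next
    case 2 show ?thesis by (rule far[of "k + 2" "k + 1"]) (use 2 k a in \<open>auto simp: mem_wide\<close>)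
  next
    case 3 show ?thesis by (rule far[of 1 "k + 2"]) (use 3 k a in \<open>auto simp: mem_wide\<close>)
  next
    \<comment> \<open>Column 3 is still in row 3 because \<open>k \<noteq> 3\<close>; in degree
      three this switch would leave rows 3 and 4 adjacent.\<close>
    case 5 show ?thesis by (rule far[of 1 3]) (use 5 j k a in \<open>auto simp: mem_wide\<close>)
  next
    case 6 show ?thesis by (rule far[of "k + 1" "k + 2"]) (use 6 j k a in \<open>auto simp: mem_wide\<close>)
  next
    case 7 show ?thesis by (rule far[of "k + 1" 3]) (use 7 j k a in \<open>auto simp: mem_wide\<close>)
  qed (simp add: adjacent_def)
qed

lemma wide_far_0: "4 \<le> j \<Longrightarrow> j < a \<Longrightarrow> \<not> adjacent wide 0 j"
proof -
  assume j: "4 \<le> j" "j < a"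
  note far = not_adjacentI[OF regular_finite[OF regular_wide], of _ _ 0 j]
  show ?thesis
  proof (cases "j + k \<le> a")
    case True show ?thesis by (rule far[of 0 2]) (use True j k a in \<open>auto simp: mem_wide\<close>)
  next
    case False show ?thesis by (rule far[of "k - 1" k]) (use False j k a in \<open>auto simp: mem_wide\<close>)
  qed
qed

lemma adjacent_wide:
  "adjacent wide 0 1" "adjacent wide 1 0" "adjacent wide 1 2" "adjacent wide 2 0" "adjacent wide 2 1"
  by (rule adjacentI[where d = 0] adjacentI[where d = 1] adjacentI[where d = "k + 1"];
      use k a in \<open>auto simp: mem_wide split: if_splits; fail\<close>)+

lemma adjacent_Suc_wide: "4 \<le> i \<Longrightarrow> Suc i < a \<Longrightarrow> adjacent wide i (Suc i)"
  by (rule adjacentI[where d = i]) (use k a in \<open>auto simp: mem_wide split: if_splits\<close>)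

text \<open>Distances to row 3 tell the end 4 of the path from the end \<open>a - 1\<close>, and row
  0 from rows 1 and 2; distances to row 4 tell row 1 from row 2.\<close>

lemma row_dist_wide:
  "row_dist wide 3 4 \<le> 2" "row_dist wide 3 1 \<le> 2" "row_dist wide 3 2 \<le> 2" "row_dist wide 2 4 \<le> 2"
  "3 \<le> row_dist wide 3 0" "3 \<le> row_dist wide 3 (a - 1)" "3 \<le> row_dist wide 1 4"
proof -
  note fin = regular_finite[OF regular_wide]
  show "row_dist wide 3 4 \<le> 2" by (rule row_dist_le2[where x = "1" and y = "3"]) (use k a in \<open>auto simp: mem_wide split: if_splits\<close>)
  show "row_dist wide 3 1 \<le> 2" by (rule row_dist_le2[where x = "k + 1" and y = "k + 2"]) (use k a in \<open>auto simp: mem_wide split: if_splits\<close>)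
  show "row_dist wide 3 2 \<le> 2" by (rule row_dist_le2[where x = "1" and y = "k + 2"]) (use k a in \<open>auto simp: mem_wide split: if_splits\<close>)
  show "row_dist wide 2 4 \<le> 2" by (rule row_dist_le2[where x = "2" and y = "3"]) (use k a in \<open>auto simp: mem_wide split: if_splits\<close>)
  show "3 \<le> row_dist wide 3 0" by (rule row_dist_ge3[OF fin, of "1" "k + 1" "k + 2"]) (use k a in \<open>auto simp: mem_wide\<close>)
  show "3 \<le> row_dist wide 3 (a - 1)"
    by (rule row_dist_ge3[OF fin, of "k - 1" "k + 1" "k + 2"]) (use k a in \<open>auto simp: mem_wide\<close>)
  show "3 \<le> row_dist wide 1 4" by (rule row_dist_ge3[OF fin, of "1" "2" "3"]) (use k a in \<open>auto simp: mem_wide\<close>)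
qed

lemma rows_fixed_wide:
  assumes "\<rho> permutes {..<a}" "\<And>i j. i < a \<Longrightarrow> j < a \<Longrightarrow> row_dist wide (\<rho> i) (\<rho> j) = row_dist wide i j"
    and "i < a"
  shows "\<rho> i = i"
proof -
  interpret row_automorphism a k wide \<rho>
    using regular_wide assms by unfold_locales auto
  have lt: "0 < a" "1 < a" "2 < a" "3 < a" "4 < a" "5 < a" "6 < a" using k a by auto
  have far: "\<not> adjacent wide i j \<and> \<not> adjacent wide j i"
    if "0 < i" "i + 2 \<le> j" "j < a" "i \<noteq> 3" "j \<noteq> 3" for i j
    using switched_far[of k a i j 3 k] that k a adjacent_commute[of i j] by simp
  have iso: "\<not> adjacent wide j 3" if "j < a" for j
    using wide_far_3[OF that] adjacent_commute[of j 3] that lt by simp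
  have not_0: "\<not> adjacent wide j 0" if "4 \<le> j" "j < a" for j
    using wide_far_0[OF that] adjacent_commute[of j 0] that lt by simp
  have nbr4: "j = Suc 4" if "j < a" "adjacent wide 4 j" for j
  proof -
    have "j \<noteq> 0" using not_0[OF order_refl lt(5)] that(2) by metis
    moreover have "j \<noteq> 1" "j \<noteq> 2" using far[of 1 4] far[of 2 4] that lt by auto
    moreover have "j \<noteq> 3" using iso[of 4] that lt by auto
    moreover have "j \<noteq> 4" using that by (simp add: adjacent_def)
    moreover have "\<not> 6 \<le> j" using far[of 4 j] that by auto
    ultimately show ?thesis by linarith
  qed
  have nbr: "j = i - 1 \<or> j = Suc i" if "4 < i" "i < a" "j < a" "adjacent wide i j" for i j
  proof -
    have "\<not> adjacent wide i 0" using not_0[of i] that by simp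
    then have "j \<noteq> 0" using that(4) by metis
    moreover have "j \<noteq> 3" using iso[of i] that by auto
    moreover have "j \<noteq> i" using that by (simp add: adjacent_def)
    moreover have "\<not> i + 2 \<le> j" using far[of i j] that by auto
    moreover have "\<not> j + 2 \<le> i" if "j \<noteq> 0" "j \<noteq> 3" using far[of j i] that \<open>adjacent wide i j\<close> \<open>4 < i\<close> \<open>i < a\<close> by auto
    ultimately show ?thesis by linarith
  qed
  have rev_Suc: "adjacent wide (Suc i) i" if "4 \<le> i" "Suc i < a" for i
    using adjacent_Suc_wide[OF that] adjacent_commute[of i "Suc i"] that by simp
  have \<rho>3: "\<rho> 3 = 3"
  proof (rule isolated_fixed)
    fix i assume i: "i < a" "i \<noteq> 3"
    consider "i = 0" | "i = 1" | "i = 2" | "4 \<le> i" "Suc i < a" | "5 \<le> i" using i lt by linarith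
    then show "\<exists>j<a. adjacent wide i j"
    proof cases
      case 4
      then show ?thesis using adjacent_Suc_wide by blast
    next
      case 5
      then show ?thesis using rev_Suc[of "i - 1"] i by (intro exI[of _ "i - 1"]) simp
    qed (use adjacent_wide lt in metis)+
  qed (use lt wide_far_3 in auto)
  \<comment> \<open>Row 4 has only one neighbour, which rules out rows 1 and 2 and the inner rows of
    the path; its distance to the fixed row 3 rules out row 0 and the other end.\<close>
  have \<rho>4: "\<rho> 4 = 4"
  proof (rule ccontr)
    assume "\<rho> 4 \<noteq> 4"
    moreover have "\<rho> 4 \<noteq> 3" using \<rho>3 eq_iff[of 4 3] by simp
    moreover have "row_dist wide 3 (\<rho> 4) \<le> 2" using dist[of 3 4] \<rho>3 lt row_dist_wide(1) by simp
    then have "\<rho> 4 \<noteq> 0" "\<rho> 4 \<noteq> a - 1" using row_dist_wide(5,6) by - (rule notI, simp)+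
    moreover have "\<rho> 4 < a" using less_iff lt by simp
    ultimately consider "\<rho> 4 = 1" | "\<rho> 4 = 2" | "5 \<le> \<rho> 4" "Suc (\<rho> 4) < a" by linarith
    then show False
    proof cases
      case 1
      then show False using leaf_image[OF lt(5) nbr4, of 0 2] adjacent_wide lt by simp
    next
      case 2
      then show False using leaf_image[OF lt(5) nbr4, of 0 1] adjacent_wide lt by simp
    next
      case 3
      then have "adjacent wide (\<rho> 4) (Suc (\<rho> 4))" "adjacent wide (\<rho> 4) (\<rho> 4 - 1)"
        using adjacent_Suc_wide[of "\<rho> 4"] rev_Suc[of "\<rho> 4 - 1"] by auto
      then show False using leaf_not_inner[OF lt(5) nbr4] 3 by simp
    qed
  qed
  have high: "\<rho> i = i" if "4 \<le> i" "i < a" for i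
    by (rule adjacent_path_fixed[of "a - 1" 4]) (use that lt \<rho>4 nbr4 nbr adjacent_Suc_wide in auto)
  have low: "\<rho> i \<in> {0, 1, 2}" if "i < 3" for i
  proof -
    have "\<rho> i < a" using less_iff that lt by simp
    moreover have "\<rho> i \<noteq> 3" using \<rho>3 eq_iff[of i 3] that by simp
    moreover have "\<not> 4 \<le> \<rho> i" using high[of "\<rho> i"] eq_iff[of "\<rho> i" i] that \<open>\<rho> i < a\<close> by auto
    ultimately show ?thesis by auto
  qed
  \<comment> \<open>In the triangle, row 0 is the one far from row 3, and of the other two row 1 is
    the one far from row 4.\<close>
  have "3 \<le> row_dist wide 3 (\<rho> 0)" using dist[of 3 0] \<rho>3 lt row_dist_wide(5) by simp
  then have \<rho>0: "\<rho> 0 = 0" using low[of 0] row_dist_wide(2,3) by auto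
  have "3 \<le> row_dist wide (\<rho> 1) 4" using dist[of 1 4] \<rho>4 lt row_dist_wide(7) by simp
  then have \<rho>1: "\<rho> 1 = 1" using low[of 1] row_dist_wide(4) \<rho>0 eq_iff[of 1 0] by auto
  have \<rho>2: "\<rho> 2 = 2" using low[of 2] \<rho>0 \<rho>1 eq_iff[of 2 0] eq_iff[of 2 1] by auto
  consider "i = 0" | "i = 1" | "i = 2" | "i = 3" | "4 \<le> i" by linarith
  then show ?thesis by cases (use \<rho>0 \<rho>1 \<rho>2 \<rho>3 high \<open>i < a\<close> in simp_all)
qed

lemma bip_rigid_wide: "bip_rigid a wide"
proof (rule bip_rigidI)
  show "wide \<subseteq> {..<a} \<times> {..<a}" using regular_wide by (simp add: regular_def)
next
  fix \<rho> :: "nat \<Rightarrow> nat" and i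
  assume "\<rho> permutes {..<a}" "\<And>i j. i < a \<Longrightarrow> j < a \<Longrightarrow> row_dist wide (\<rho> i) (\<rho> j) = row_dist wide i j" "i < a"
  then show "\<rho> i = i" by (rule rows_fixed_wide)
next
  fix j j' assume j: "j < j'" "j' < a"
  \<comment> \<open>Row \<open>j'\<close> starts at column \<open>j'\<close> and misses
    \<open>j\<close> unless it wraps around that far; then row \<open>j\<close> serves. The extra
    case is due to column 1, which the switch put into row 3.\<close>
  consider "j' + k \<le> a + j" "\<not> (j = 1 \<and> j' = 3)" | "j = 1" "j' = 3" | "a + j < j' + k" by linarith
  then show "\<exists>i. (i, j) \<in> wide \<longleftrightarrow> (i, j') \<notin> wide"
  proof cases
    case 1
    show ?thesis by (rule exI[of _ j']) (use 1 j k a in \<open>auto simp: mem_wide\<close>)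
  next
    case 2
    show ?thesis by (rule exI[of _ 2]) (use 2 j k a in \<open>auto simp: mem_wide\<close>)
  next
    case 3
    show ?thesis by (rule exI[of _ j]) (use 3 j k a in \<open>auto simp: mem_wide\<close>)
  qed
qed

end

section \<open>Degree three: an isolated row and two paths\<close>

context
  fixes a :: nat
  assumes a: "9 \<le> a"
begin

text \<open>Moving column 5 from row 5 to row 0 and column 1 the other way isolates row 0 and
  separates rows 4 and 5; the paths 1, ..., 4 and 5, ..., \<open>a - 1\<close> remain.\<close>

abbreviation "cubic \<equiv> switched a 3 5 5"

lemma mem_cubic:
  "(i, j) \<in> cubic \<longleftrightarrow> i < a \<and> j < a \<and> (if i = 0 then j = 0 \<or> j = 2 \<or> j = 5
     else if i = 5 then j = 1 \<or> j = 6 \<or> j = 7 else i \<le> j \<and> j < i + 3 \<or> j + a < i + 3)"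
  using a by (auto simp: switched_def band_def)

lemma regular_cubic: "regular a 3 cubic"
  unfolding switched_def using a
  by (intro regular_switch regular_band) (auto simp: band_def)

lemma cubic_far_0: "0 < j \<Longrightarrow> j < a \<Longrightarrow> \<not> adjacent cubic 0 j"
proof -
  assume j: "0 < j" "j < a"
  note far = not_adjacentI[OF regular_finite[OF regular_cubic], of _ _ 0 j]
  consider "j \<le> 2" | "3 \<le> j" "j + 3 \<le> a" | "a < j + 3" using j by linarith
  then show ?thesis
  proof cases
    case 1 show ?thesis by (rule far[of 0 5]) (use 1 j a in \<open>auto simp: mem_cubic\<close>)
  next
    case 2 show ?thesis by (rule far[of 0 2]) (use 2 j a in \<open>auto simp: mem_cubic\<close>)
  next
    case 3 show ?thesis by (rule far[of 2 5]) (use 3 j a in \<open>auto simp: mem_cubic\<close>)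
  qed
qed

lemma cubic_far_5: "0 < j \<Longrightarrow> j < a \<Longrightarrow> j \<noteq> 6 \<Longrightarrow> \<not> adjacent cubic 5 j"
proof -
  assume j: "0 < j" "j < a" "j \<noteq> 6"
  note far = not_adjacentI[OF regular_finite[OF regular_cubic], of _ _ 5 j]
  consider "j = 1 \<or> j = a - 1" | "2 \<le> j" "j \<le> 4" | "j = 5" | "7 \<le> j" "j + 2 \<le> a" using j by linarith
  then show ?thesis
  proof cases
    \<comment> \<open>The use of \<open>a \<ge> 9\<close>: row \<open>a - 1\<close> has the columns
      \<open>a - 1\<close>, 0 and 1, and must not contain 7.\<close>
    case 1 show ?thesis by (rule far[of 6 7]) (use 1 j a in \<open>auto simp: mem_cubic\<close>)
  next
    case 2 show ?thesis by (rule far[of 1 7]) (use 2 j a in \<open>auto simp: mem_cubic\<close>)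
  next
    case 4 show ?thesis by (rule far[of 1 6]) (use 4 j a in \<open>auto simp: mem_cubic\<close>)
  qed (simp add: adjacent_def)
qed

lemma adjacent_Suc_cubic: "0 < i \<Longrightarrow> i \<noteq> 4 \<Longrightarrow> Suc i < a \<Longrightarrow> adjacent cubic i (Suc i)"
  by (rule adjacentI[where d = "if i = 5 then 1 else i"]) (use a in \<open>auto simp: mem_cubic split: if_splits\<close>)

text \<open>For \<open>a = 9\<close> both paths have four rows, so their lengths do not tell them
  apart. Distance to row 0 singles out the end 5; distance to row \<open>a - 1\<close> then
  separates the ends 1 and 4.\<close>

lemma row_dist_cubic:
  "row_dist cubic 0 1 \<le> 2" "row_dist cubic 0 4 \<le> 2" "row_dist cubic 0 (a - 1) \<le> 2" "row_dist cubic (a - 1) 1 \<le> 2"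
  "3 \<le> row_dist cubic 0 5" "3 \<le> row_dist cubic (a - 1) 4"
proof -
  note fin = regular_finite[OF regular_cubic]
  show "row_dist cubic 0 1 \<le> 2" by (rule row_dist_le2[where x = "0" and y = "5"]) (use a in \<open>auto simp: mem_cubic split: if_splits\<close>)
  show "row_dist cubic 0 4 \<le> 2" by (rule row_dist_le2[where x = "0" and y = "2"]) (use a in \<open>auto simp: mem_cubic split: if_splits\<close>)
  show "row_dist cubic 0 (a - 1) \<le> 2" by (rule row_dist_le2[where x = "2" and y = "5"]) (use a in \<open>auto simp: mem_cubic split: if_splits\<close>)
  show "row_dist cubic (a - 1) 1 \<le> 2"
    by (rule row_dist_le2[where x = "a - 1" and y = "0"]) (use a in \<open>auto simp: mem_cubic split: if_splits\<close>)
  show "3 \<le> row_dist cubic 0 5" by (rule row_dist_ge3[OF fin, of "0" "2" "5"]) (use a in \<open>auto simp: mem_cubic\<close>)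
  show "3 \<le> row_dist cubic (a - 1) 4"
    by (rule row_dist_ge3[OF fin, of "a - 1" "0" "1"]) (use a in \<open>auto simp: mem_cubic\<close>)
qed

lemma rows_fixed_cubic:
  assumes "\<rho> permutes {..<a}" "\<And>i j. i < a \<Longrightarrow> j < a \<Longrightarrow> row_dist cubic (\<rho> i) (\<rho> j) = row_dist cubic i j"
    and "i < a"
  shows "\<rho> i = i"
proof -
  interpret row_automorphism a 3 cubic \<rho>
    using regular_cubic assms by unfold_locales auto
  have lt: "0 < a" "1 < a" "2 < a" "3 < a" "4 < a" "5 < a" "6 < a" using a by auto
  have far: "\<not> adjacent cubic i j \<and> \<not> adjacent cubic j i"
    if "0 < i" "i + 2 \<le> j" "j < a" "i \<noteq> 5" "j \<noteq> 5" for i j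
    using switched_far[of 3 a i j 5 5] that a adjacent_commute[of i j] by simp
  have not_0: "\<not> adjacent cubic j 0" if "0 < j" "j < a" for j
    using cubic_far_0[OF that] adjacent_commute[of j 0] that lt by simp
  have not_5: "\<not> adjacent cubic j 5" if "0 < j" "j < a" "j \<noteq> 6" for j
    using cubic_far_5[OF that] adjacent_commute[of j 5] that lt by simp
  have nbr: "j = i - 1 \<or> j = Suc i" if "0 < i" "i < a" "j < a" "adjacent cubic i j" for i j
  proof -
    have "\<not> adjacent cubic i 0" using not_0[of i] that by simp
    then have "j \<noteq> 0" using that(4) by metis
    have "j \<noteq> i" using that by (simp add: adjacent_def)
    consider "i = 5" | "j = 5" | "i \<noteq> 5" "j \<noteq> 5" by blast
    then show ?thesis
    proof cases
      case 1
      then have "j = 6" using cubic_far_5[of j] that \<open>j \<noteq> 0\<close> by auto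
      then show ?thesis using 1 by simp
    next
      case 2
      then have "i = 6" using not_5[of i] that by auto
      then show ?thesis using 2 by simp
    next
      case 3
      then have "\<not> i + 2 \<le> j" "\<not> j + 2 \<le> i" using far[of i j] far[of j i] that \<open>j \<noteq> 0\<close> by auto
      then show ?thesis using \<open>j \<noteq> i\<close> by linarith
    qed
  qed
  have nbr5: "j = Suc 5" if "j < a" "adjacent cubic 5 j" for j
    using cubic_far_5[of j] not_0[of 5] that lt by (cases "j = 0") auto
  have nbr1: "j = Suc 1" if "j < a" "adjacent cubic 1 j" for j
    using nbr[of 1 j] not_0[of 1] that lt by auto
  have rev_Suc: "adjacent cubic (Suc i) i" if "0 < i" "i \<noteq> 4" "Suc i < a" for i
    using adjacent_Suc_cubic[OF that] adjacent_commute[of i "Suc i"] that by simp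
  have \<rho>0: "\<rho> 0 = 0"
  proof (rule isolated_fixed)
    fix j assume "j < a"
    then show "\<not> adjacent cubic 0 j" using cubic_far_0[of j] by (cases "j = 0") (auto simp: adjacent_def)
  next
    fix i assume i: "i < a" "i \<noteq> 0"
    show "\<exists>j<a. adjacent cubic i j"
    proof (cases "i = 4 \<or> Suc i = a")
      case True
      then show ?thesis using rev_Suc[of "i - 1"] i a by (intro exI[of _ "i - 1"]) auto
    next
      case False
      then show ?thesis using adjacent_Suc_cubic[of i] i by (intro exI[of _ "Suc i"]) auto
    qed
  qed (rule lt(1))
  have inner: False
    if s: "s < a" "\<And>j. j < a \<Longrightarrow> adjacent cubic s j \<Longrightarrow> j = Suc s"
      and m: "1 < \<rho> s" "\<rho> s \<noteq> 4" "\<rho> s \<noteq> 5" "Suc (\<rho> s) < a" for s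
  proof -
    have "0 < \<rho> s - 1" "\<rho> s - 1 \<noteq> 4" "Suc (\<rho> s - 1) = \<rho> s" using m by auto
    then have "adjacent cubic (\<rho> s) (\<rho> s - 1)" using rev_Suc[of "\<rho> s - 1"] m by simp
    then show False using leaf_not_inner[OF s] adjacent_Suc_cubic[of "\<rho> s"] m by simp
  qed
  have \<rho>5: "\<rho> 5 = 5"
  proof (rule ccontr)
    assume ne: "\<rho> 5 \<noteq> 5"
    have "3 \<le> row_dist cubic 0 (\<rho> 5)" using dist[of 0 5] \<rho>0 lt row_dist_cubic(5) by simp
    then have "\<rho> 5 \<noteq> 1" "\<rho> 5 \<noteq> 4" "\<rho> 5 \<noteq> a - 1" using row_dist_cubic(1-3) by auto
    moreover have "\<rho> 5 \<noteq> 0" using \<rho>0 eq_iff[of 5 0] by simp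
    moreover have "\<rho> 5 < a" using less_iff lt by simp
    ultimately show False using inner[OF lt(6) nbr5] ne by linarith
  qed
  have high: "\<rho> i = i" if "5 \<le> i" "i < a" for i
    by (rule adjacent_path_fixed[of "a - 1" 5]) (use that lt \<rho>5 nbr5 nbr adjacent_Suc_cubic in auto)
  have \<rho>1: "\<rho> 1 = 1"
  proof (rule ccontr)
    assume ne: "\<rho> 1 \<noteq> 1"
    have "\<rho> 1 < a" using less_iff lt by simp
    then have "\<not> 5 \<le> \<rho> 1" using high[of "\<rho> 1"] eq_iff[of "\<rho> 1" 1] by auto
    moreover have "\<rho> 1 \<noteq> 0" using \<rho>0 eq_iff[of 1 0] by simp
    moreover have "row_dist cubic (a - 1) (\<rho> 1) \<le> 2"
      using dist[of "a - 1" 1] high[of "a - 1"] a row_dist_cubic(4) by simp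
    then have "\<rho> 1 \<noteq> 4" using row_dist_cubic(6) by auto
    ultimately show False using inner[OF lt(2) nbr1] ne a by linarith
  qed
  have low: "\<rho> i = i" if "1 \<le> i" "i \<le> 4" for i
    by (rule adjacent_path_fixed[of 4 1]) (use that lt \<rho>1 nbr1 nbr adjacent_Suc_cubic in auto)
  consider "i = 0" | "1 \<le> i" "i \<le> 4" | "5 \<le> i" by linarith
  then show ?thesis by cases (use \<rho>0 low high \<open>i < a\<close> in simp_all)
qed

lemma bip_rigid_cubic: "bip_rigid a cubic"
proof (rule bip_rigidI)
  show "cubic \<subseteq> {..<a} \<times> {..<a}" using regular_cubic by (simp add: regular_def)
next
  fix \<rho> :: "nat \<Rightarrow> nat" and i
  assume "\<rho> permutes {..<a}" "\<And>i j. i < a \<Longrightarrow> j < a \<Longrightarrow> row_dist cubic (\<rho> i) (\<rho> j) = row_dist cubic i j" "i < a"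
  then show "\<rho> i = i" by (rule rows_fixed_cubic)
next
  fix j j' assume j: "j < j'" "j' < a"
  \<comment> \<open>In general row \<open>j'\<close> or row \<open>j\<close> distinguishes the
    columns. Column 5 has left row 5, so rows 0 and 4 serve there.\<close>
  consider "j' = 5" "j = 4" | "j' = 5" "j < 4" | "j' \<noteq> 5" "j' + 3 \<le> a + j" | "a + j < j' + 3" using j by linarith
  then show "\<exists>i. (i, j) \<in> cubic \<longleftrightarrow> (i, j') \<notin> cubic"
  proof cases
    case 1
    show ?thesis by (rule exI[of _ 0]) (use 1 a in \<open>auto simp: mem_cubic\<close>)
  next
    case 2
    show ?thesis by (rule exI[of _ 4]) (use 2 a in \<open>auto simp: mem_cubic\<close>)
  next
    case 3
    show ?thesis by (rule exI[of _ j']) (use 3 j a in \<open>auto simp: mem_cubic\<close>)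
  next
    case 4
    show ?thesis by (rule exI[of _ j]) (use 4 j a in \<open>auto simp: mem_cubic\<close>)
  qed
qed

end

section \<open>The base size\<close>

text \<open>The constructions need degree at most \<open>a / 2\<close>. Beyond that the complement
  is used; its degree \<open>a - b\<close> is at least 3 by \<open>b + 3 \<le> a\<close>.\<close>

lemma exists_bip_rigid_regular:
  assumes "3 \<le> b" "b + 3 \<le> a" "8 \<le> a"
  obtains E where "regular a b E" "bip_rigid a E"
proof -
  have half: "\<exists>E. regular a k E \<and> bip_rigid a E" if k: "3 \<le> k" "2 * k \<le> a" for k
  proof -
    consider "4 \<le> k" | "k = 3" "9 \<le> a" | "k = 3" "a = 8" using k assms by linarith
    then show ?thesis
    proof cases
      case 1
      then show ?thesis using regular_wide bip_rigid_wide k(2) by blast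
    next
      case 2
      then show ?thesis using regular_cubic bip_rigid_cubic by blast
    next
      case 3
      then show ?thesis using regular_graph8 bip_rigid_graph8 by blast
    qed
  qed
  show thesis
  proof (cases "2 * b \<le> a")
    case True
    then show thesis using half[OF assms(1)] that by blast
  next
    case False
    then have "3 \<le> a - b" "2 * (a - b) \<le> a" using assms(2) by auto
    from half[OF this] obtain E where E: "regular a (a - b) E" "bip_rigid a E" by blast
    have "regular a (a - (a - b)) (bip_compl a E)" by (rule regular_compl[OF E(1)])
    moreover have "bip_rigid a (bip_compl a E)"
      using bip_rigid_compl E by (auto simp: regular_def)
    moreover have "a - (a - b) = b" using assms(2) by simp
    ultimately show thesis using that by metis
  qed
qed

text \<open>Two points of the same class can be transposed.\<close>

lemma one_not_separating:
  assumes "balanced X a b f" "0 < a" "2 \<le> b"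
  shows "\<not> separating X [f]"
proof -
  have "2 \<le> card {x \<in> X. f x = 0}" using assms by (simp add: balanced_def)
  then obtain Y where Y: "Y \<subseteq> {x \<in> X. f x = 0}" "card Y = 2"
    by (rule obtain_subset_with_card_n)
  then obtain x y where xy: "x \<in> X" "y \<in> X" "f x = 0" "f y = 0" "x \<noteq> y"
    by (auto simp: card_2_iff)
  then have "f (transpose x y z) = f z" for z by (auto simp: transpose_def)
  then have "preserves X f (transpose x y)" by (simp add: preserves_def)
  moreover have "transpose x y \<noteq> id" using xy(5) by (metis id_apply transpose_apply_first)
  ultimately show ?thesis
    using permutes_swap_id[OF xy(1,2)] by (auto simp: separating_def)
qed

lemma three_labellings:
  assumes "b \<le> a" "3 \<le> b \<or> b = 2 \<and> 4 \<le> a"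
  obtains fs where "length fs = 3" "\<forall>f\<in>set fs. balanced {..<a * b} a b f" "separating {..<a * b} fs"
proof (cases "3 \<le> b")
  case True
  then interpret three_partitions a b using assms(1) by unfold_locales
  obtain fs where "length fs = length [fst, snd, third]"
      "\<forall>f\<in>set fs. balanced {..<a * b} a b f" "separating {..<a * b} fs"
    by (rule separating_on_nat[OF finite_band _ _ three_separating])
      (use regular_balanced[OF regular_band[OF assms(1)]] balanced_third in auto)
  then show thesis using that[of fs] by (simp add: numeral_3_eq_3)
next
  case False
  then interpret three_pairings a using assms(2) by unfold_locales auto
  have "b = 2" using False assms(2) by simp
  then show thesis
    using that[of "[pairing1, pairing2, pairing3]"] three_pairings_separating
      balanced_pairing1 balanced_pairing2 balanced_pairing3
    by (simp add: mult.commute)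
qed

theorem theorem2:
  fixes a b n :: nat
  assumes "n = a * b" and "a \<ge> b" and "b \<ge> 2" and "(a, b) \<noteq> (2, 2)"
  shows "base_size (Sym n) (stab n (std_partition a b)) =
           (if (a, b) = (3, 2) then 4
            else if b \<ge> 3 \<and> a \<ge> max (b + 3) 8 then 2
            else 3)"
proof -
  have b0: "0 < b" and a0: "0 < a" using assms by auto
  note base_size = base_size_eq_Suc[OF assms(1) b0]
  consider "(a, b) = (3, 2)" | "3 \<le> b" "max (b + 3) 8 \<le> a"
    | "(a, b) \<noteq> (3, 2)" "\<not> (3 \<le> b \<and> max (b + 3) 8 \<le> a)"
    by blast
  then show ?thesis
  proof cases
    case 1
    then have ab: "a = 3" "b = 2" "n = 6" using assms(1) by auto
    have "base_size (Sym n) (stab n (std_partition a b)) = Suc 3"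
    proof (rule base_size)
      fix fs :: "(nat \<Rightarrow> nat) list"
      assume "length fs = 3" and bal: "\<forall>f\<in>set fs. balanced {..<n} a b f"
      then obtain f g h where "fs = [f, g, h]" by (auto simp: length_Suc_conv numeral_3_eq_3)
      then show "\<not> separating {..<n} fs"
        using three_pairings6_not_separating bal unfolding ab by simp
    qed (use four_pairings in \<open>simp_all add: ab\<close>)
    then show ?thesis using 1 by simp
  next
    case 2
    then obtain E where E: "regular a b E" "bip_rigid a E"
      using exists_bip_rigid_regular by auto
    obtain fs where "length fs = length [fst, snd :: nat \<times> nat \<Rightarrow> nat]"
        "\<forall>f\<in>set fs. balanced {..<a * b} a b f" "separating {..<a * b} fs"
      by (rule separating_on_nat[OF regular_finite[OF E(1)] _ _ bip_rigid_imp_separating[OF E b0]])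
        (use regular_balanced[OF E(1)] in auto)
    moreover have "\<not> separating {..<n} gs"
      if gs: "length gs = 1" "\<forall>g\<in>set gs. balanced {..<n} a b g" for gs :: "(nat \<Rightarrow> nat) list"
    proof -
      obtain g where "gs = [g]" using gs(1) by (auto simp: length_Suc_conv)
      then show ?thesis using one_not_separating gs(2) a0 assms(3) by simp
    qed
    ultimately have "base_size (Sym n) (stab n (std_partition a b)) = Suc 1"
      using assms(1) by (intro base_size) auto
    then show ?thesis using 2 by auto
  next
    case 3
    \<comment> \<open>The forbidden degree, of the graph or of its complement. The last branch is
      reached only for \<open>(a, b)\<close> equal to (6,3), (7,3) or (7,4), where
      \<open>b = 3\<close> or \<open>a - b = 3\<close>.\<close>
    define k where "k = (if b = 2 then 2 else if a < b + 3 then a - b else 3)"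
    have small: "a < b + 3 \<or> a < 8" if "b \<noteq> 2" using 3(2) that assms(3) by auto
    have k: "k \<le> 2 \<or> k = 3 \<and> (a = 6 \<or> a = 7)" "b = k \<or> b + k = a"
      using small assms(2,3) unfolding k_def by (auto simp del: One_nat_def split: if_splits; linarith)+
    have "\<not> separating {..<n} gs"
      if gs: "length gs = 2" "\<forall>g\<in>set gs. balanced {..<n} a b g" for gs :: "(nat \<Rightarrow> nat) list"
    proof
      assume sep: "separating {..<n} gs"
      obtain f g where fg: "gs = [f, g]" using gs(1) by (auto simp: length_Suc_conv numeral_2_eq_2)
      then obtain E where "regular a b E" "bip_rigid a E"
        using separating_imp_bip_rigid[of "{..<n}" a b f g] gs(2) sep b0 by auto
      then show False using no_rigid_regular[OF _ k(1) _ k(2)] assms(2,3) by simp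
    qed
    moreover obtain fs where "length fs = 3" "\<forall>f\<in>set fs. balanced {..<a * b} a b f"
        "separating {..<a * b} fs"
    proof (rule three_labellings[OF assms(2)])
      show "3 \<le> b \<or> b = 2 \<and> 4 \<le> a" using 3(1) assms(2-4) by auto
    qed
    ultimately have "base_size (Sym n) (stab n (std_partition a b)) = Suc 2"
      using assms(1) by (intro base_size) auto
    then show ?thesis using 3 by auto
  qed
qed

end
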